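(* Let $d\ge1$ and $\alpha\in(0,2)$, and let $(X_n)_{n\ge1}$ be i.i.d. random vectors in $\mathbb{R}^d$ with density $$p(x)=\frac{\alpha\,\Gamma(\frac d2+1)}{\pi^{d/2}\,d\,|x|^{d+\alpha}}\,\mathbf 1_{[1,+\infty)}(|x|).$$ Let $\nu_0$ be the uniform probability measure on $\mathbb{S}^{d-1}$ and let $\mu_n^\alpha$ be the distribution of $S_n=\frac{1}{n^{1/\alpha}\sigma}\sum_{i=1}^n(X_i-\omega_{n,\alpha})$. Then there exist constants $C,c>0$ (not depending on $n$) such that $$c\,n^{-\frac{(2-\alpha)\wedge\alpha}{\alpha}}\le d_{\mathrm{TV}}(\mu_n^\alpha,S_\alpha(\nu_0))\le C\,n^{-\frac{(2-\alpha)\wedge\alpha}{\alpha}},\qquad\forall n\ge1.$$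
   Context: Total variation distance: for probability measures $\mu,\mu'$ on $\mathbb{R}^d$, $d_{\mathrm{TV}}(\mu,\mu')=\inf_\pi \pi(\{(x,y):x\ne y\})$, the infimum over all couplings $\pi$ of $\mu$ and $\mu'$. Stable law: for $\alpha\in(0,2)$ and a probability measure $\nu$ on $\mathbb{S}^{d-1}$, $S_\alpha(\nu)$ is the distribution of a random vector $Y$ with $\mathbb{E}[e^{i\langle\lambda,Y\rangle}]=\exp\left(-\int_{\mathbb{S}^{d-1}}\psi_\alpha(\langle\lambda,\theta\rangle)\,\nu(d\theta)\right)$, where $\psi_\alpha(t)=|t|^\alpha\left(1-i\,\mathrm{sgn}(t)\tan\frac{\pi\alpha}{2}\right)$ for $\alpha\ne1$ and $\psi_1(t)=|t|\left(1+i\frac{2}{\pi}\mathrm{sgn}(t)\ln|t|\right)$. Normalization: $\sigma=\left(A\alpha\int_0^{+\infty}\frac{1-\cos y}{y^{1+\alpha}}\,dy\right)^{1/\alpha}$, where $A$ is the tail constant of $X_1$, i.e. $\mathbb{P}(|X_1|\ge r)\sim A r^{-\alpha}$ as $r\to\infty$ (here $A=1$); $\omega_{n,\alpha}=\mathbb{E}X_1$ if $\alpha\in(1,2)$, $\omega_{n,1}=\mathbb{E}[X_1\mathbf 1_{(0,\sigma n]}(|X_1|)]$, and $\omega_{n,\alpha}=\mathbf 0$ if $\alpha\in(0,1)$. $a\wedge b=\min\{a,b\}$, and $\Gamma$ is the gamma function. *)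

theory Defs
  imports "HOL-Probability.Probability"
begin

definition couplings :: "'a::euclidean_space measure \<Rightarrow> 'a measure \<Rightarrow> ('a \<times> 'a) measure set" where
  "couplings \<mu> \<mu>' = {\<pi>. sets \<pi> = sets (borel \<Otimes>\<^sub>M borel) \<and>
     distr \<pi> borel fst = \<mu> \<and> distr \<pi> borel snd = \<mu>'}"

definition d_TV :: "'a::euclidean_space measure \<Rightarrow> 'a measure \<Rightarrow> real" where
  "d_TV \<mu> \<mu>' = (INF \<pi>\<in>couplings \<mu> \<mu>'. measure \<pi> {(x, y). x \<noteq> y})"

definition stable_exponent :: "real \<Rightarrow> real \<Rightarrow> complex" where
  "stable_exponent \<alpha> t =
     (if \<alpha> = 1
      then complex_of_real \<bar>t\<bar> * (1 + \<i> * complex_of_real (2 / pi * sgn t * ln \<bar>t\<bar>))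
      else complex_of_real (\<bar>t\<bar> powr \<alpha>) * (1 - \<i> * complex_of_real (sgn t * tan (pi * \<alpha> / 2))))"

text \<open>
  The law is determined by its characteristic function. Measures on the unit sphere are
  represented as Borel measures \<open>\<nu>\<close> on the ambient space giving full mass to \<open>sphere 0 1\<close>.
\<close>

definition stable_law :: "real \<Rightarrow> 'a::euclidean_space measure \<Rightarrow> 'a measure" where
  "stable_law \<alpha> \<nu> = (THE Q. prob_space Q \<and> sets Q = sets borel \<and>
     (\<forall>l. (CLINT y|Q. iexp (l \<bullet> y)) =
          exp (- (CLINT \<theta>:sphere 0 1|\<nu>. stable_exponent \<alpha> (l \<bullet> \<theta>)))))"

text \<open>
  Uniform distribution (normalized surface measure) on the unit sphere, obtained by radially
  projecting the uniform distribution on the unit ball; the origin is a null set. In dimension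
  one it gives mass one half to each of the two unit vectors.
\<close>

definition uniform_sphere :: "'a::euclidean_space measure" where
  "uniform_sphere = distr (uniform_measure lborel (ball 0 1)) borel (\<lambda>x. x /\<^sub>R norm x)"

lemma radial_projection_measurable [measurable]:
  "(\<lambda>x::'a::euclidean_space. x /\<^sub>R norm x) \<in> borel_measurable borel"
  by measurable

lemma emeasure_ball01: "0 < emeasure lborel (ball (0::'a::euclidean_space) 1)"
  "emeasure lborel (ball (0::'a) 1) < \<infinity>"
  using emeasure_ball[of 1 "0::'a"] by (simp_all add: unit_ball_vol_pos)

lemma prob_space_uniform_sphere: "prob_space (uniform_sphere :: 'a::euclidean_space measure)"
  unfolding uniform_sphere_def
  by (intro prob_space.prob_space_distr prob_space_uniform_measure)
     (use emeasure_ball01[where 'a='a] in auto)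

lemma AE_uniform_sphere: "AE \<theta> in (uniform_sphere :: 'a::euclidean_space measure). \<theta> \<in> sphere 0 1"
proof -
  have "AE x in lborel. x \<noteq> (0::'a)"
    by (rule AE_I[of _ _ "{0}"]) auto
  then have "AE x in uniform_measure lborel (ball 0 1). x /\<^sub>R norm x \<in> sphere (0::'a) 1"
    by (intro AE_uniform_measureI) (auto simp: dist_norm elim!: eventually_mono)
  then show ?thesis
    unfolding uniform_sphere_def
    by (subst AE_distr_iff) (auto simp: dist_norm)
qed

definition pareto_density :: "real \<Rightarrow> 'a::euclidean_space \<Rightarrow> real" where
  "pareto_density \<alpha> x =
     \<alpha> * Gamma (real DIM('a) / 2 + 1) /
       (pi powr (real DIM('a) / 2) * real DIM('a) * norm x powr (real DIM('a) + \<alpha>)) *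
     indicator {1..} (norm x)"

text \<open>\<open>A\<close> is the tail constant: the norm of the summands exceeds \<open>r\<close> with probability
  asymptotic to \<open>A * r powr (- \<alpha>)\<close>.\<close>

definition stable_scale :: "real \<Rightarrow> real \<Rightarrow> real" where
  "stable_scale A \<alpha> =
     (A * \<alpha> * (LBINT y:{0<..}. (1 - cos y) / y powr (1 + \<alpha>))) powr (1 / \<alpha>)"

definition centering ::
  "'w measure \<Rightarrow> ('w \<Rightarrow> 'a::euclidean_space) \<Rightarrow> real \<Rightarrow> real \<Rightarrow> nat \<Rightarrow> 'a" where
  "centering M X \<sigma> \<alpha> n =
     (if \<alpha> > 1 then (LINT w|M. X w)
      else if \<alpha> = 1 then (LINT w|M. indicator {0<..\<sigma> * real n} (norm (X w)) *\<^sub>R X w)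
      else 0)"

definition normalized_sum ::
  "'w measure \<Rightarrow> (nat \<Rightarrow> 'w \<Rightarrow> 'a::euclidean_space) \<Rightarrow> real \<Rightarrow> real \<Rightarrow> nat \<Rightarrow> 'w \<Rightarrow> 'a" where
  "normalized_sum M X \<sigma> \<alpha> n w =
     (1 / (real n powr (1 / \<alpha>) * \<sigma>)) *\<^sub>R (\<Sum>i=1..n. X i w - centering M (X 1) \<sigma> \<alpha> n)"

end

theory Submission
  imports Defs "HOL-Real_Asymp.Real_Asymp"
begin

text \<open>
  Let \<open>T g x\<close> be the expectation of \<open>g (x + X)\<close>, acting on bounded Borel functions. The Pareto law
  conditioned on large norms is a dilation of itself; hence the operator \<open>T'\<close> of the dilated variable
  \<open>2 powr (1 / \<alpha>) *\<^sub>R X\<close> satisfies \<open>T * T - T' = (T - 1) * (T - 1) + K\<close>, where \<open>K\<close> is the average of second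
  differences over a bounded set. Powers of \<open>T\<close> and \<open>T'\<close> smooth at the scale \<open>n powr (1 / \<alpha>)\<close> in total
  variation, so that after \<open>n\<close> steps \<open>T - 1\<close> has norm \<open>O(1 / n)\<close> and \<open>K\<close> has norm \<open>O(n powr (- 2 / \<alpha>))\<close>.
  Telescoping over \<open>n\<close> steps bounds the distance of the laws of the normalised sums for \<open>n\<close> and \<open>2 * n\<close>
  by the rate of the theorem. Along \<open>n * 2 ^ j\<close> the densities are therefore Cauchy in mean; the limit is
  identified as the stable law by characteristic functions, and the geometric series gives the upper bound.

  The lower bound compares the characteristic functions at a single frequency: the deviation is
  \<open>n\<close> times the second-order term of the expansion of the characteristic function of \<open>X\<close> at
  a point of norm of order \<open>n powr (- 1 / \<alpha>)\<close>.
\<close>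

section \<open>Convolution operators\<close>

text \<open>The operator norm on bounded functions is dual to total variation, so the estimates are
  made for test functions, and densities of the n-fold sums appear only when a limit in mean is
  needed. Comparing n with 2 n, rather than a sum with the stable law directly, avoids all
  regularity of stable densities. Since X is symmetric, the centering vanishes and first-order terms
  cancel; \<open>T - 1\<close> as well as \<open>K\<close> then averages second differences.
  Smoothing by two halves of the walk makes a second difference with step h of order |h|^2
  n^(-2/\<alpha>); min(1, |h|^2 n^(-2/\<alpha>)) integrated against the Pareto law gives 1/n. The
  telescoping sum is n (n^(-2) + n^(-2/\<alpha>)), and its exponents -1 and 1 - 2/\<alpha> are the
  two branches of the rate. The lower bound has two competing terms: the second-order term of the
  exponential, of size s^(2 \<alpha>), and the missing small jumps, of size s^2. Their signs are
  opposite, so \<alpha> = 1, where the sizes agree, requires a direction without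
  cancellation.\<close>

definition bdd_borel :: "real \<Rightarrow> ('a::euclidean_space \<Rightarrow> real) \<Rightarrow> bool" where
  "bdd_borel B g \<longleftrightarrow> g \<in> borel_measurable borel \<and> (\<forall>x. \<bar>g x\<bar> \<le> B)"

text \<open>The kernel may be signed: differences of densities, as they arise from translating or
  splitting a step, are fed to the same operator.\<close>

definition conv_op :: "('a::euclidean_space \<Rightarrow> real) \<Rightarrow> ('a \<Rightarrow> real) \<Rightarrow> 'a \<Rightarrow> real" where
  "conv_op q g x = (LINT y|lborel. q y * g (x + y))"

lemma bdd_borelD: "bdd_borel B g \<Longrightarrow> g \<in> borel_measurable borel" "bdd_borel B g \<Longrightarrow> \<bar>g x\<bar> \<le> B"
  "bdd_borel B g \<Longrightarrow> 0 \<le> B"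
  by (auto simp: bdd_borel_def intro: order_trans[OF abs_ge_zero])

lemma bdd_borel_shift:
  assumes "bdd_borel B g" shows "bdd_borel B (\<lambda>x. g (x + h))"
  using assms bdd_borelD(1)[OF assms, measurable] by (auto simp: bdd_borel_def)

lemma bdd_borel_scale:
  assumes "bdd_borel B g" shows "bdd_borel B (\<lambda>x. g (c *\<^sub>R x))"
  using assms bdd_borelD(1)[OF assms, measurable] by (auto simp: bdd_borel_def)

lemma bdd_borel_diff:
  assumes "bdd_borel B f" "bdd_borel D g" shows "bdd_borel (B + D) (\<lambda>x. f x - g x)"
  using assms bdd_borelD(1)[OF assms(1), measurable] bdd_borelD(1)[OF assms(2), measurable]
  by (auto simp: bdd_borel_def intro!: order_trans[OF abs_triangle_ineq4] add_mono)

lemma integrable_mult_bdd: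
  assumes q: "integrable M (q::_ \<Rightarrow> real)" and g: "g \<in> borel_measurable M" "\<And>x. \<bar>g x\<bar> \<le> B"
  shows "integrable M (\<lambda>y. q y * g y)"
proof -
  have "integrable M (\<lambda>y. g y *\<^sub>R q y)"
    by (rule Bochner_Integration.integrable_bound[where f="\<lambda>y. B * \<bar>q y\<bar>"])
       (use q g in \<open>auto simp: abs_mult intro!: mult_right_mono AE_I2 integrable_abs order_trans[OF g(2) abs_ge_self]\<close>)
  then show ?thesis by (simp add: mult.commute)
qed

lemma conv_op_integrable:
  assumes q: "integrable lborel q" and g: "bdd_borel B g"
  shows "integrable lborel (\<lambda>y. q y * g (x + y))"
  using bdd_borelD[OF g]
  by (intro integrable_mult_bdd[OF q, where B=B]) (auto intro: measurable_compose[where g=g])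

lemma integrable_lborel_shift:
  fixes q :: "'a::euclidean_space \<Rightarrow> real"
  assumes "integrable lborel q" shows "integrable lborel (\<lambda>y. q (y - h))"
proof -
  have "integrable (distr lborel borel ((+) (-h))) q"
    using assms by (simp add: lborel_distr_plus)
  then show ?thesis by (subst (asm) integrable_distr_eq) (use assms in auto)
qed

lemma integral_lborel_shift:
  fixes q :: "'a::euclidean_space \<Rightarrow> real"
  assumes "q \<in> borel_measurable borel" shows "(LINT y|lborel. q (y - h)) = (LINT y|lborel. q y)"
proof -
  have "(LINT y|distr lborel borel ((+) (-h)). q y) = (LINT y|lborel. q (y - h))"
    by (subst integral_distr) (use assms in auto)
  then show ?thesis by (simp add: lborel_distr_plus)
qed

lemma conv_op_measurable:
  assumes [measurable]: "q \<in> borel_measurable borel" and g: "bdd_borel B g"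
  shows "conv_op q g \<in> borel_measurable borel"
proof -
  note [measurable] = bdd_borelD(1)[OF g]
  show ?thesis unfolding conv_op_def by measurable
qed

text \<open>Young's inequality: the L1 norm of the kernel bounds the operator norm for the supremum.
  A probability density thus acts as a contraction, which is how surplus steps of a walk are
  disposed of.\<close>

lemma bdd_borel_conv_op:
  assumes q: "integrable lborel q" "(LINT y|lborel. \<bar>q y\<bar>) \<le> N" and g: "bdd_borel B g"
  shows "bdd_borel (N * B) (conv_op q g)"
  unfolding bdd_borel_def
proof safe
  show "conv_op q g \<in> borel_measurable borel"
    using q g by (intro conv_op_measurable) auto
  fix x
  have "\<bar>conv_op q g x\<bar> \<le> (LINT y|lborel. \<bar>q y * g (x + y)\<bar>)"
    unfolding conv_op_def by (rule integral_abs_bound)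
  also have "\<dots> \<le> (LINT y|lborel. \<bar>q y\<bar> * B)"
    by (intro integral_mono integrable_abs conv_op_integrable[OF q(1) g] integrable_mult_left)
       (use q bdd_borelD[OF g] in \<open>auto simp: abs_mult intro!: mult_left_mono\<close>)
  also have "\<dots> = (LINT y|lborel. \<bar>q y\<bar>) * B" by simp
  also have "\<dots> \<le> N * B" using q bdd_borelD(3)[OF g] by (intro mult_right_mono)
  finally show "\<bar>conv_op q g x\<bar> \<le> N * B" .
qed

lemma conv_op_diff:
  assumes "integrable lborel q" "bdd_borel B f" "bdd_borel D g"
  shows "conv_op q (\<lambda>x. f x - g x) x = conv_op q f x - conv_op q g x"
  using conv_op_integrable[OF assms(1,2)] conv_op_integrable[OF assms(1,3)]
  by (simp add: conv_op_def right_diff_distrib)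

lemma conv_op_shift: "conv_op q (\<lambda>x. g (x + h)) x = conv_op q g (x + h)"
  by (simp add: conv_op_def ac_simps)

text \<open>By translation invariance of Lebesgue measure the shift passes from g to the kernel, so
  a merely bounded g acquires the modulus of continuity of q in mean.\<close>

lemma conv_op_modulus:
  assumes q: "integrable lborel q" and g: "bdd_borel B g"
    and w: "(LINT y|lborel. \<bar>q (y - h) - q y\<bar>) \<le> w"
  shows "\<bar>conv_op q g (x + h) - conv_op q g x\<bar> \<le> w * B"
proof -
  have [measurable]: "q \<in> borel_measurable borel" "g \<in> borel_measurable borel"
    using q bdd_borelD[OF g] by auto
  have "conv_op q g (x + h) = (LINT y|lborel. (\<lambda>y. q (y - h) * g (x + y)) (y - (-h)))"
    by (simp add: conv_op_def ac_simps)
  also have "\<dots> = (LINT y|lborel. q (y - h) * g (x + y))"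
    by (rule integral_lborel_shift) measurable
  finally have "conv_op q g (x + h) - conv_op q g x = conv_op (\<lambda>y. q (y - h) - q y) g x"
    using conv_op_integrable[OF q g, of x] conv_op_integrable[OF integrable_lborel_shift[OF q] g, of h x]
    by (simp add: conv_op_def left_diff_distrib)
  moreover have "bdd_borel (w * B) (conv_op (\<lambda>y. q (y - h) - q y) g)"
    using q integrable_lborel_shift[OF q] w g by (intro bdd_borel_conv_op) auto
  ultimately show ?thesis by (simp add: bdd_borelD)
qed

lemma conv_op_commute:
  assumes q: "integrable lborel q" and r: "integrable lborel r" and g: "bdd_borel B g"
  shows "conv_op q (conv_op r g) = conv_op r (conv_op q g)"
proof
  fix x
  have [measurable]: "q \<in> borel_measurable borel" "r \<in> borel_measurable borel" "g \<in> borel_measurable borel"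
    using q r bdd_borelD[OF g] by auto
  have i: "integrable (lborel \<Otimes>\<^sub>M lborel) (\<lambda>(y, z). (q y * r z) * g (x + y + z))"
  proof -
    have "integrable (lborel \<Otimes>\<^sub>M lborel) (\<lambda>w. (q (fst w) * r (snd w)) * g (x + fst w + snd w))"
    proof (rule integrable_mult_bdd[where B=B])
      show "integrable (lborel \<Otimes>\<^sub>M lborel) (\<lambda>w. q (fst w) * r (snd w))"
        by (rule lborel_pair.Fubini_integrable) (use q r in \<open>auto simp: abs_mult\<close>)
    qed (use bdd_borelD[OF g] in auto)
    then show ?thesis by (simp add: split_beta')
  qed
  have "conv_op q (conv_op r g) x = (LINT y|lborel. LINT z|lborel. (q y * r z) * g (x + y + z))"
    by (simp add: conv_op_def mult.assoc)
  also have "\<dots> = (LINT z|lborel. LINT y|lborel. (q y * r z) * g (x + y + z))"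
    using lborel_pair.Fubini_integral[OF i] by simp
  also have "\<dots> = conv_op r (conv_op q g) x"
    by (simp add: conv_op_def ac_simps flip: integral_mult_right_zero)
  finally show "conv_op q (conv_op r g) x = conv_op r (conv_op q g) x" .
qed

lemma conv_op_density_diff:
  assumes "integrable lborel q" "integrable lborel r" "bdd_borel B g"
  shows "conv_op (\<lambda>y. q y - r y) g x = conv_op q g x - conv_op r g x"
  using conv_op_integrable[OF assms(1,3), of x] conv_op_integrable[OF assms(2,3), of x]
  by (simp add: conv_op_def left_diff_distrib)

text \<open>Boundedness of the iterates is part of the induction, because commuting past one more
  factor presupposes a bounded argument.\<close>

lemma conv_op_pow_commute:
  assumes q: "integrable lborel q" "(LINT y|lborel. \<bar>q y\<bar>) \<le> 1" and r: "integrable lborel r" and g: "bdd_borel B g"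
  shows "conv_op r ((conv_op q ^^ k) g) = (conv_op q ^^ k) (conv_op r g) \<and> bdd_borel B ((conv_op q ^^ k) g)"
proof (induction k)
  case (Suc k)
  have "conv_op r ((conv_op q ^^ Suc k) g) = conv_op q (conv_op r ((conv_op q ^^ k) g))"
    using conv_op_commute[OF r q(1), of B "(conv_op q ^^ k) g"] Suc by simp
  also have "\<dots> = (conv_op q ^^ Suc k) (conv_op r g)" using Suc by simp
  finally show ?case using Suc bdd_borel_conv_op[OF q, of B "(conv_op q ^^ k) g"] by simp
qed (use g in simp)

lemma bdd_borel_conv_op_pow:
  assumes q: "integrable lborel q" "(LINT y|lborel. \<bar>q y\<bar>) \<le> 1" and g: "bdd_borel B g"
  shows "bdd_borel B ((conv_op q ^^ k) g)"
  using conv_op_pow_commute[OF q q(1) g] by simp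

lemma conv_op_pow_diff:
  assumes q: "integrable lborel q" "(LINT y|lborel. \<bar>q y\<bar>) \<le> 1" and f: "bdd_borel B f" and g: "bdd_borel D g"
  shows "(conv_op q ^^ k) (\<lambda>x. f x - g x) = (\<lambda>x. (conv_op q ^^ k) f x - (conv_op q ^^ k) g x)"
proof (induction k)
  case (Suc k)
  then show ?case
    using conv_op_diff[OF q(1) bdd_borel_conv_op_pow[OF q f] bdd_borel_conv_op_pow[OF q g]] by auto
qed simp

lemma conv_op_pow_shift: "(conv_op q ^^ k) (\<lambda>x. g (x + h)) = (\<lambda>x. (conv_op q ^^ k) g (x + h))"
proof (induction k)
  case (Suc k)
  then show ?case
    using conv_op_shift[of q "(conv_op q ^^ k) g" h] by auto
qed simp

text \<open>Regularity under translations improves along a random walk: a step is split into its part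
  far from the origin, which is smooth at a large scale, and the rest, which only transports the
  regularity gained so far. Optimising the cut-off in each step gives the exact rate.\<close>

lemma conv_op_pow_lipschitz:
  fixes p :: "'a::euclidean_space \<Rightarrow> real" and \<gamma> C0 :: real
  assumes p: "integrable lborel p" "\<And>y. 0 \<le> p y" "(LINT y|lborel. p y) = 1"
    and pu: "\<And>u. 0 < u \<Longrightarrow> u \<le> 1 \<Longrightarrow> integrable lborel (t u)"
            "\<And>u y. 0 < u \<Longrightarrow> u \<le> 1 \<Longrightarrow> 0 \<le> t u y \<and> t u y \<le> p y"
            "\<And>u. 0 < u \<Longrightarrow> u \<le> 1 \<Longrightarrow> (LINT y|lborel. t u y) = u"
            "\<And>u h. 0 < u \<Longrightarrow> u \<le> 1 \<Longrightarrow>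
               (LINT y|lborel. \<bar>t u (y - h) - t u y\<bar>) \<le> C0 * norm h * u powr (1 + \<gamma>)"
    and \<gamma>: "0 < \<gamma>" and C0: "0 \<le> C0"
  shows "\<exists>C\<ge>0. \<forall>k\<ge>1. \<forall>B g x h. bdd_borel B g \<longrightarrow>
     \<bar>(conv_op p ^^ k) g (x + h) - (conv_op p ^^ k) g x\<bar> \<le> C * B * norm h * real k powr (- \<gamma>)"
proof -
  \<comment> \<open>With cut-off mass u = m/k the transported part carries the factor 1 - m/k \<le>
    (1 - 1/k)^(1 + \<gamma>). This turns (k - 1)^(-\<gamma>) into k^(-\<gamma>) (1 - 1/k), and
    \<open>C\<close> is chosen so that the smooth part of the step fills exactly the remaining
    k^(-\<gamma>) / k.\<close>
  define m where "m = 1 + \<gamma>"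
  define C where "C = C0 * m powr (1 + \<gamma>)"
  have m: "1 < m" using \<gamma> by (simp add: m_def)
  have C: "0 \<le> C" using C0 by (simp add: C_def)
  have p1: "(LINT y|lborel. \<bar>p y\<bar>) \<le> 1" using p by simp
  have step: "\<bar>conv_op p g (x + h) - conv_op p g x\<bar> \<le> (1 - u) * L + C0 * norm h * u powr (1 + \<gamma>) * B"
    if u: "0 < u" "u \<le> 1" and g: "bdd_borel B g" and L: "\<And>x. \<bar>g (x + h) - g x\<bar> \<le> L" for u g B L x h
  proof -
    have L0: "0 \<le> L" using L[of 0] by linarith
    note tu = pu(1)[OF u]
    have r: "integrable lborel (\<lambda>y. p y - t u y)" using p tu by auto
    have ev: "conv_op p g z = conv_op (\<lambda>y. p y - t u y) g z + conv_op (t u) g z" for z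
      using conv_op_density_diff[OF p(1) tu g] by simp
    have "bdd_borel ((1 - u) * L) (conv_op (\<lambda>y. p y - t u y) (\<lambda>x. g (x + h) - g x))"
    proof (rule bdd_borel_conv_op[OF r])
      have "(LINT y|lborel. \<bar>p y - t u y\<bar>) = (LINT y|lborel. p y - t u y)"
        using pu(2)[OF u] by (intro Bochner_Integration.integral_cong) auto
      also have "\<dots> = 1 - u" using p tu pu(3)[OF u] by simp
      finally show "(LINT y|lborel. \<bar>p y - t u y\<bar>) \<le> 1 - u" by simp
      show "bdd_borel L (\<lambda>x. g (x + h) - g x)"
        using bdd_borel_diff[OF bdd_borel_shift[OF g] g] L by (auto simp: bdd_borel_def)
    qed
    from bdd_borelD(2)[OF this, of x]
    have "\<bar>conv_op (\<lambda>y. p y - t u y) g (x + h) - conv_op (\<lambda>y. p y - t u y) g x\<bar> \<le> (1 - u) * L"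
      unfolding conv_op_diff[OF r bdd_borel_shift[OF g] g] conv_op_shift .
    moreover have "\<bar>conv_op (t u) g (x + h) - conv_op (t u) g x\<bar> \<le> C0 * norm h * u powr (1 + \<gamma>) * B"
      by (rule conv_op_modulus[OF tu g]) (use pu(4)[OF u] in auto)
    ultimately show ?thesis unfolding ev by linarith
  qed
  have "\<bar>(conv_op p ^^ k) g (x + h) - (conv_op p ^^ k) g x\<bar> \<le> C * B * norm h * real k powr (- \<gamma>)"
    if "k \<ge> 1" "bdd_borel B g" for k B g x h
    using that(1)
  proof (induction k arbitrary: x rule: less_induct)
    case (less k)
    note g = \<open>bdd_borel B g\<close>
    have B: "0 \<le> B" using bdd_borelD[OF g] by auto
    obtain j where j: "k = Suc j" using less.prems by (cases k) auto
    note gj = bdd_borel_conv_op_pow[OF p(1) p1 g, of j]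
    have kk: "(conv_op p ^^ k) g = conv_op p ((conv_op p ^^ j) g)" by (simp add: j)
    show ?case
    proof (cases "real k \<le> m")
      case True
      \<comment> \<open>Cut-off u = 1: the whole step is treated as smooth, and the crude
        oscillation \<open>B + B\<close> of the earlier iterate enters with weight 0.\<close>
      have "\<bar>(conv_op p ^^ k) g (x + h) - (conv_op p ^^ k) g x\<bar> \<le> (1 - 1) * (B + B) + C0 * norm h * 1 powr (1 + \<gamma>) * B"
        unfolding kk using bdd_borelD(2)[OF bdd_borel_diff[OF bdd_borel_shift[OF gj] gj]]
        by (intro step[OF _ _ gj]) auto
      also have "\<dots> = C0 * B * norm h * 1" by simp
      also have "\<dots> \<le> C0 * B * norm h * (m powr (1 + \<gamma>) * real k powr (-\<gamma>))"
      proof (intro mult_left_mono mult_nonneg_nonneg)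
        have "m powr (1 + \<gamma>) * real k powr (-\<gamma>) \<ge> m powr (1 + \<gamma>) * m powr (-\<gamma>)"
          using True less.prems \<gamma> m by (intro mult_left_mono powr_mono2') auto
        also have "m powr (1 + \<gamma>) * m powr (-\<gamma>) = m" using m by (simp flip: powr_add)
        finally show "1 \<le> m powr (1 + \<gamma>) * real k powr (-\<gamma>)" using m by linarith
      qed (use C0 B in auto)
      finally show ?thesis by (simp add: C_def ac_simps)
    next
      case False
      then have k1: "real k > 1" using m by linarith
      then have j1: "j \<ge> 1" using j by auto
      define u where "u = m / real k"
      have u: "0 < u" "u \<le> 1" using False m k1 by (auto simp: u_def)
      have "\<bar>(conv_op p ^^ k) g (x + h) - (conv_op p ^^ k) g x\<bar>
         \<le> (1 - u) * (C * B * norm h * real j powr (-\<gamma>)) + C0 * norm h * u powr (1 + \<gamma>) * B"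
        unfolding kk using less.IH[of j] j j1 by (intro step[OF u gj]) auto
      also have "(1 - u) * (C * B * norm h * real j powr (-\<gamma>)) \<le> C * B * norm h * (real k powr (-\<gamma>) * (1 - 1 / real k))"
      proof -
        define y where "y = 1 - 1 / real k"
        have y: "0 < y" using k1 by (simp add: y_def)
        have jy: "real j = real k * y" using k1 by (simp add: y_def j field_simps)
        \<comment> \<open>Bernoulli's inequality for the real exponent m, as the weighted
          arithmetic-geometric mean of 1 - u and 1 with weights 1/m and 1 - 1/m.\<close>
        have "1 - u \<le> y powr m"
        proof -
          have u1: "0 < 1 - u" using False k1 by (simp add: u_def)
          have "(1 - u) powr (1 / m) * 1 powr (1 - 1 / m) \<le> 1 / m * (1 - u) + (1 - 1 / m) * 1"
            using m u1 by (intro Youngs_inequality_0) auto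
          also have "\<dots> = y" using m by (simp add: y_def u_def field_simps)
          finally have "((1 - u) powr (1 / m)) powr m \<le> y powr m"
            using m by (intro powr_mono2) auto
          then show ?thesis using m u1 by (simp add: powr_powr)
        qed
        then have "(1 - u) * real j powr (-\<gamma>) \<le> y powr m * (real k powr (-\<gamma>) * y powr (-\<gamma>))"
          using y k1 by (simp add: jy powr_mult mult_right_mono)
        also have "\<dots> = real k powr (-\<gamma>) * y" using y by (simp add: m_def flip: powr_add)
        finally have "C * B * norm h * ((1 - u) * real j powr (-\<gamma>)) \<le> C * B * norm h * (real k powr (-\<gamma>) * y)"
          using C B by (intro mult_left_mono) auto
        then show ?thesis by (simp add: y_def ac_simps)
      qed
      also have "C0 * norm h * u powr (1 + \<gamma>) * B = C * B * norm h * (real k powr (-\<gamma>) * (1 / real k))"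
      proof -
        have "u powr (1 + \<gamma>) = m powr (1 + \<gamma>) * (real k powr (-\<gamma>) * (1 / real k))"
          using m k1 by (simp add: u_def powr_divide powr_minus powr_add field_simps)
        then show ?thesis by (simp add: C_def)
      qed
      also have "C * B * norm h * (real k powr (-\<gamma>) * (1 - 1 / real k)) + C * B * norm h * (real k powr (-\<gamma>) * (1 / real k))
         = C * B * norm h * real k powr (- \<gamma>)" by (simp add: algebra_simps)
      finally show ?thesis by simp
    qed
  qed
  then show ?thesis using C by blast
qed

text \<open>Shared interface of \<open>p\<close> and \<open>p_dil\<close>, both with \<gamma> =
  1/\<alpha>: after k steps the walk is spread over the scale k^\<gamma>. The constant is uniform in
  g and its bound, hence survives composition with other contractions.\<close>

definition smoothing :: "real \<Rightarrow> real \<Rightarrow> ('a::euclidean_space \<Rightarrow> real) \<Rightarrow> bool" where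
  "smoothing C \<gamma> q \<longleftrightarrow> integrable lborel q \<and> (LINT y|lborel. \<bar>q y\<bar>) \<le> 1 \<and>
     (\<forall>k\<ge>1. \<forall>B g x h. bdd_borel B g \<longrightarrow>
       \<bar>(conv_op q ^^ k) g (x + h) - (conv_op q ^^ k) g x\<bar> \<le> C * B * norm h * real k powr (- \<gamma>))"

lemma smoothingD:
  assumes "smoothing C \<gamma> q"
  shows "integrable lborel q" "(LINT y|lborel. \<bar>q y\<bar>) \<le> 1"
    "k \<ge> 1 \<Longrightarrow> bdd_borel B g \<Longrightarrow>
       \<bar>(conv_op q ^^ k) g (x + h) - (conv_op q ^^ k) g x\<bar> \<le> C * B * norm h * real k powr (- \<gamma>)"
  using assms by (auto simp: smoothing_def)

lemma conv_op_pow_pow_commute: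
  assumes q: "integrable lborel q" "(LINT y|lborel. \<bar>q y\<bar>) \<le> 1"
    and r: "integrable lborel r" "(LINT y|lborel. \<bar>r y\<bar>) \<le> 1" and g: "bdd_borel B g"
  shows "(conv_op r ^^ j) ((conv_op q ^^ k) g) = (conv_op q ^^ k) ((conv_op r ^^ j) g)"
proof (induction j)
  case (Suc j)
  have "(conv_op r ^^ Suc j) ((conv_op q ^^ k) g) = conv_op r ((conv_op q ^^ k) ((conv_op r ^^ j) g))"
    using Suc by simp
  also have "\<dots> = (conv_op q ^^ k) ((conv_op r ^^ Suc j) g)"
    using conv_op_pow_commute[OF q r(1) bdd_borel_conv_op_pow[OF r g, of j], of k] by simp
  finally show ?case .
qed simp

text \<open>A second difference is a first difference of first differences. Splitting the m steps
  into halves lets each half pay one factor |h| m^(-\<gamma>); both halves have at least m/3 steps,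
  whence 9^\<gamma>. The shape 4 (1 + ...) of the constant lets it also dominate the trivial bound 4
  B, which takes over for large h.\<close>

lemma smoothing_second_difference:
  assumes q: "smoothing C \<gamma> q" and "0 \<le> C" "0 \<le> \<gamma>" and g: "bdd_borel B g" and m: "m \<ge> 2"
  shows "\<bar>(conv_op q ^^ m) g (x + h) + (conv_op q ^^ m) g (x - h) - 2 * (conv_op q ^^ m) g x\<bar>
     \<le> 4 * (1 + C\<^sup>2 * 9 powr \<gamma>) * B * (norm h / real m powr \<gamma>)\<^sup>2"
proof -
  define k where "k = m div 2"
  define j where "j = m - k"
  have kj: "m = k + j" "1 \<le> k" "1 \<le> j" "real m / 3 \<le> real k" "real m / 3 \<le> real j"
  proof -
    have "m \<le> 3 * k" "m \<le> 3 * j" using m unfolding k_def j_def by linarith+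
    then show "real m / 3 \<le> real k" "real m / 3 \<le> real j" by linarith+
  qed (use m in \<open>auto simp: k_def j_def\<close>)
  note q1 = smoothingD(1,2)[OF q]
  define u where "u = (\<lambda>x. (conv_op q ^^ j) g (x + h) - (conv_op q ^^ j) g x)"
  note gj = bdd_borel_conv_op_pow[OF q1 g, of j]
  have u: "bdd_borel (C * B * norm h * real j powr (- \<gamma>)) u"
    using bdd_borel_diff[OF bdd_borel_shift[OF gj] gj] smoothingD(3)[OF q kj(3) g]
    by (auto simp: bdd_borel_def u_def)
  have e: "(conv_op q ^^ k) u = (\<lambda>x. (conv_op q ^^ m) g (x + h) - (conv_op q ^^ m) g x)"
    unfolding u_def conv_op_pow_diff[OF q1 bdd_borel_shift[OF gj] gj] conv_op_pow_shift
    by (simp add: kj(1) funpow_add)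
  have B: "0 \<le> B" using bdd_borelD[OF g] by simp
  have m3: "real i powr (-\<gamma>) \<le> 3 powr \<gamma> * real m powr (-\<gamma>)" if "real m / 3 \<le> real i" for i
  proof -
    have "real i powr (-\<gamma>) \<le> (real m / 3) powr (-\<gamma>)"
      using that m \<open>0 \<le> \<gamma>\<close> by (intro powr_mono2') auto
    then show ?thesis by (simp add: powr_divide powr_minus field_simps)
  qed
  have "\<bar>(conv_op q ^^ k) u ((x - h) + h) - (conv_op q ^^ k) u (x - h)\<bar>
     \<le> C * (C * B * norm h * real j powr (- \<gamma>)) * norm h * real k powr (- \<gamma>)"
    by (rule smoothingD(3)[OF q kj(2) u])
  also have "\<dots> = C\<^sup>2 * B * (norm h)\<^sup>2 * (real j powr (- \<gamma>) * real k powr (- \<gamma>))"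
    by (simp add: power2_eq_square)
  also have "\<dots> \<le> C\<^sup>2 * B * (norm h)\<^sup>2 * ((3 powr \<gamma> * real m powr (-\<gamma>)) * (3 powr \<gamma> * real m powr (-\<gamma>)))"
    using kj m3 B by (intro mult_left_mono mult_mono) auto
  also have "\<dots> = (C\<^sup>2 * 9 powr \<gamma>) * B * (norm h / real m powr \<gamma>)\<^sup>2"
    using powr_mult[of 3 3 \<gamma>] by (simp add: powr_minus power2_eq_square field_simps)
  also have "\<dots> \<le> (4 * (1 + C\<^sup>2 * 9 powr \<gamma>)) * B * (norm h / real m powr \<gamma>)\<^sup>2"
    using B by (intro mult_right_mono) auto
  finally show ?thesis by (simp add: e algebra_simps)
qed

section \<open>Symmetrisation, the single doubling step and its telescoping\<close>

lemma lborel_distr_uminus_euclidean: "distr lborel borel uminus = (lborel :: 'a::euclidean_space measure)"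
  using lborel_affine[of "-1" "0::'a"] by (simp add: density_1)

lemma integrable_lborel_uminus:
  fixes f :: "'a::euclidean_space \<Rightarrow> real"
  assumes "integrable lborel f" shows "integrable lborel (\<lambda>y. f (- y))"
proof -
  have "integrable (distr lborel borel uminus) f"
    using assms by (simp add: lborel_distr_uminus_euclidean)
  then show ?thesis by (subst (asm) integrable_distr_eq) (use assms in auto)
qed

lemma integral_lborel_uminus:
  fixes f :: "'a::euclidean_space \<Rightarrow> real"
  assumes "f \<in> borel_measurable borel" shows "(LINT y|lborel. f (- y)) = (LINT y|lborel. f y)"
proof -
  have "(LINT y|distr lborel borel uminus. f y) = (LINT y|lborel. f (- y))"
    by (subst integral_distr) (use assms in auto)
  then show ?thesis by (simp add: lborel_distr_uminus_euclidean)
qed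

text \<open>Evenness of q allows averaging over y and -y, which removes the first-order term. First
  differences alone would give n^(-1/\<alpha>) for a bounded step instead of
  n^(-2/\<alpha>).\<close>

lemma conv_op_symmetrize:
  fixes q :: "'a::euclidean_space \<Rightarrow> real"
  assumes q: "integrable lborel q" "\<And>y. q (- y) = q y" and F: "bdd_borel B F"
  shows "integrable lborel (\<lambda>y. q y * (F (x + y) + F (x - y) - 2 * F x))"
    "2 * (conv_op q F x - (LINT y|lborel. q y) * F x) = (LINT y|lborel. q y * (F (x + y) + F (x - y) - 2 * F x))"
proof -
  note i1 = conv_op_integrable[OF q(1) F, of x]
  have i2: "integrable lborel (\<lambda>y. q y * F (x - y))"
    using integrable_lborel_uminus[OF i1] by (simp add: q(2))
  have [measurable]: "q \<in> borel_measurable borel" "F \<in> borel_measurable borel"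
    using q bdd_borelD[OF F] by auto
  have e2: "(LINT y|lborel. q y * F (x - y)) = conv_op q F x"
    unfolding conv_op_def using integral_lborel_uminus[of "\<lambda>y. q y * F (x + y)"] by (simp add: q(2))
  have i3: "integrable lborel (\<lambda>y. q y * (2 * F x))" using q by simp
  have eq: "q y * (F (x + y) + F (x - y) - 2 * F x) = q y * F (x + y) + q y * F (x - y) - q y * (2 * F x)" for y
    by (simp add: algebra_simps)
  show "integrable lborel (\<lambda>y. q y * (F (x + y) + F (x - y) - 2 * F x))"
    unfolding eq using i1 i2 i3 by simp
  have "(LINT y|lborel. q y * (F (x + y) + F (x - y) - 2 * F x)) =
    conv_op q F x + conv_op q F x - (LINT y|lborel. q y * (2 * F x))"
    unfolding eq using i1 i2 i3 by (simp add: e2) (simp add: conv_op_def)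
  then show "2 * (conv_op q F x - (LINT y|lborel. q y) * F x) = (LINT y|lborel. q y * (F (x + y) + F (x - y) - 2 * F x))"
    by (simp add: algebra_simps)
qed

text \<open>The majorant is asked for only where q is nonzero, so that a kernel cut off at radius s
  can be paired with a constant.\<close>

lemma symmetrized_integral_bound:
  fixes q :: "'a::euclidean_space \<Rightarrow> real"
  assumes q: "integrable lborel q" "\<And>y. q (- y) = q y" "\<And>y. 0 \<le> q y" and F: "bdd_borel B F"
    and w: "\<And>y. q y \<noteq> 0 \<Longrightarrow> \<bar>F (x + y) + F (x - y) - 2 * F x\<bar> \<le> w y"
    and i: "integrable lborel (\<lambda>y. q y * w y)" "(LINT y|lborel. q y * w y) \<le> W"
  shows "2 * \<bar>conv_op q F x - (LINT y|lborel. q y) * F x\<bar> \<le> W"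
proof -
  have "2 * \<bar>conv_op q F x - (LINT y|lborel. q y) * F x\<bar> = \<bar>2 * (conv_op q F x - (LINT y|lborel. q y) * F x)\<bar>"
    by (simp only: abs_mult abs_numeral)
  also have "\<dots> \<le> (LINT y|lborel. \<bar>q y * (F (x + y) + F (x - y) - 2 * F x)\<bar>)"
    unfolding conv_op_symmetrize(2)[OF q(1,2) F] by (rule integral_abs_bound)
  also have "\<dots> \<le> (LINT y|lborel. q y * w y)"
  proof (intro integral_mono integrable_abs conv_op_symmetrize(1)[OF q(1,2) F] i)
    fix y show "\<bar>q y * (F (x + y) + F (x - y) - 2 * F x)\<bar> \<le> q y * w y"
      using q(3)[of y] w[of y] by (cases "q y = 0") (auto simp: abs_mult intro!: mult_left_mono)
  qed
  finally show ?thesis using i by simp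
qed

text \<open>The smoothing kernel q is kept apart from p because telescoping meets powers of
  \<open>p\<close> and of \<open>p'\<close>. The term m^(-2) comes from the square of
  \<open>P - 1\<close>, the term m^(-2/\<alpha>) from second differences with |y| < s, the region
  that holds half of the mass.\<close>

lemma doubling_step_bound:
  fixes p q p' :: "'a::euclidean_space \<Rightarrow> real"
  assumes p: "integrable lborel p" "\<And>y. 0 \<le> p y" "(LINT y|lborel. p y) = 1" "\<And>y. p (- y) = p y"
    and \<alpha>: "0 < \<alpha>" and s: "0 < s" "(LINT y|lborel. p y * indicator {..<s} (norm y)) = 1 / 2"
    and D: "\<And>R. 1 \<le> R \<Longrightarrow> (LINT y|lborel. p y * min 1 ((norm y / R)\<^sup>2)) \<le> D * R powr (- \<alpha>)"
    and p': "p' = (\<lambda>y. 2 * (p y * indicator {s..} (norm y)))"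
    and q: "smoothing C (1 / \<alpha>) q" and C: "0 \<le> C"
  shows "\<exists>C'\<ge>0. \<forall>m\<ge>4. \<forall>B g x. bdd_borel B g \<longrightarrow>
     \<bar>conv_op p (conv_op p ((conv_op q ^^ m) g)) x - conv_op p' ((conv_op q ^^ m) g) x\<bar>
        \<le> C' * B * (real m powr (- (2 / \<alpha>)) + real m powr (- 2))"
proof -
  define c where "c = 1 + C\<^sup>2 * 9 powr (1 / \<alpha>)"
  have c: "1 \<le> c" by (simp add: c_def)
  define S where "S k = (conv_op q ^^ k)" for k
  define P where "P = conv_op p"
  define L where "L = (\<lambda>F x. P F x - F x)"
  have [measurable]: "p \<in> borel_measurable borel" using p by auto
  note q1 = smoothingD(1,2)[OF q]
  have p1: "(LINT y|lborel. \<bar>p y\<bar>) \<le> 1" using p by simp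
  have D0: "0 \<le> D"
  proof -
    have "0 \<le> (LINT y|lborel. p y * min 1 ((norm y / 1)\<^sup>2))" using p by (intro integral_nonneg_AE) auto
    also have "\<dots> \<le> D * 1 powr (-\<alpha>)" by (rule D) simp
    finally show ?thesis by simp
  qed
  have sb: "bdd_borel B (S k g)" if "bdd_borel B g" for B k g
    using bdd_borel_conv_op_pow[OF q1 that] by (simp add: S_def)
  have s2: "\<bar>S m g (x + h) + S m g (x - h) - 2 * S m g x\<bar> \<le> 4 * c * B * (norm h / real m powr (1 / \<alpha>))\<^sup>2"
    if "bdd_borel B g" "m \<ge> 2" for B g m x h
    unfolding S_def c_def using that \<alpha> C by (intro smoothing_second_difference[OF q]) auto
  \<comment> \<open>At the scale R = m^(1/\<alpha>) of the smoothed function, second differences are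
    bounded by a multiple of min(1, (|y|/R)^2); the truncated second moment at R is of order
    R^(-\<alpha>) = 1/m.\<close>
  have Lb: "bdd_borel (2 * c * D * B * (1 / real m)) (L (S m g))" if g: "bdd_borel B g" and m: "m \<ge> 2" for B g m
  proof -
    define R where "R = real m powr (1 / \<alpha>)"
    have R: "1 \<le> R" "R powr (- \<alpha>) = 1 / real m"
      using m \<alpha> by (auto simp: R_def ge_one_powr_ge_zero powr_powr powr_minus_divide)
    have B: "0 \<le> B" using bdd_borelD[OF g] by simp
    have "2 * \<bar>P (S m g) x - (LINT y|lborel. p y) * S m g x\<bar> \<le> 4 * c * B * (D * (1 / real m))" for x
      unfolding P_def
    proof (rule symmetrized_integral_bound[OF p(1,4,2) sb[OF g]])
      fix y
      show "\<bar>S m g (x + y) + S m g (x - y) - 2 * S m g x\<bar> \<le> 4 * c * B * min 1 ((norm y / R)\<^sup>2)"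
      proof (cases "(norm y / R)\<^sup>2 \<le> 1")
        case True then show ?thesis using s2[OF g m, of x y] by (simp add: R_def min_def)
      next
        case False
        have "\<bar>S m g (x + y) + S m g (x - y) - 2 * S m g x\<bar> \<le> 4 * B"
          using bdd_borelD(2)[OF sb[OF g], of m "x + y"] bdd_borelD(2)[OF sb[OF g], of m "x - y"]
            bdd_borelD(2)[OF sb[OF g], of m x] by linarith
        also have "\<dots> \<le> 4 * c * B" using c B by (simp add: mult_le_cancel_right1)
        finally show ?thesis using False by (simp add: min_def)
      qed
    next
      have i: "integrable lborel (\<lambda>y. p y * min 1 ((norm y / R)\<^sup>2))"
        by (rule integrable_mult_bdd[OF p(1), where B=1]) auto
      have e: "p y * (4 * c * B * min 1 ((norm y / R)\<^sup>2)) = (4 * c * B) * (p y * min 1 ((norm y / R)\<^sup>2))" for y by simp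
      show "integrable lborel (\<lambda>y. p y * (4 * c * B * min 1 ((norm y / R)\<^sup>2)))"
        unfolding e using i by simp
      have "(LINT y|lborel. p y * (4 * c * B * min 1 ((norm y / R)\<^sup>2))) =
         4 * c * B * (LINT y|lborel. p y * min 1 ((norm y / R)\<^sup>2))"
        unfolding e using i by simp
      also have "\<dots> \<le> 4 * c * B * (D * R powr (- \<alpha>))"
        using R c B by (intro mult_left_mono D) auto
      finally show "(LINT y|lborel. p y * (4 * c * B * min 1 ((norm y / R)\<^sup>2))) \<le> 4 * c * B * (D * (1 / real m))"
        by (simp add: R)
    qed
    moreover have "L (S m g) \<in> borel_measurable borel"
      unfolding L_def P_def
      using bdd_borelD(1)[OF bdd_borel_conv_op[OF p(1) p1 sb[OF g]], of m] bdd_borelD(1)[OF sb[OF g], of m] by measurable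
    moreover have "2 * \<bar>L (S m g) x\<bar> = 2 * \<bar>P (S m g) x - (LINT y|lborel. p y) * S m g x\<bar>" for x
      by (simp add: L_def p(3))
    moreover have "4 * c * B * (D * (1 / real m)) = 2 * (2 * c * D * B * (1 / real m))" by simp
    ultimately have "2 * \<bar>L (S m g) x\<bar> \<le> 2 * (2 * c * D * B * (1 / real m))" for x by metis
    then have "\<bar>L (S m g) x\<bar> \<le> 2 * c * D * B * (1 / real m)" for x
      by (simp only: mult_le_cancel_left_pos zero_less_numeral)
    then show ?thesis using \<open>L (S m g) \<in> borel_measurable borel\<close> unfolding bdd_borel_def by blast
  qed
  \<comment> \<open>With Q the operator of the part |y| < s, \<open>p'\<close> acts as 2 (P - Q),
    and P P - 2 (P - Q) = (P - 1)(P - 1) + 2 (Q - 1/2), where 1/2 is the mass of Q.\<close>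
  have split: "P (P F) x - conv_op p' F x = L (L F) x + 2 * (conv_op (\<lambda>y. p y * indicator {..<s} (norm y)) F x - 1 / 2 * F x)"
    if F: "bdd_borel B F" for F B x
  proof -
    have i1: "integrable lborel (\<lambda>y. p y * indicator {..<s} (norm y))"
      by (rule integrable_mult_bdd[OF p(1), where B=1]) (auto simp: indicator_def)
    have e: "conv_op p' F x = 2 * (P F x - conv_op (\<lambda>y. p y * indicator {..<s} (norm y)) F x)"
    proof -
      have "conv_op p' F x = (LINT y|lborel. 2 * (p y * F (x + y) - p y * indicator {..<s} (norm y) * F (x + y)))"
        unfolding conv_op_def p' by (intro Bochner_Integration.integral_cong) (auto simp: indicator_def)
      then show ?thesis
        unfolding conv_op_def P_def using conv_op_integrable[OF p(1) F, of x] conv_op_integrable[OF i1 F, of x] by simp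
    qed
    have "L (L F) x = P (P F) x - 2 * P F x + F x"
      using conv_op_diff[OF p(1) bdd_borel_conv_op[OF p(1) p1 F] F, of x]
      by (simp add: L_def P_def)
    then show ?thesis using e by simp
  qed
  have Kb: "\<bar>conv_op (\<lambda>y. p y * indicator {..<s} (norm y)) (S m g) x - 1 / 2 * S m g x\<bar>
      \<le> c * s\<^sup>2 * B * real m powr (- (2 / \<alpha>))" if g: "bdd_borel B g" and m: "m \<ge> 2" for B g m x
  proof -
    have B: "0 \<le> B" using bdd_borelD[OF g] by simp
    have i: "integrable lborel (\<lambda>y. p y * indicator {..<s} (norm y))"
      by (rule integrable_mult_bdd[OF p(1), where B=1]) (auto simp: indicator_def)
    have "2 * \<bar>conv_op (\<lambda>y. p y * indicator {..<s} (norm y)) (S m g) x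
       - (LINT y|lborel. p y * indicator {..<s} (norm y)) * S m g x\<bar> \<le> 4 * c * B * (s / real m powr (1 / \<alpha>))\<^sup>2 * (1 / 2)"
    proof (rule symmetrized_integral_bound[OF i _ _ sb[OF g], where w="\<lambda>_. 4 * c * B * (s / real m powr (1 / \<alpha>))\<^sup>2"])
      fix y assume "p y * indicator {..<s} (norm y) \<noteq> 0"
      then have "norm y < s" by (auto simp: indicator_def split: if_splits)
      then have "4 * c * B * (norm y / real m powr (1 / \<alpha>))\<^sup>2 \<le> 4 * c * B * (s / real m powr (1 / \<alpha>))\<^sup>2"
        using c B by (intro mult_left_mono power_mono divide_right_mono) auto
      then show "\<bar>S m g (x + y) + S m g (x - y) - 2 * S m g x\<bar> \<le> 4 * c * B * (s / real m powr (1 / \<alpha>))\<^sup>2"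
        using s2[OF g m, of x y] by linarith
    next
      show "(LINT y|lborel. p y * indicator {..<s} (norm y) * (4 * c * B * (s / real m powr (1 / \<alpha>))\<^sup>2))
         \<le> 4 * c * B * (s / real m powr (1 / \<alpha>))\<^sup>2 * (1 / 2)"
        unfolding integral_mult_left_zero s by simp
    qed (use p i in auto)
    moreover have "(s / real m powr (1 / \<alpha>))\<^sup>2 = s\<^sup>2 * real m powr (- (2 / \<alpha>))"
      using m by (simp add: power_divide powr_power powr_minus_divide)
    ultimately show ?thesis by (simp add: s algebra_simps)
  qed
  define C' where "C' = 9 * (2 * c * D)\<^sup>2 + 2 * c * s\<^sup>2"
  have "\<bar>P (P (S m g)) x - conv_op p' (S m g) x\<bar> \<le> C' * B * (real m powr (- (2 / \<alpha>)) + real m powr (- 2))"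
    if m: "m \<ge> 4" and g: "bdd_borel B g" for m B g x
  proof -
    have B: "0 \<le> B" using bdd_borelD[OF g] by simp
    define k where "k = m div 2"
    define j where "j = m - k"
    have kj: "m = k + j" "2 \<le> k" "2 \<le> j" "real m / 3 \<le> real k" "real m / 3 \<le> real j"
    proof -
      have "m \<le> 3 * k" "m \<le> 3 * j" using m unfolding k_def j_def by linarith+
      then show "real m / 3 \<le> real k" "real m / 3 \<le> real j" by linarith+
    qed (use m in \<open>auto simp: k_def j_def\<close>)
    \<comment> \<open>\<open>L\<close> commutes with the smoothing, so each of its two occurrences
      receives one half of the m steps.\<close>
    have e: "L (L (S m g)) = L (S k (L (S j g)))"
    proof -
      have "S k (L (S j g)) = (\<lambda>x. S k (P (S j g)) x - S k (S j g) x)"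
        unfolding L_def S_def P_def
        by (rule conv_op_pow_diff[OF q1 bdd_borel_conv_op[OF p(1) p1]])
           (use bdd_borel_conv_op_pow[OF q1 g] in auto)
      also have "S k (P (S j g)) = P (S k (S j g))"
        unfolding S_def P_def using conv_op_pow_commute[OF q1 p(1) bdd_borel_conv_op_pow[OF q1 g]] by simp
      finally show ?thesis by (simp add: L_def S_def kj(1) funpow_add)
    qed
    have "\<bar>L (L (S m g)) x\<bar> \<le> 2 * c * D * (2 * c * D * B * (1 / real j)) * (1 / real k)"
      unfolding e by (rule bdd_borelD(2)[OF Lb[OF Lb[OF g kj(3)] kj(2)]])
    also have "\<dots> = (2 * c * D)\<^sup>2 * B * (1 / real j * (1 / real k))" by (simp add: power2_eq_square)
    also have "\<dots> \<le> (2 * c * D)\<^sup>2 * B * (1 / (real m / 3) * (1 / (real m / 3)))"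
      using kj m B by (intro mult_left_mono mult_mono divide_left_mono) auto
    also have "\<dots> = 9 * (2 * c * D)\<^sup>2 * B * real m powr (-2)"
      using m by (simp add: powr_minus_divide power2_eq_square)
    finally have "\<bar>L (L (S m g)) x\<bar> \<le> 9 * (2 * c * D)\<^sup>2 * B * real m powr (-2)" .
    moreover have "\<bar>P (P (S m g)) x - conv_op p' (S m g) x\<bar> \<le> \<bar>L (L (S m g)) x\<bar> +
        2 * \<bar>conv_op (\<lambda>y. p y * indicator {..<s} (norm y)) (S m g) x - 1 / 2 * S m g x\<bar>"
      proof -
      have "\<bar>a + 2 * b\<bar> \<le> \<bar>a\<bar> + 2 * \<bar>b\<bar>" for a b :: real by linarith
      then show ?thesis unfolding split[OF sb[OF g]] .
    qed
    moreover have "2 * \<bar>conv_op (\<lambda>y. p y * indicator {..<s} (norm y)) (S m g) x - 1 / 2 * S m g x\<bar>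
        \<le> 2 * (c * s\<^sup>2 * B * real m powr (- (2 / \<alpha>)))" using Kb[OF g, of m x] m by simp
    moreover have "9 * (2 * c * D)\<^sup>2 * B * real m powr (-2) + 2 * (c * s\<^sup>2 * B * real m powr (- (2 / \<alpha>)))
       \<le> C' * B * (real m powr (- (2 / \<alpha>)) + real m powr (- 2))"
      using c B by (simp add: C'_def algebra_simps)
    ultimately show ?thesis by linarith
  qed
  moreover have "0 \<le> C'" using c by (simp add: C'_def)
  ultimately show ?thesis unfolding P_def S_def by blast
qed

text \<open>One \<open>p'\<close>-step replaces two \<open>p\<close>-steps at a time. In every
  intermediate product one of the two walks still has at least n/2 steps and supplies the smoothing;
  the power of the other is a contraction and is absorbed into the test function.\<close>

lemma doubling_telescope:
  fixes p p' :: "'a::euclidean_space \<Rightarrow> real"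
  assumes p: "integrable lborel p" "(LINT y|lborel. \<bar>p y\<bar>) \<le> 1"
    and p': "integrable lborel p'" "(LINT y|lborel. \<bar>p' y\<bar>) \<le> 1"
    and g: "bdd_borel B g" and n: "2 \<le> n"
    and b1: "\<And>m f x. 2 * m \<ge> n \<Longrightarrow> bdd_borel B f \<Longrightarrow>
      \<bar>conv_op p (conv_op p ((conv_op p ^^ m) f)) x - conv_op p' ((conv_op p ^^ m) f) x\<bar> \<le> W"
    and b2: "\<And>m f x. 2 * m \<ge> n \<Longrightarrow> bdd_borel B f \<Longrightarrow>
      \<bar>conv_op p (conv_op p ((conv_op p' ^^ m) f)) x - conv_op p' ((conv_op p' ^^ m) f) x\<bar> \<le> W"
  shows "\<bar>(conv_op p ^^ (2 * n)) g x - (conv_op p' ^^ n) g x\<bar> \<le> real n * W"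
proof -
  define a where "a j = (conv_op p ^^ (2 * (n - j))) ((conv_op p' ^^ j) g) x" for j
  have d: "\<bar>a j - a (Suc j)\<bar> \<le> W" if j: "j < n" for j
  proof -
    define i where "i = 2 * (n - Suc j)"
    have i: "2 * (n - j) = Suc (Suc i)" using j by (simp add: i_def)
    define F where "F = (conv_op p ^^ i) ((conv_op p' ^^ j) g)"
    have F': "F = (conv_op p' ^^ j) ((conv_op p ^^ i) g)"
      unfolding F_def using conv_op_pow_pow_commute[OF p' p g] .
    have "a (Suc j) = conv_op p' F x"
      unfolding a_def F_def i_def[symmetric]
      using conv_op_pow_commute[OF p p'(1) bdd_borel_conv_op_pow[OF p' g], of i j] by simp
    moreover have "a j = conv_op p (conv_op p F) x"
      unfolding a_def F_def i by simp
    moreover have "\<bar>conv_op p (conv_op p F) x - conv_op p' F x\<bar> \<le> W"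
    proof (cases "2 * j \<ge> n")
      case True
      then show ?thesis unfolding F' by (intro b2 bdd_borel_conv_op_pow[OF p g])
    next
      case False
      \<comment> \<open>Here 2 i \<ge> 2 n - 2, which is at least n because n \<ge> 2.\<close>
      then have "2 * i \<ge> n" using n unfolding i_def by linarith
      then show ?thesis unfolding F_def by (intro b1 bdd_borel_conv_op_pow[OF p' g])
    qed
    ultimately show ?thesis by simp
  qed
  have "\<bar>a 0 - a n\<bar> = \<bar>\<Sum>j<n. a j - a (Suc j)\<bar>" by (simp add: sum_lessThan_telescope')
  also have "\<dots> \<le> (\<Sum>j<n. W)" using d by (intro order_trans[OF sum_abs] sum_mono) auto
  finally show ?thesis by (simp add: a_def)
qed

section \<open>Polar coordinates\<close>

lemma emeasure_lborel_scaleR_image: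
  assumes [measurable]: "A \<in> sets (borel :: 'a::euclidean_space measure)" and r: "0 < r"
  shows "emeasure lborel ((\<lambda>x. x /\<^sub>R r) -` A) = ennreal (r ^ DIM('a)) * emeasure lborel A"
proof -
  have "emeasure lborel A = emeasure (density (distr lborel borel (\<lambda>x. 0 + (1/r) *\<^sub>R x)) (\<lambda>_. \<bar>1/r\<bar>^DIM('a))) A"
    using r by (subst lborel_affine[of "1/r" "0::'a"]) auto
  also have "\<dots> = ennreal ((1/r)^DIM('a)) * emeasure lborel ((\<lambda>x. x /\<^sub>R r) -` A)"
    using r by (subst emeasure_density) (auto simp: nn_integral_cmult emeasure_distr divide_inverse)
  finally have "ennreal (r ^ DIM('a)) * emeasure lborel A =
      ennreal (r ^ DIM('a)) * ennreal ((1/r)^DIM('a)) * emeasure lborel ((\<lambda>x. x /\<^sub>R r) -` A)"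
    by (simp add: mult.assoc)
  also have "ennreal (r ^ DIM('a)) * ennreal ((1/r)^DIM('a)) = 1"
    using r by (simp add: power_divide flip: ennreal_mult)
  finally show ?thesis by simp
qed

text \<open>Image of Lebesgue measure under the norm; its density is the surface area of the sphere
  of radius r. The \<open>itself\<close> argument serves to convey the dimension.\<close>

definition radial_measure :: "'a::euclidean_space itself \<Rightarrow> real measure" where
  "radial_measure _ = density lborel (\<lambda>r. ennreal (indicator {0<..} r *
     (real DIM('a) * unit_ball_vol (real DIM('a)) * r ^ (DIM('a) - 1))))"

lemma emeasure_radial_lessThan:
  "emeasure (radial_measure TYPE('a::euclidean_space)) {..<r} =
    (if 0 < r then ennreal (unit_ball_vol (real DIM('a)) * r ^ DIM('a)) else 0)"
proof (cases "0 < r")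
  case False
  then show ?thesis
    unfolding radial_measure_def
    by (subst emeasure_density) (auto simp: indicator_def nn_integral_0_iff_AE intro!: AE_I2)
next
  case True
  let ?d = "DIM('a)" and ?w = "unit_ball_vol (real DIM('a))"
  have "emeasure (radial_measure TYPE('a)) {..<r} =
     (\<integral>\<^sup>+x. ennreal (indicator {0<..} x * (real ?d * ?w * x ^ (?d - 1))) * indicator {..<r} x \<partial>lborel)"
    unfolding radial_measure_def by (subst emeasure_density) auto
  also have "\<dots> = (\<integral>\<^sup>+x. ennreal (real ?d * ?w * x ^ (?d - 1)) * indicator {0..r} x \<partial>lborel)"
  proof (rule nn_integral_cong_AE)
    have "AE x in lborel. x \<noteq> 0 \<and> x \<noteq> r" using AE_lborel_singleton[of 0] AE_lborel_singleton[of r] by auto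
    then show "AE x in lborel. ennreal (indicator {0<..} x * (real ?d * ?w * x ^ (?d - 1))) * indicator {..<r} x =
        ennreal (real ?d * ?w * x ^ (?d - 1)) * indicator {0..r} x"
      by eventually_elim (auto simp: indicator_def)
  qed
  also have "\<dots> = ennreal (?w * r ^ ?d - ?w * 0 ^ ?d)"
  proof (rule nn_integral_FTC_Icc[where F="\<lambda>x. ?w * x ^ ?d"])
    fix x :: real assume x: "x \<in> {0..r}"
    show "((\<lambda>x. ?w * x ^ ?d) has_real_derivative real ?d * ?w * x ^ (?d - 1)) (at x)"
      by (auto intro!: derivative_eq_intros)
    show "0 \<le> real ?d * ?w * x ^ (?d - 1)" using x by simp
  qed (use True in auto)
  finally show ?thesis using True by simp
qed

lemma sigma_finite_radial_measure: "sigma_finite_measure (radial_measure TYPE('a::euclidean_space))"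
proof
  show "\<exists>A. countable A \<and> A \<subseteq> sets (radial_measure TYPE('a)) \<and> \<Union> A = space (radial_measure TYPE('a)) \<and>
      (\<forall>a\<in>A. emeasure (radial_measure TYPE('a)) a \<noteq> \<infinity>)"
    by (rule exI[of _ "range (\<lambda>n::nat. {..<real n})"])
       (auto simp: emeasure_radial_lessThan, auto simp: radial_measure_def intro: reals_Archimedean2)
qed

lemma emeasure_uniform_sphere:
  assumes [measurable]: "A \<in> sets (borel :: 'a::euclidean_space measure)"
  shows "emeasure uniform_sphere A * ennreal (unit_ball_vol (real DIM('a)))
     = emeasure lborel ({x. x /\<^sub>R norm x \<in> A} \<inter> ball 0 1)"
proof -
  have b: "emeasure lborel (ball 0 1 :: 'a set) = ennreal (unit_ball_vol (real DIM('a)))"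
    using emeasure_ball[of 1 "0::'a"] by simp
  have "emeasure uniform_sphere A = emeasure (uniform_measure lborel (ball 0 1)) ((\<lambda>x. x /\<^sub>R norm x) -` A)"
    unfolding uniform_sphere_def by (subst emeasure_distr) auto
  also have "\<dots> = emeasure lborel (ball 0 1 \<inter> (\<lambda>x. x /\<^sub>R norm x) -` A) / ennreal (unit_ball_vol (real DIM('a)))"
    by (subst emeasure_uniform_measure) (auto simp: b intro!: measurable_sets_borel[OF radial_projection_measurable])
  moreover have "ennreal (unit_ball_vol (real DIM('a))) \<noteq> 0"
    using unit_ball_vol_pos[of "real DIM('a)"] by (simp add: ennreal_eq_0_iff not_le)
  ultimately show ?thesis
    by (simp add: Int_commute vimage_def ennreal_divide_times ennreal_times_divide mult_divide_eq_ennreal)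
qed

text \<open>Cones are invariant under dilation, so the truncation radius contributes the factor r^d
  to the value at radius 1.\<close>

lemma emeasure_lborel_cone:
  assumes [measurable]: "A \<in> sets (borel :: 'a::euclidean_space measure)" and r: "0 < r"
  shows "emeasure lborel {x. x /\<^sub>R norm x \<in> A \<and> norm x < r}
    = emeasure uniform_sphere A * ennreal (unit_ball_vol (real DIM('a)) * r ^ DIM('a))"
proof -
  have "{x. x /\<^sub>R norm x \<in> A \<and> norm x < r} = (\<lambda>x. x /\<^sub>R r) -` ({x. x /\<^sub>R norm x \<in> A} \<inter> ball 0 1)"
    using r by (auto simp: dist_norm field_simps)
  then have "emeasure lborel {x. x /\<^sub>R norm x \<in> A \<and> norm x < r} = ennreal (r ^ DIM('a)) * emeasure lborel ({x. x /\<^sub>R norm x \<in> A} \<inter> ball 0 1)"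
    using emeasure_lborel_scaleR_image[OF _ r, of "{x. x /\<^sub>R norm x \<in> A} \<inter> ball 0 1"]
    by (simp add: measurable_sets_borel[OF radial_projection_measurable, unfolded vimage_def])
  then show ?thesis
    unfolding emeasure_uniform_sphere[OF assms(1), symmetric] using r by (simp add: ennreal_mult ac_simps)
qed

text \<open>Direction and norm are independent under Lebesgue measure. For a fixed set A of
  directions both sides are measures in the radial variable, and they agree on the half-lines
  \<open>{..<r}\<close>, that is, on truncated cones.\<close>

lemma polar_decomposition:
  "uniform_sphere \<Otimes>\<^sub>M radial_measure TYPE('a) =
    distr lborel (borel \<Otimes>\<^sub>M borel) (\<lambda>x::'a::euclidean_space. (x /\<^sub>R norm x, norm x))"
proof (rule pair_measure_eqI)
  interpret prob_space "uniform_sphere :: 'a measure" by (rule prob_space_uniform_sphere)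
  show "sigma_finite_measure (uniform_sphere :: 'a measure)" ..
  show "sigma_finite_measure (radial_measure TYPE('a))" by (rule sigma_finite_radial_measure)
  have sb: "sets (uniform_sphere :: 'a measure) = sets borel" "sets (radial_measure TYPE('a)) = sets borel"
    by (simp_all add: uniform_sphere_def radial_measure_def)
  then show "sets (uniform_sphere \<Otimes>\<^sub>M radial_measure TYPE('a)) =
     sets (distr lborel (borel \<Otimes>\<^sub>M borel) (\<lambda>x::'a. (x /\<^sub>R norm x, norm x)))"
    by (simp cong: sets_pair_measure_cong)
  fix A :: "'a set" and B :: "real set"
  assume "A \<in> sets uniform_sphere" "B \<in> sets (radial_measure TYPE('a))"
  then have [measurable]: "A \<in> sets borel" "B \<in> sets borel" by (simp_all add: sb)
  define N where "N = emeasure uniform_sphere A"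
  have Nfin: "N < \<infinity>" by (simp add: N_def less_top[symmetric])
  define m1 where "m1 = density (radial_measure TYPE('a)) (\<lambda>_. N)"
  define m2 where "m2 = distr (density lborel (indicator {x::'a. x /\<^sub>R norm x \<in> A})) borel norm"
  have mA: "{x::'a. x /\<^sub>R norm x \<in> A} \<in> sets borel"
    using measurable_sets_borel[OF radial_projection_measurable, of A] by (simp add: vimage_def)
  have m1: "emeasure m1 S = N * emeasure (radial_measure TYPE('a)) S" if "S \<in> sets borel" for S
    unfolding m1_def by (subst emeasure_density) (use that sb in \<open>auto simp: nn_integral_cmult\<close>)
  have m2: "emeasure m2 S = emeasure lborel {x::'a. x /\<^sub>R norm x \<in> A \<and> norm x \<in> S}" if [measurable]: "S \<in> sets borel" for S
  proof -
    have "emeasure m2 S = (\<integral>\<^sup>+x. indicator {x::'a. x /\<^sub>R norm x \<in> A} x * indicator (norm -` S) x \<partial>lborel)"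
      unfolding m2_def using mA that by (subst emeasure_distr, simp_all, subst emeasure_density) (auto intro!: measurable_sets_borel[OF borel_measurable_norm])
    also have "\<dots> = (\<integral>\<^sup>+x. indicator {x::'a. x /\<^sub>R norm x \<in> A \<and> norm x \<in> S} x \<partial>lborel)"
      by (intro nn_integral_cong) (auto simp: indicator_def)
    also have "\<dots> = emeasure lborel {x::'a. x /\<^sub>R norm x \<in> A \<and> norm x \<in> S}"
      by (rule nn_integral_indicator) measurable
    finally show ?thesis .
  qed
  have eqr: "emeasure m1 {..<r} = emeasure m2 {..<r}" for r :: real
  proof (cases "0 < r")
    case True
    then show ?thesis
      using emeasure_lborel_cone[OF \<open>A \<in> sets borel\<close> True]
      by (simp add: m1 m2 emeasure_radial_lessThan N_def)
  next
    case False
    then have "\<not> norm x < r" for x :: 'a using norm_ge_zero[of x] by linarith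
    with False show ?thesis by (simp add: m1 m2 emeasure_radial_lessThan)
  qed
  have "m1 = m2"
  proof (rule measure_eqI_generator_eq[where E="range (\<lambda>r::real. {..<r})" and \<Omega>=UNIV and A="\<lambda>n::nat. {..<real n}"])
    show "Int_stable (range (\<lambda>r::real. {..<r}))"
      unfolding Int_stable_def
    proof clarify
      fix a b :: real
      have "{..<a} \<inter> {..<b} = {..<min a b}" by auto
      then show "{..<a} \<inter> {..<b} \<in> range lessThan" by simp
    qed
    show "sets m1 = sigma_sets UNIV (range (\<lambda>r::real. {..<r}))" "sets m2 = sigma_sets UNIV (range (\<lambda>r::real. {..<r}))"
      using arg_cong[OF borel_Iio, of sets] sb by (simp_all add: m1_def m2_def)
    show "(\<Union>i. {..<real i}) = UNIV" by (auto intro: reals_Archimedean2)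
    show "emeasure m1 {..<real i} \<noteq> \<infinity>" for i
      using Nfin by (auto simp: m1 emeasure_radial_lessThan ennreal_mult_eq_top_iff)
  qed (use eqr in auto)
  then have "emeasure m1 B = emeasure m2 B" by simp
  also have "emeasure m2 B = emeasure (distr lborel (borel \<Otimes>\<^sub>M borel) (\<lambda>x::'a. (x /\<^sub>R norm x, norm x))) (A \<times> B)"
    by (subst emeasure_distr) (auto simp: m2 intro!: arg_cong[where f="emeasure lborel"])
  finally show "emeasure uniform_sphere A * emeasure (radial_measure TYPE('a)) B =
      emeasure (distr lborel (borel \<Otimes>\<^sub>M borel) (\<lambda>x. (x /\<^sub>R norm x, norm x))) (A \<times> B)"
    by (simp add: m1 N_def)
qed

lemma nn_integral_polar:
  fixes f :: "'a::euclidean_space \<Rightarrow> ennreal"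
  assumes [measurable]: "f \<in> borel_measurable borel"
  shows "(\<integral>\<^sup>+x. f x \<partial>lborel) = (\<integral>\<^sup>+\<theta>. (\<integral>\<^sup>+r. ennreal (indicator {0<..} r *
     (real DIM('a) * unit_ball_vol (real DIM('a)) * r ^ (DIM('a) - 1))) * f (r *\<^sub>R \<theta>) \<partial>lborel) \<partial>uniform_sphere)"
proof -
  interpret r: sigma_finite_measure "radial_measure TYPE('a)" by (rule sigma_finite_radial_measure)
  have sb: "sets (uniform_sphere :: 'a measure) = sets borel" "sets (radial_measure TYPE('a)) = sets borel"
    by (simp_all add: uniform_sphere_def radial_measure_def)
  have m: "(\<lambda>(\<theta>, r). f (r *\<^sub>R \<theta>)) \<in> borel_measurable (uniform_sphere \<Otimes>\<^sub>M radial_measure TYPE('a))"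
    by (subst measurable_cong_sets[OF sets_pair_measure_cong[OF sb] refl]) measurable
  have "(\<integral>\<^sup>+x. f x \<partial>lborel) = (\<integral>\<^sup>+x. f (norm x *\<^sub>R (x /\<^sub>R norm x)) \<partial>lborel)"
    by (intro nn_integral_cong arg_cong[where f=f]) (simp add: divide_simps)
  also have "\<dots> = (\<integral>\<^sup>+z. (case z of (\<theta>, r) \<Rightarrow> f (r *\<^sub>R \<theta>)) \<partial>(uniform_sphere \<Otimes>\<^sub>M radial_measure TYPE('a)))"
    unfolding polar_decomposition by (subst nn_integral_distr) auto
  also have "\<dots> = (\<integral>\<^sup>+\<theta>. \<integral>\<^sup>+r. f (r *\<^sub>R \<theta>) \<partial>radial_measure TYPE('a) \<partial>uniform_sphere)"
    using r.nn_integral_fst[OF m] by simp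
  also have "\<dots> = (\<integral>\<^sup>+\<theta>. (\<integral>\<^sup>+r. ennreal (indicator {0<..} r *
     (real DIM('a) * unit_ball_vol (real DIM('a)) * r ^ (DIM('a) - 1))) * f (r *\<^sub>R \<theta>) \<partial>lborel) \<partial>uniform_sphere)"
    unfolding radial_measure_def by (intro nn_integral_cong, subst nn_integral_density) auto
  finally show ?thesis .
qed

section \<open>The isotropic Pareto density\<close>

lemma lborel_scale:
  fixes f :: "'a::euclidean_space \<Rightarrow> real"
  assumes R: "0 < R"
  shows lborel_integrable_scale: "integrable lborel f \<Longrightarrow> integrable lborel (\<lambda>y. f (R *\<^sub>R y))"
    and lborel_integral_scale: "f \<in> borel_measurable borel \<Longrightarrow>
      (LINT y|lborel. f y) = R ^ DIM('a) * (LINT y|lborel. f (R *\<^sub>R y))"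
proof -
  have e: "lborel = density (distr lborel borel (\<lambda>x::'a. 0 + R *\<^sub>R x)) (\<lambda>_. ennreal (R ^ DIM('a)))"
    using lborel_affine[of R "0::'a"] R by simp
  show "(LINT y|lborel. f y) = R ^ DIM('a) * (LINT y|lborel. f (R *\<^sub>R y))" if [measurable]: "f \<in> borel_measurable borel"
    using R by (subst e) (simp add: integral_density integral_distr)
  assume "integrable lborel f"
  then have [measurable]: "f \<in> borel_measurable borel" and "integrable (density (distr lborel borel (\<lambda>x::'a. 0 + R *\<^sub>R x)) (\<lambda>_. ennreal (R ^ DIM('a)))) f"
    by (auto, subst (asm) e, simp)
  then have "integrable (distr lborel borel (\<lambda>x::'a. 0 + R *\<^sub>R x)) (\<lambda>x. R ^ DIM('a) * f x)"
    using R by (simp add: integrable_density)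
  then have "integrable (distr lborel borel (\<lambda>x::'a. 0 + R *\<^sub>R x)) f"
    using R by simp
  then show "integrable lborel (\<lambda>y. f (R *\<^sub>R y))"
    by (subst (asm) integrable_distr_eq) auto
qed

lemma nn_integral_powr_tail:
  fixes \<alpha> :: real
  assumes \<alpha>: "0 < \<alpha>" and R: "1 \<le> R"
  shows "(\<integral>\<^sup>+r. ennreal (\<alpha> * r powr (- 1 - \<alpha>)) * indicator {R..} r \<partial>lborel) = ennreal (R powr (- \<alpha>))"
proof -
  have "(\<integral>\<^sup>+r. ennreal (\<alpha> * r powr (- 1 - \<alpha>)) * indicator {R..} r \<partial>lborel) = ennreal (0 - (- (R powr (- \<alpha>))))"
  proof (rule nn_integral_FTC_atLeast[where F="\<lambda>r. - (r powr (- \<alpha>))"])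
    have [simp]: "- \<alpha> - 1 = - 1 - \<alpha>" by simp
    fix x assume "R \<le> x"
    then show "((\<lambda>r. - (r powr (- \<alpha>))) has_real_derivative \<alpha> * x powr (- 1 - \<alpha>)) (at x)"
      using R by (auto intro!: derivative_eq_intros)
  next
    show "((\<lambda>r. - (r powr (- \<alpha>))) \<longlongrightarrow> 0) at_top"
      using tendsto_minus[OF tendsto_neg_powr[OF _ filterlim_ident, of "-\<alpha>"]] \<alpha> by simp
  qed (use \<alpha> in auto)
  then show ?thesis by simp
qed

locale pareto =
  fixes \<alpha> :: real and p :: "'a::euclidean_space \<Rightarrow> real"
  assumes \<alpha>: "0 < \<alpha>" "\<alpha> < 2" and p_def: "p = pareto_density \<alpha>"
begin

definition pareto_const :: real where "pareto_const = \<alpha> / (real DIM('a) * unit_ball_vol (real DIM('a)))"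

lemma pareto_const_pos: "0 < pareto_const"
  using \<alpha> unit_ball_vol_pos[of "real DIM('a)"] by (simp add: pareto_const_def)

lemma p_eq: "p y = pareto_const * norm y powr (- (real DIM('a) + \<alpha>)) * indicator {1..} (norm y)"
  unfolding p_def pareto_density_def pareto_const_def unit_ball_vol_def powr_minus
  by (simp add: field_simps)

lemma p_nonneg: "0 \<le> p y"
  using pareto_const_pos by (simp add: p_eq)

lemma p_measurable [measurable]: "p \<in> borel_measurable borel"
  unfolding p_eq[abs_def] by measurable

lemma p_even: "p (- y) = p y"
  by (simp add: p_eq)

text \<open>The Jacobian r^(d-1) cancels the dimension in the density: the direction is uniform and
  the radius has the one-dimensional Pareto density \<alpha> r^(-1-\<alpha>) on r \<ge> 1.\<close>

lemma nn_integral_pareto: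
  assumes [measurable]: "f \<in> borel_measurable borel"
  shows "(\<integral>\<^sup>+y. ennreal (p y) * f y \<partial>lborel) =
    (\<integral>\<^sup>+\<theta>. (\<integral>\<^sup>+r. ennreal (\<alpha> * r powr (- 1 - \<alpha>) * indicator {1..} r) * f (r *\<^sub>R \<theta>) \<partial>lborel) \<partial>uniform_sphere)"
proof -
  have "(\<integral>\<^sup>+y. ennreal (p y) * f y \<partial>lborel) = (\<integral>\<^sup>+\<theta>. (\<integral>\<^sup>+r. ennreal (indicator {0<..} r *
     (real DIM('a) * unit_ball_vol (real DIM('a)) * r ^ (DIM('a) - 1))) * (ennreal (p (r *\<^sub>R \<theta>)) * f (r *\<^sub>R \<theta>)) \<partial>lborel) \<partial>uniform_sphere)"
    by (rule nn_integral_polar) measurable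
  also have "\<dots> = (\<integral>\<^sup>+\<theta>. (\<integral>\<^sup>+r. ennreal (\<alpha> * r powr (- 1 - \<alpha>) * indicator {1..} r) * f (r *\<^sub>R \<theta>) \<partial>lborel) \<partial>uniform_sphere)"
  proof (rule nn_integral_cong_AE)
    show "AE \<theta> in uniform_sphere. (\<integral>\<^sup>+r. ennreal (indicator {0<..} r *
       (real DIM('a) * unit_ball_vol (real DIM('a)) * r ^ (DIM('a) - 1))) * (ennreal (p (r *\<^sub>R \<theta>)) * f (r *\<^sub>R \<theta>)) \<partial>lborel)
       = (\<integral>\<^sup>+r. ennreal (\<alpha> * r powr (- 1 - \<alpha>) * indicator {1..} r) * f (r *\<^sub>R \<theta>) \<partial>lborel)"
      using AE_uniform_sphere
    proof eventually_elim
      fix \<theta> :: 'a assume "\<theta> \<in> sphere 0 1"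
      then have \<theta>: "norm \<theta> = 1" by simp
      have "indicator {0<..} r * (real DIM('a) * unit_ball_vol (real DIM('a)) * r ^ (DIM('a) - 1)) * p (r *\<^sub>R \<theta>)
         = \<alpha> * r powr (- 1 - \<alpha>) * indicator {1..} r" for r :: real
      proof (cases "1 \<le> r")
        case True
        have "r ^ (DIM('a) - 1) * r powr (- (real DIM('a) + \<alpha>)) = r powr (- 1 - \<alpha>)"
          using True by (simp add: of_nat_diff flip: powr_realpow powr_add)
        then show ?thesis
          using True \<theta> unit_ball_vol_pos[of "real DIM('a)", THEN less_imp_neq] by (simp add: p_eq pareto_const_def)
      qed (use \<theta> in \<open>auto simp: p_eq indicator_def\<close>)
      then show "(\<integral>\<^sup>+r. ennreal (indicator {0<..} r *
       (real DIM('a) * unit_ball_vol (real DIM('a)) * r ^ (DIM('a) - 1))) * (ennreal (p (r *\<^sub>R \<theta>)) * f (r *\<^sub>R \<theta>)) \<partial>lborel)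
       = (\<integral>\<^sup>+r. ennreal (\<alpha> * r powr (- 1 - \<alpha>) * indicator {1..} r) * f (r *\<^sub>R \<theta>) \<partial>lborel)"
        by (intro nn_integral_cong) (simp add: p_nonneg flip: mult.assoc ennreal_mult'')
    qed
  qed
  finally show ?thesis .
qed

lemma nn_integral_pareto_radial:
  assumes [measurable]: "f \<in> borel_measurable borel"
  shows "(\<integral>\<^sup>+y. ennreal (p y) * f (norm y) \<partial>lborel) =
    (\<integral>\<^sup>+r. ennreal (\<alpha> * r powr (- 1 - \<alpha>) * indicator {1..} r) * f r \<partial>lborel)"
proof -
  interpret S: prob_space "uniform_sphere :: 'a measure" by (rule prob_space_uniform_sphere)
  have "(\<integral>\<^sup>+y. ennreal (p y) * f (norm y) \<partial>lborel) =
    (\<integral>\<^sup>+\<theta>. (\<integral>\<^sup>+r. ennreal (\<alpha> * r powr (- 1 - \<alpha>) * indicator {1..} r) * f (norm (r *\<^sub>R \<theta>)) \<partial>lborel) \<partial>(uniform_sphere :: 'a measure))"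
    by (rule nn_integral_pareto) measurable
  also have "\<dots> = (\<integral>\<^sup>+\<theta>. (\<integral>\<^sup>+r. ennreal (\<alpha> * r powr (- 1 - \<alpha>) * indicator {1..} r) * f r \<partial>lborel) \<partial>(uniform_sphere :: 'a measure))"
    using AE_uniform_sphere
    by (intro nn_integral_cong_AE) (auto elim!: eventually_mono intro!: nn_integral_cong simp: indicator_def)
  finally show ?thesis by (simp add: S.emeasure_space_1)
qed

lemma pareto_tail:
  assumes R: "1 \<le> R"
  shows "integrable lborel (\<lambda>y. p y * indicator {R..} (norm y))"
    "(LINT y|lborel. p y * indicator {R..} (norm y)) = R powr (- \<alpha>)"
proof -
  have "(\<integral>\<^sup>+y. ennreal (p y * indicator {R..} (norm y)) \<partial>lborel) = (\<integral>\<^sup>+y. ennreal (p y) * indicator {R..} (norm y) \<partial>lborel)"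
    by (intro nn_integral_cong) (simp add: indicator_def)
  also have "\<dots> = (\<integral>\<^sup>+r. ennreal (\<alpha> * r powr (- 1 - \<alpha>) * indicator {1..} r) * indicator {R..} r \<partial>lborel)"
    by (rule nn_integral_pareto_radial) measurable
  also have "\<dots> = (\<integral>\<^sup>+r. ennreal (\<alpha> * r powr (- 1 - \<alpha>)) * indicator {R..} r \<partial>lborel)"
    using R by (intro nn_integral_cong) (simp add: indicator_def)
  finally have "(\<integral>\<^sup>+y. ennreal (p y * indicator {R..} (norm y)) \<partial>lborel) = ennreal (R powr (- \<alpha>))"
    by (simp add: nn_integral_powr_tail[OF \<alpha>(1) R])
  then have "has_bochner_integral lborel (\<lambda>y. p y * indicator {R..} (norm y)) (R powr (- \<alpha>))"
    by (intro has_bochner_integral_nn_integral) (auto simp: p_nonneg)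
  then show "integrable lborel (\<lambda>y. p y * indicator {R..} (norm y))"
    "(LINT y|lborel. p y * indicator {R..} (norm y)) = R powr (- \<alpha>)"
    by (auto simp: has_bochner_integral_iff)
qed

lemma p_integrable: "integrable lborel p" and integral_p: "(LINT y|lborel. p y) = 1"
proof -
  have "(\<lambda>y. p y * indicator {1..} (norm y)) = p" by (auto simp: p_eq indicator_def)
  then show "integrable lborel p" "(LINT y|lborel. p y) = 1" using pareto_tail[of 1] by auto
qed

lemma pareto_body:
  assumes R: "1 \<le> R" shows "(LINT y|lborel. p y * indicator {..<R} (norm y)) = 1 - R powr (- \<alpha>)"
proof -
  have "(LINT y|lborel. p y * indicator {..<R} (norm y)) = (LINT y|lborel. p y - p y * indicator {R..} (norm y))"
    by (intro Bochner_Integration.integral_cong) (auto simp: indicator_def)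
  then show ?thesis using p_integrable integral_p pareto_tail[OF R] by simp
qed

text \<open>Below R the integrand \<alpha> r^(1-\<alpha>) / R^2 contributes at most
  \<alpha>/(2-\<alpha>) R^(-\<alpha>), since \<alpha> < 2 lets the upper end point dominate; the
  tail beyond R contributes R^(-\<alpha>). The sum has the constant 2/(2-\<alpha>).\<close>

lemma pareto_truncated_second_moment:
  assumes R: "1 \<le> R"
  shows "(LINT y|lborel. p y * min 1 ((norm y / R)\<^sup>2)) \<le> 2 / (2 - \<alpha>) * R powr (- \<alpha>)"
proof -
  have e: "R powr (2 - \<alpha>) / R\<^sup>2 = R powr (- \<alpha>)" using R by (simp add: powr_diff powr_minus field_simps powr_numeral)
  have "(\<integral>\<^sup>+y. ennreal (p y * min 1 ((norm y / R)\<^sup>2)) \<partial>lborel) = (\<integral>\<^sup>+y. ennreal (p y) * ennreal (min 1 ((norm y / R)\<^sup>2)) \<partial>lborel)"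
    by (intro nn_integral_cong) (simp add: p_nonneg flip: ennreal_mult)
  also have "\<dots> = (\<integral>\<^sup>+r. ennreal (\<alpha> * r powr (- 1 - \<alpha>) * indicator {1..} r) * ennreal (min 1 ((r / R)\<^sup>2)) \<partial>lborel)"
    by (rule nn_integral_pareto_radial) measurable
  also have "\<dots> \<le> (\<integral>\<^sup>+r. ennreal (\<alpha> * r powr (1 - \<alpha>) / R\<^sup>2) * indicator {1..R} r + ennreal (\<alpha> * r powr (- 1 - \<alpha>)) * indicator {R..} r \<partial>lborel)"
  proof (intro nn_integral_mono)
    fix r :: real
    consider "r < 1" | "1 \<le> r" "r < R" | "R \<le> r" by linarith
    then show "ennreal (\<alpha> * r powr (- 1 - \<alpha>) * indicator {1..} r) * ennreal (min 1 ((r / R)\<^sup>2))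
      \<le> ennreal (\<alpha> * r powr (1 - \<alpha>) / R\<^sup>2) * indicator {1..R} r + ennreal (\<alpha> * r powr (- 1 - \<alpha>)) * indicator {R..} r"
    proof cases
      case 2
      have "r powr (- 1 - \<alpha>) * (r / R)\<^sup>2 = r powr (1 - \<alpha>) / R\<^sup>2"
        using 2 by (simp add: power_divide flip: powr_numeral powr_add)
      moreover have "\<alpha> * r powr (- 1 - \<alpha>) * min 1 ((r / R)\<^sup>2) \<le> \<alpha> * r powr (- 1 - \<alpha>) * (r / R)\<^sup>2"
        using \<alpha> by (intro mult_left_mono) auto
      ultimately have "\<alpha> * r powr (- 1 - \<alpha>) * min 1 ((r / R)\<^sup>2) \<le> \<alpha> * r powr (1 - \<alpha>) / R\<^sup>2"
        by (simp add: mult.assoc)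
      then show ?thesis using 2 \<alpha> R by (simp flip: ennreal_mult)
    next
      case 3
      have "\<alpha> * r powr (- 1 - \<alpha>) * min 1 ((r / R)\<^sup>2) \<le> \<alpha> * r powr (- 1 - \<alpha>) * 1"
        using \<alpha> by (intro mult_left_mono) auto
      then have "ennreal (\<alpha> * r powr (- 1 - \<alpha>) * min 1 ((r / R)\<^sup>2)) \<le> ennreal (\<alpha> * r powr (- 1 - \<alpha>))"
        by (intro ennreal_leI) simp
      then show ?thesis using 3 \<alpha> R by (simp add: add_increasing flip: ennreal_mult)
    qed simp
  qed
  also have "\<dots> = (\<integral>\<^sup>+r. ennreal (\<alpha> * r powr (1 - \<alpha>) / R\<^sup>2) * indicator {1..R} r \<partial>lborel) + ennreal (R powr (- \<alpha>))"
    by (subst nn_integral_add) (auto simp: nn_integral_powr_tail[OF \<alpha>(1) R])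
  also have "(\<integral>\<^sup>+r. ennreal (\<alpha> * r powr (1 - \<alpha>) / R\<^sup>2) * indicator {1..R} r \<partial>lborel) =
     ennreal (\<alpha> / (2 - \<alpha>) / R\<^sup>2 * R powr (2 - \<alpha>) - \<alpha> / (2 - \<alpha>) / R\<^sup>2 * 1 powr (2 - \<alpha>))"
  proof (rule nn_integral_FTC_Icc[where F="\<lambda>r. \<alpha> / (2 - \<alpha>) / R\<^sup>2 * r powr (2 - \<alpha>)"])
    fix x assume "x \<in> {1..R}"
    then have "((\<lambda>r. \<alpha> / (2 - \<alpha>) / R\<^sup>2 * r powr (2 - \<alpha>)) has_real_derivative
        \<alpha> / (2 - \<alpha>) / R\<^sup>2 * ((2 - \<alpha>) * x powr (2 - \<alpha> - 1))) (at x)"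
      by (intro DERIV_cmult has_real_derivative_powr) auto
    moreover have "\<alpha> / (2 - \<alpha>) / R\<^sup>2 * ((2 - \<alpha>) * x powr (2 - \<alpha> - 1)) = \<alpha> * x powr (1 - \<alpha>) / R\<^sup>2"
      using \<alpha> by simp
    ultimately show "((\<lambda>r. \<alpha> / (2 - \<alpha>) / R\<^sup>2 * r powr (2 - \<alpha>)) has_real_derivative \<alpha> * x powr (1 - \<alpha>) / R\<^sup>2) (at x)"
      by simp
  qed (use R \<alpha> in auto)
  also have "\<dots> + ennreal (R powr (- \<alpha>)) \<le> ennreal (\<alpha> / (2 - \<alpha>) * R powr (- \<alpha>)) + ennreal (R powr (- \<alpha>))"
    using \<alpha> by (intro add_mono ennreal_leI) (simp_all flip: e)
  also have "\<dots> = ennreal (\<alpha> / (2 - \<alpha>) * R powr (- \<alpha>) + R powr (- \<alpha>))"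
    using \<alpha> by (subst ennreal_plus) auto
  also have "\<alpha> / (2 - \<alpha>) * R powr (- \<alpha>) + R powr (- \<alpha>) = 2 / (2 - \<alpha>) * R powr (- \<alpha>)"
    using \<alpha> by (simp add: field_simps)
  finally have "(\<integral>\<^sup>+y. ennreal (p y * min 1 ((norm y / R)\<^sup>2)) \<partial>lborel) \<le> ennreal (2 / (2 - \<alpha>) * R powr (- \<alpha>))" .
  then show ?thesis
    using \<alpha> by (subst integral_eq_nn_integral) (auto simp: p_nonneg intro!: enn2real_leI)
qed

end

section \<open>Translation modulus of the Pareto density in mean\<close>

lemma powr_neg_diff_le:
  fixes a b \<rho> q :: real
  assumes q: "0 \<le> q" and "1 \<le> \<rho>" "\<rho> \<le> a" "\<rho> \<le> b"
  shows "\<bar>a powr (- q) - b powr (- q)\<bar> \<le> q * \<rho> powr (- q) * \<bar>a - b\<bar>"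
proof -
  have *: "a powr (- q) - b powr (- q) \<le> q * \<rho> powr (- q) * \<bar>a - b\<bar> \<and> b powr (- q) \<le> a powr (- q)"
    if ab: "a \<le> b" and \<rho>: "\<rho> \<le> a" for a b
  proof
    have a: "1 \<le> a" using \<rho> \<open>1 \<le> \<rho>\<close> by simp
    have "1 - q * ln (b / a) \<le> exp (- (q * ln (b / a)))"
      using exp_ge_add_one_self[of "- (q * ln (b / a))"] by simp
    then have "1 - q * ln (b / a) \<le> (b / a) powr (- q)" using a ab by (simp add: powr_def)
    then have "a powr (- q) * (1 - q * ln (b / a)) \<le> a powr (- q) * (b / a) powr (- q)"
      by (intro mult_left_mono) auto
    also have "\<dots> = b powr (- q)" using a ab by (simp flip: powr_mult)
    finally have "a powr (- q) - b powr (- q) \<le> a powr (- q) * (q * ln (b / a))"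
      using a by (simp add: algebra_simps)
    also have "\<dots> \<le> a powr (- q) * (q * \<bar>a - b\<bar>)"
    proof (intro mult_left_mono)
      have "ln (b / a) \<le> b / a - 1" using a ab by (intro ln_le_minus_one) auto
      also have "\<dots> = (b - a) / a" using a by (simp add: field_simps)
      \<comment> \<open>The mean value theorem would give the exponent -q - 1; the extra factor 1/a
        \<le> 1 is discarded, so that the majorant has the same form as the function itself.\<close>
      also have "\<dots> \<le> (b - a) / 1" using a ab by (intro divide_left_mono) auto
      finally show "ln (b / a) \<le> \<bar>a - b\<bar>" by simp
    qed (use q in auto)
    also have "\<dots> \<le> \<rho> powr (- q) * (q * \<bar>a - b\<bar>)"
      using \<rho> \<open>1 \<le> \<rho>\<close> q by (intro mult_right_mono powr_mono2') auto
    finally show "a powr (- q) - b powr (- q) \<le> q * \<rho> powr (- q) * \<bar>a - b\<bar>"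
      by (simp add: ac_simps)
    show "b powr (- q) \<le> a powr (- q)" using a ab q by (intro powr_mono2') auto
  qed
  show ?thesis
  proof (cases "a \<le> b")
    case True then show ?thesis using *[of a b] assms by auto
  next
    case False then show ?thesis using *[of b a] assms by (auto simp: abs_minus_commute)
  qed
qed

text \<open>The symmetric difference of the ball and its translate lies in the shell between the
  radii 1 - |h| and 1 + |h|. Its volume is linear in |h| up to a crude constant: 3^d comes from the
  outer radius, d from the inner one by Bernoulli's inequality.\<close>

lemma ball_translation_modulus:
  fixes h :: "'a::euclidean_space"
  assumes h: "norm h \<le> 1"
  shows "(LINT y|lborel. \<bar>indicator (ball 0 1) (y - h) - indicator (ball 0 1) y :: real\<bar>)
     \<le> unit_ball_vol (real DIM('a)) * (3 ^ DIM('a) + real DIM('a)) * norm h"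
proof -
  define t where "t = norm h"
  have t: "0 \<le> t" "t \<le> 1" using h by (auto simp: t_def)
  have i: "integrable lborel (indicator (ball 0 r) :: 'a \<Rightarrow> real)" for r
    using emeasure_lborel_ball_finite[of "0::'a" r] by (auto simp: less_top)
  have c: "(LINT y|lborel. indicator (ball (0::'a) r) y) = unit_ball_vol (real DIM('a)) * r ^ DIM('a)" if "0 \<le> r" for r
    using that content_ball[of r "0::'a"] by simp
  have "(LINT y|lborel. \<bar>indicator (ball 0 1) (y - h) - indicator (ball 0 1) y :: real\<bar>)
    \<le> (LINT y|lborel. indicator (ball 0 (1 + t)) y - indicator (ball (0::'a) (1 - t)) y)"
  proof (intro integral_mono integrable_abs Bochner_Integration.integrable_diff i integrable_lborel_shift)
    fix y :: 'a
    have "norm y - t \<le> norm (y - h)" "norm (y - h) \<le> norm y + t"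
      using norm_triangle_ineq2[of y h] norm_triangle_ineq4[of y h] by (auto simp: t_def)
    then show "\<bar>indicator (ball 0 1) (y - h) - indicator (ball 0 1) y :: real\<bar>
        \<le> indicator (ball 0 (1 + t)) y - indicator (ball 0 (1 - t)) y"
      using t by (auto simp: indicator_def dist_norm norm_minus_commute)
  qed
  also have "\<dots> = unit_ball_vol (real DIM('a)) * ((1 + t) ^ DIM('a) - (1 - t) ^ DIM('a))"
    using t i c[of "1 + t"] c[of "1 - t"] by (simp add: right_diff_distrib)
  also have "\<dots> \<le> unit_ball_vol (real DIM('a)) * ((3 ^ DIM('a) + real DIM('a)) * t)"
  proof (intro mult_left_mono)
    have "(1 + t) ^ n \<le> 1 + 3 ^ n * t" for n
    proof (induction n)
      case (Suc n)
      have "(1 + t) ^ Suc n \<le> (1 + t) * (1 + 3 ^ n * t)" using Suc t by (simp add: mult_left_mono)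
      also have "\<dots> = 1 + t * 1 + 3 ^ n * t + 3 ^ n * t * t" by (simp add: algebra_simps)
      also have "\<dots> \<le> 1 + t * 3 ^ n + 3 ^ n * t + 3 ^ n * t * 1"
        using t by (intro add_mono mult_left_mono) auto
      finally show ?case by (simp add: ac_simps)
    qed (use t in simp)
    moreover have "1 + real DIM('a) * (- t) \<le> (1 + (- t)) ^ DIM('a)"
      using t by (intro Bernoulli_inequality) auto
    ultimately show "(1 + t) ^ DIM('a) - (1 - t) ^ DIM('a) \<le> (3 ^ DIM('a) + real DIM('a)) * t"
      by (smt (verit) ring_class.ring_distribs)
  qed auto
  finally show ?thesis by (simp add: t_def ac_simps)
qed

context pareto
begin

text \<open>The density jumps on the unit sphere. Up to the constant it is a Lipschitz profile
  \<open>F\<close>, equal to 1 on the unit ball, minus the indicator \<open>I\<close> of that ball;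
  both parts are regular in mean. For |h| > 1 the trivial bound 2 suffices.\<close>

lemma p_translation_modulus:
  "\<exists>C0\<ge>0. \<forall>h. (LINT y|lborel. \<bar>p (y - h) - p y\<bar>) \<le> C0 * norm h"
proof -
  define q where "q = real DIM('a) + \<alpha>"
  have q: "0 < q" using \<alpha> by (simp add: q_def add_nonneg_pos)
  define F where "F y = max 1 (norm y) powr (- q)" for y :: 'a
  define I where "I = (indicator (ball 0 1) :: 'a \<Rightarrow> real)"
  have [measurable]: "F \<in> borel_measurable borel"
    unfolding F_def[abs_def] by measurable
  have [measurable]: "I \<in> borel_measurable borel"
    unfolding I_def by (intro borel_measurable_indicator) auto
  have pF: "p y = pareto_const * (F y - I y)" for y
    by (auto simp: p_eq F_def I_def q_def indicator_def dist_norm max_def)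
  have iI: "integrable lborel I"
    using emeasure_lborel_ball_finite[of "0::'a" 1] by (auto simp: less_top I_def)
  have iF: "integrable lborel F"
  proof -
    have "F = (\<lambda>y. p y / pareto_const + I y)" using pareto_const_pos by (auto simp: pF)
    then show ?thesis using p_integrable iI by simp
  qed
  \<comment> \<open>For |h| \<le> 1 the number max(1, |y|/2) is a lower bound of max(1, |y|) and of
    max(1, |y - h|); hence q |h| times \<open>G\<close> dominates the increment of \<open>F\<close>,
    and \<open>G\<close> is integrable by scaling.\<close>
  define G where "G y = F ((1 / 2) *\<^sub>R y)" for y
  have iG: "integrable lborel G" unfolding G_def[abs_def] by (intro lborel_integrable_scale iF) simp
  define C where "C = pareto_const * (q * (LINT y|lborel. G y) + unit_ball_vol (real DIM('a)) * (3 ^ DIM('a) + real DIM('a)))"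
  have "0 \<le> (LINT y|lborel. G y)" by (simp add: G_def F_def)
  then have C: "0 \<le> C" using q pareto_const_pos by (auto simp: C_def intro!: mult_nonneg_nonneg add_nonneg_nonneg)
  have "(LINT y|lborel. \<bar>p (y - h) - p y\<bar>) \<le> (2 + C) * norm h" for h
  proof (cases "norm h \<le> 1")
    case False
    have "(LINT y|lborel. \<bar>p (y - h) - p y\<bar>) \<le> (LINT y|lborel. p (y - h) + p y)"
      using p_nonneg by (intro integral_mono integrable_abs Bochner_Integration.integrable_diff
         Bochner_Integration.integrable_add integrable_lborel_shift p_integrable) (auto simp: abs_le_iff add_increasing2 add_increasing)
    also have "\<dots> = 2" using p_integrable integrable_lborel_shift[OF p_integrable, of h]
      by (simp add: integral_lborel_shift integral_p)
    also have "\<dots> \<le> 2 * norm h" using False by simp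
    also have "\<dots> \<le> (2 + C) * norm h" using C by (intro mult_right_mono) auto
    finally show ?thesis .
  next
    case True
    have Fd: "\<bar>F (y - h) - F y\<bar> \<le> q * G y * norm h" for y
    proof -
      have n: "norm y - norm h \<le> norm (y - h)" "norm (y - h) \<le> norm y + norm h"
        using norm_triangle_ineq2[of y h] norm_triangle_ineq4[of y h] by auto
      have "\<bar>F (y - h) - F y\<bar> \<le> q * max 1 (norm ((1/2) *\<^sub>R y)) powr (- q) * \<bar>max 1 (norm (y - h)) - max 1 (norm y)\<bar>"
        unfolding F_def using n True q by (intro powr_neg_diff_le) (auto simp: max_def)
      also have "\<dots> \<le> q * max 1 (norm ((1/2) *\<^sub>R y)) powr (- q) * norm h"
        using n q by (intro mult_left_mono) (auto simp: max_def)
      finally show ?thesis by (simp add: G_def F_def)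
    qed
    have "(LINT y|lborel. \<bar>p (y - h) - p y\<bar>) \<le> (LINT y|lborel. pareto_const * (q * G y * norm h) + pareto_const * \<bar>I (y - h) - I y\<bar>)"
    proof (intro integral_mono integrable_abs Bochner_Integration.integrable_diff Bochner_Integration.integrable_add
        integrable_lborel_shift p_integrable integrable_mult_right integrable_mult_left iG iI)
      fix y
      have "\<bar>p (y - h) - p y\<bar> = pareto_const * \<bar>(F (y - h) - F y) - (I (y - h) - I y)\<bar>"
        using pareto_const_pos by (simp add: pF abs_mult_pos' flip: right_diff_distrib) (simp add: algebra_simps)
      also have "\<dots> \<le> pareto_const * (q * G y * norm h + \<bar>I (y - h) - I y\<bar>)"
        using pareto_const_pos Fd[of y] by (intro mult_left_mono) auto
      finally show "\<bar>p (y - h) - p y\<bar> \<le> pareto_const * (q * G y * norm h) + pareto_const * \<bar>I (y - h) - I y\<bar>"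
        by (simp add: algebra_simps)
    qed
    also have "\<dots> = pareto_const * (q * (LINT y|lborel. G y) * norm h) + pareto_const * (LINT y|lborel. \<bar>I (y - h) - I y\<bar>)"
      using iG iI integrable_lborel_shift[OF iI, of h] by simp
    also have "\<dots> \<le> pareto_const * (q * (LINT y|lborel. G y) * norm h) + pareto_const * (unit_ball_vol (real DIM('a)) * (3 ^ DIM('a) + real DIM('a)) * norm h)"
      using ball_translation_modulus[OF True] pareto_const_pos by (intro add_left_mono mult_left_mono) (auto simp: I_def)
    also have "\<dots> = C * norm h" by (simp add: C_def algebra_simps)
    also have "\<dots> \<le> (2 + C) * norm h" by (intro mult_right_mono) auto
    finally show ?thesis .
  qed
  then show ?thesis using C by (intro exI[of _ "2 + C"]) auto
qed

text \<open>Density form of the self-similarity: R^(-\<alpha>) is the probability of a norm of at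
  least R, and R^(-d) comes from the Jacobian of the dilation.\<close>

lemma p_scale:
  assumes R: "1 \<le> R"
  shows "p (R *\<^sub>R z) * indicator {R..} (norm (R *\<^sub>R z)) = R powr (- \<alpha>) / R ^ DIM('a) * p z"
proof (cases "1 \<le> norm z")
  case True
  have "R powr (- (real DIM('a) + \<alpha>)) = R powr (- \<alpha>) / R ^ DIM('a)"
  proof -
    have "- (real DIM('a) + \<alpha>) = - \<alpha> + - real DIM('a)" by simp
    then show ?thesis using R by (simp only: powr_add powr_minus[of R "real DIM('a)"]) (simp add: powr_realpow divide_inverse)
  qed
  moreover have "R \<le> R * norm z" using True R by simp
  moreover have "1 \<le> R * norm z" using True R by (simp add: mult_ge1_I)
  ultimately show ?thesis using R True by (simp only: p_eq) (simp add: powr_mult)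
next
  case False
  then have "\<not> R \<le> R * norm z" using R by simp
  then show ?thesis using R False by (simp add: p_eq)
qed

text \<open>After scaling by R the tail is R^(-\<alpha>) times a copy of p shifted by h/R. In terms
  of the mass u = R^(-\<alpha>) the factor is u^(1 + 1/\<alpha>), the form that the random walk
  argument asks for.\<close>

lemma tail_translation_modulus:
  assumes C0: "\<And>h. (LINT y|lborel. \<bar>p (y - h) - p y\<bar>) \<le> C0 * norm h" and R: "1 \<le> R"
  shows "(LINT y|lborel. \<bar>p (y - h) * indicator {R..} (norm (y - h)) - p y * indicator {R..} (norm y)\<bar>)
     \<le> C0 * norm h * (R powr (- \<alpha>) / R)"
proof -
  have "(LINT y|lborel. \<bar>p (y - h) * indicator {R..} (norm (y - h)) - p y * indicator {R..} (norm y)\<bar>) =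
    R ^ DIM('a) * (LINT y|lborel. \<bar>p (R *\<^sub>R y - h) * indicator {R..} (norm (R *\<^sub>R y - h)) - p (R *\<^sub>R y) * indicator {R..} (norm (R *\<^sub>R y))\<bar>)"
    using R by (subst lborel_integral_scale[of R]) auto
  also have "(LINT y|lborel. \<bar>p (R *\<^sub>R y - h) * indicator {R..} (norm (R *\<^sub>R y - h)) - p (R *\<^sub>R y) * indicator {R..} (norm (R *\<^sub>R y))\<bar>)
     = (LINT y|lborel. R powr (- \<alpha>) / R ^ DIM('a) * \<bar>p (y - h /\<^sub>R R) - p y\<bar>)"
  proof (intro Bochner_Integration.integral_cong refl)
    fix y
    have "R *\<^sub>R y - h = R *\<^sub>R (y - h /\<^sub>R R)" using R by (simp add: scaleR_diff_right)
    then show "\<bar>p (R *\<^sub>R y - h) * indicator {R..} (norm (R *\<^sub>R y - h)) - p (R *\<^sub>R y) * indicator {R..} (norm (R *\<^sub>R y))\<bar>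
      = R powr (- \<alpha>) / R ^ DIM('a) * \<bar>p (y - h /\<^sub>R R) - p y\<bar>"
      using R by (simp only: p_scale[OF R] right_diff_distrib[symmetric] abs_mult) simp
  qed
  also have "R ^ DIM('a) * \<dots> = R powr (- \<alpha>) * (LINT y|lborel. \<bar>p (y - h /\<^sub>R R) - p y\<bar>)"
    using R by simp
  also have "\<dots> \<le> R powr (- \<alpha>) * (C0 * norm (h /\<^sub>R R))"
    by (intro mult_left_mono C0) auto
  finally show ?thesis using R by (simp add: field_simps)
qed

lemma smoothing_p: "\<exists>C\<ge>0. smoothing C (1 / \<alpha>) p"
proof -
  obtain C0 where C0: "0 \<le> C0" "\<And>h. (LINT y|lborel. \<bar>p (y - h) - p y\<bar>) \<le> C0 * norm h"
    using p_translation_modulus by blast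
  \<comment> \<open>The radius u^(-1/\<alpha>) is the one beyond which \<open>p\<close> has mass
    u.\<close>
  have R: "1 \<le> u powr (- (1 / \<alpha>))" "(u powr (- (1 / \<alpha>))) powr (- \<alpha>) = u"
    "(u powr (- (1 / \<alpha>))) powr (- \<alpha>) / u powr (- (1 / \<alpha>)) = u powr (1 + 1 / \<alpha>)" if "0 < u" "u \<le> 1" for u :: real
  proof -
    show e: "(u powr (- (1 / \<alpha>))) powr (- \<alpha>) = u" using that \<alpha> by (simp add: powr_powr)
    show "1 \<le> u powr (- (1 / \<alpha>))" using that \<alpha> powr_mono2'[of "- (1/\<alpha>)" u 1] by simp
    show "(u powr (- (1 / \<alpha>))) powr (- \<alpha>) / u powr (- (1 / \<alpha>)) = u powr (1 + 1 / \<alpha>)"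
      unfolding e using that by (simp add: powr_add powr_minus field_simps)
  qed
  have "\<exists>C\<ge>0. \<forall>k\<ge>1. \<forall>B g x h. bdd_borel B g \<longrightarrow>
     \<bar>(conv_op p ^^ k) g (x + h) - (conv_op p ^^ k) g x\<bar> \<le> C * B * norm h * real k powr (- (1 / \<alpha>))"
  proof (rule conv_op_pow_lipschitz[where t="\<lambda>u y. p y * indicator {u powr (- (1 / \<alpha>))..} (norm y)" and ?C0.0=C0])
    fix u :: real and h :: 'a assume u: "0 < u" "u \<le> 1"
    show "(LINT y|lborel. \<bar>p (y - h) * indicator {u powr (- (1 / \<alpha>))..} (norm (y - h)) - p y * indicator {u powr (- (1 / \<alpha>))..} (norm y)\<bar>)
      \<le> C0 * norm h * u powr (1 + 1 / \<alpha>)"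
      using tail_translation_modulus[OF C0(2) R(1)[OF u], of h] by (simp only: R(3)[OF u])
  qed (use \<alpha> C0 R pareto_tail p_nonneg p_integrable integral_p in \<open>auto simp: mult_left_le indicator_def\<close>)
  then show ?thesis using p_integrable integral_p p_nonneg by (auto simp: smoothing_def)
qed

text \<open>Half of the mass lies beyond this radius, which is also the ratio of the normalisations
  (2 n)^(1/\<alpha>) and n^(1/\<alpha>). The two facts together make n and 2 n the natural pair to
  compare.\<close>

definition dil :: real where "dil = 2 powr (1 / \<alpha>)"

text \<open>Law of X given |X| \<ge> \<open>dil\<close>, which by self-similarity is the law of
  \<open>dil\<close> times X. In the conditional form it is visible that \<open>2 * p\<close> and
  \<open>p_dil\<close> differ only inside a ball.\<close>

definition p_dil :: "'a \<Rightarrow> real" where "p_dil = (\<lambda>y. 2 * (p y * indicator {dil..} (norm y)))"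

lemma dil: "1 \<le> dil" "dil powr (- \<alpha>) = 1 / 2"
  using \<alpha> by (auto simp: dil_def powr_powr powr_minus_divide ge_one_powr_ge_zero)

lemma conv_op_p_dil: "conv_op p_dil g x = conv_op p (\<lambda>z. g (dil *\<^sub>R z)) (x /\<^sub>R dil)"
  if g: "bdd_borel B g"
proof -
  note [measurable] = bdd_borelD(1)[OF g]
  have "conv_op p_dil g x = dil ^ DIM('a) * (LINT y|lborel. p_dil (dil *\<^sub>R y) * g (x + dil *\<^sub>R y))"
    unfolding conv_op_def p_dil_def using dil by (subst lborel_integral_scale[of dil]) auto
  also have "(LINT y|lborel. p_dil (dil *\<^sub>R y) * g (x + dil *\<^sub>R y)) = (LINT y|lborel. (p y * g (dil *\<^sub>R (x /\<^sub>R dil + y))) / dil ^ DIM('a))"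
    using dil(1) by (intro Bochner_Integration.integral_cong) (simp_all only: p_dil_def p_scale dil(2), simp_all add: scaleR_add_right)
  finally show ?thesis using dil(1) by (simp add: conv_op_def)
qed

lemma p_dil_integrable: "integrable lborel p_dil" and p_dil_norm: "(LINT y|lborel. \<bar>p_dil y\<bar>) \<le> 1"
  using pareto_tail[OF dil(1)] p_nonneg by (auto simp: p_dil_def dil(2) abs_mult)

text \<open>Conjugation by the dilation turns a walk with \<open>p_dil\<close> steps into one with
  \<open>p\<close> steps. It transfers smoothing to \<open>p_dil\<close>, and later exhibits the law
  of the normalised sum for n inside the comparison with 2 n.\<close>

lemma conv_op_p_dil_pow: 
  assumes g: "bdd_borel B g"
  shows "(conv_op p_dil ^^ k) g x = (conv_op p ^^ k) (\<lambda>z. g (dil *\<^sub>R z)) (x /\<^sub>R dil)"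
proof (induction k arbitrary: x)
  case 0 show ?case using dil by simp
next
  case (Suc k)
  have "(conv_op p_dil ^^ Suc k) g x = conv_op p (\<lambda>z. (conv_op p_dil ^^ k) g (dil *\<^sub>R z)) (x /\<^sub>R dil)"
    using conv_op_p_dil[OF bdd_borel_conv_op_pow[OF p_dil_integrable p_dil_norm g]] by simp
  also have "\<dots> = (conv_op p ^^ Suc k) (\<lambda>z. g (dil *\<^sub>R z)) (x /\<^sub>R dil)"
    using dil(1) by (simp add: Suc)
  finally show ?case .
qed

text \<open>The dilation divides the increment h by \<open>dil\<close> \<ge> 1, so the same constant
  serves.\<close>

lemma smoothing_p_dil:
  assumes "smoothing C (1 / \<alpha>) p" and C: "0 \<le> C" shows "smoothing C (1 / \<alpha>) p_dil"
  unfolding smoothing_def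
proof (intro conjI allI impI p_dil_integrable p_dil_norm)
  fix k :: nat and B and g :: "'a \<Rightarrow> real" and x h :: 'a assume k: "1 \<le> k" and g: "bdd_borel B g"
  have B: "0 \<le> B" using bdd_borelD[OF g] by simp
  have "\<bar>(conv_op p_dil ^^ k) g (x + h) - (conv_op p_dil ^^ k) g x\<bar> \<le> C * B * norm (h /\<^sub>R dil) * real k powr - (1 / \<alpha>)"
    unfolding conv_op_p_dil_pow[OF g] scaleR_add_right
    by (rule smoothingD(3)[OF assms(1) k bdd_borel_scale[OF g]])
  also have "\<dots> \<le> C * B * norm h * real k powr - (1 / \<alpha>)"
  proof (intro mult_left_mono mult_right_mono)
    have "norm h / dil \<le> norm h / 1" using dil(1) by (intro divide_left_mono) auto
    then show "norm (h /\<^sub>R dil) \<le> norm h" using dil(1) by (simp add: divide_inverse mult.commute)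
  qed (use C B in auto)
  finally show "\<bar>(conv_op p_dil ^^ k) g (x + h) - (conv_op p_dil ^^ k) g x\<bar> \<le> C * B * norm h * real k powr - (1 / \<alpha>)" .
qed

definition rate :: real where "rate = min (2 - \<alpha>) \<alpha> / \<alpha>"

lemma rate: "0 < rate" "rate = min (2 / \<alpha> - 1) 1"
  using \<alpha> by (auto simp: rate_def min_def field_simps)

lemma doubling_estimate:
  "\<exists>C\<ge>0. \<forall>n\<ge>1. \<forall>B g x. bdd_borel B g \<longrightarrow>
     \<bar>(conv_op p ^^ (2 * n)) g x - (conv_op p_dil ^^ n) g x\<bar> \<le> C * B * real n powr (- rate)"
proof -
  obtain C where C: "0 \<le> C" "smoothing C (1 / \<alpha>) p" using smoothing_p by blast
  note ds = doubling_step_bound[OF p_integrable p_nonneg integral_p p_even \<alpha>(1) _ _ pareto_truncated_second_moment p_dil_def _ C(1)]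
  have d1: "0 < dil" "(LINT y|lborel. p y * indicator {..<dil} (norm y)) = 1 / 2"
    using dil pareto_body[OF dil(1)] by auto
  obtain C1 where C1: "0 \<le> C1" "\<And>m B g x. m \<ge> 4 \<Longrightarrow> bdd_borel B g \<Longrightarrow>
     \<bar>conv_op p (conv_op p ((conv_op p ^^ m) g)) x - conv_op p_dil ((conv_op p ^^ m) g) x\<bar>
        \<le> C1 * B * (real m powr (- (2 / \<alpha>)) + real m powr (- 2))"
    using ds[OF d1 _ C(2)] by auto
  obtain C2 where C2: "0 \<le> C2" "\<And>m B g x. m \<ge> 4 \<Longrightarrow> bdd_borel B g \<Longrightarrow>
     \<bar>conv_op p (conv_op p ((conv_op p_dil ^^ m) g)) x - conv_op p_dil ((conv_op p_dil ^^ m) g) x\<bar>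
        \<le> C2 * B * (real m powr (- (2 / \<alpha>)) + real m powr (- 2))"
    using ds[OF d1 _ smoothing_p_dil[OF C(2,1)]] by auto
  define K where "K = (C1 + C2) * (2 powr (2 / \<alpha>) + 2 powr 2)"
  define C3 where "C3 = K + 2 * 8 powr rate"
  have K: "0 \<le> K" using C1 C2 by (simp add: K_def)
  have p1: "(LINT y|lborel. \<bar>p y\<bar>) \<le> 1" using integral_p p_nonneg by simp
  have "\<bar>(conv_op p ^^ (2 * n)) g x - (conv_op p_dil ^^ n) g x\<bar> \<le> C3 * B * real n powr (- rate)"
    if n: "n \<ge> 1" and g: "bdd_borel B g" for n B g x
  \<comment> \<open>Telescoping guarantees at least n/2 smoothing steps, and the bound on a single
    doubling step wants 4. For n < 8 the trivial bound 2 B is absorbed by the summand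
    \<open>2 * 8 powr rate\<close> of the constant.\<close>
  proof (cases "n \<ge> 8")
    case False
    have B: "0 \<le> B" using bdd_borelD[OF g] by simp
    have "\<bar>(conv_op p ^^ (2 * n)) g x - (conv_op p_dil ^^ n) g x\<bar> \<le> 2 * B"
      using bdd_borelD(2)[OF bdd_borel_conv_op_pow[OF p_integrable p1 g], of "2 * n" x]
        bdd_borelD(2)[OF bdd_borel_conv_op_pow[OF p_dil_integrable p_dil_norm g], of n x] by linarith
    also have "1 \<le> 8 powr rate * real n powr (- rate)"
    proof -
      have "8 powr rate * 8 powr (- rate) \<le> 8 powr rate * real n powr (- rate)"
        using False n rate(1) by (intro mult_left_mono powr_mono2') auto
      then show ?thesis by (simp flip: powr_add)
    qed
    then have "2 * B * 1 \<le> 2 * B * (8 powr rate * real n powr (- rate))" using B by (intro mult_left_mono) auto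
    also have "\<dots> \<le> C3 * B * real n powr (- rate)"
      using K B by (simp add: C3_def algebra_simps)
    finally show ?thesis by simp
  next
    case True
    have B: "0 \<le> B" using bdd_borelD[OF g] by simp
    define W where "W = (C1 + C2) * B * ((real n / 2) powr (- (2 / \<alpha>)) + (real n / 2) powr (- 2))"
    have mono: "c * B * (real m powr (- (2 / \<alpha>)) + real m powr (- 2)) \<le> W" if m: "n \<le> 2 * m" and c: "0 \<le> c" "c \<le> C1 + C2" for m c
      unfolding W_def using m c B True \<alpha> by (intro mult_mono add_mono powr_mono2') auto
    have "\<bar>(conv_op p ^^ (2 * n)) g x - (conv_op p_dil ^^ n) g x\<bar> \<le> real n * W"
    proof (rule doubling_telescope[OF p_integrable p1 p_dil_integrable p_dil_norm g])
      fix m :: nat and f :: "'a \<Rightarrow> real" and x :: 'a assume m: "n \<le> 2 * m" and f: "bdd_borel B f"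
      then have m4: "4 \<le> m" using True by simp
      show "\<bar>conv_op p (conv_op p ((conv_op p ^^ m) f)) x - conv_op p_dil ((conv_op p ^^ m) f) x\<bar> \<le> W"
        using C1(2)[OF m4 f, of x] mono[OF m, of C1] C1(1) C2(1) by linarith
      show "\<bar>conv_op p (conv_op p ((conv_op p_dil ^^ m) f)) x - conv_op p_dil ((conv_op p_dil ^^ m) f) x\<bar> \<le> W"
        using C2(2)[OF m4 f, of x] mono[OF m, of C2] C1(1) C2(1) by linarith
    qed (use True in simp)
    also have "real n * W = (C1 + C2) * B * (2 powr (2 / \<alpha>) * real n powr (1 - 2 / \<alpha>) + 2 powr 2 * real n powr (- 1))"
    proof -
      have *: "real n * (real n / 2) powr (- e) = 2 powr e * real n powr (1 - e)" for e
        using True by (simp add: powr_divide powr_minus powr_diff field_simps)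
      have "real n * W = (C1 + C2) * B * (real n * (real n / 2) powr (- (2 / \<alpha>)) + real n * (real n / 2) powr (- 2))"
        by (simp only: W_def) (simp only: distrib_left mult.left_commute)
      then show ?thesis unfolding *[of "2 / \<alpha>"] *[of 2] by simp
    qed
    also have "\<dots> \<le> (C1 + C2) * B * (2 powr (2 / \<alpha>) * real n powr (- rate) + 2 powr 2 * real n powr (- rate))"
      using C1 C2 B True by (intro mult_left_mono add_mono powr_mono) (auto simp: rate(2))
    also have "\<dots> = K * B * real n powr (- rate)" by (simp add: K_def algebra_simps)
    also have "\<dots> \<le> C3 * B * real n powr (- rate)"
      using B by (intro mult_right_mono) (auto simp: C3_def)
    finally show ?thesis .
  qed
  moreover have "0 \<le> C3" using K by (simp add: C3_def)
  ultimately show ?thesis by blast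
qed

end

section \<open>Couplings and densities\<close>

lemma couplingsD:
  assumes "\<pi> \<in> couplings \<mu> \<mu>'"
  shows "sets \<pi> = sets (borel \<Otimes>\<^sub>M borel)" "distr \<pi> borel fst = \<mu>" "distr \<pi> borel snd = \<mu>'"
  using assms by (auto simp: couplings_def)

lemma coupling_measurable:
  assumes "\<pi> \<in> couplings \<mu> \<mu>'"
  shows "fst \<in> measurable \<pi> borel" "snd \<in> measurable \<pi> borel"
  using measurable_fst[of borel borel] measurable_snd[of borel borel]
  by (simp_all add: measurable_cong_sets[OF couplingsD(1)[OF assms] refl])

lemma neq_sets: "{(x, y::'a::euclidean_space). x \<noteq> y} \<in> sets (borel \<Otimes>\<^sub>M borel)"
proof -
  have "{(x, y::'a). x \<noteq> y} = {z \<in> space (borel \<Otimes>\<^sub>M borel). fst z \<noteq> snd z}" by (auto simp: space_pair_measure)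
  also have "\<dots> \<in> sets (borel \<Otimes>\<^sub>M borel)" by measurable
  finally show ?thesis .
qed

text \<open>Shows that the infimum in \<open>d_TV\<close> ranges over a nonempty set, as bounding an
  infimum of reals from below requires.\<close>

lemma product_coupling:
  assumes "prob_space \<mu>" "prob_space \<mu>'" "sets \<mu> = sets borel" "sets \<mu>' = sets borel"
  shows "\<mu> \<Otimes>\<^sub>M \<mu>' \<in> couplings \<mu> (\<mu>' :: 'a::euclidean_space measure)"
proof -
  interpret a: prob_space \<mu> by fact
  interpret b: prob_space \<mu>' by fact
  interpret pair_prob_space \<mu> \<mu>' ..
  have "distr (\<mu> \<Otimes>\<^sub>M \<mu>') borel fst = distr (\<mu> \<Otimes>\<^sub>M \<mu>') \<mu> fst" "distr (\<mu> \<Otimes>\<^sub>M \<mu>') borel snd = distr (\<mu> \<Otimes>\<^sub>M \<mu>') \<mu>' snd"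
    using assms by (auto intro: distr_cong)
  moreover have "distr (\<mu> \<Otimes>\<^sub>M \<mu>') \<mu>' snd = \<mu>'"
  proof (rule measure_eqI)
    fix A assume A: "A \<in> sets (distr (\<mu> \<Otimes>\<^sub>M \<mu>') \<mu>' snd)"
    then have "emeasure (distr (\<mu> \<Otimes>\<^sub>M \<mu>') \<mu>' snd) A = emeasure (\<mu> \<Otimes>\<^sub>M \<mu>') (space \<mu> \<times> A)"
      by (subst emeasure_distr) (auto simp: space_pair_measure dest: sets.sets_into_space intro!: arg_cong[where f="emeasure _"])
    then show "emeasure (distr (\<mu> \<Otimes>\<^sub>M \<mu>') \<mu>' snd) A = emeasure \<mu>' A"
      using A by (simp add: b.emeasure_pair_measure_Times a.emeasure_space_1)
  qed simp
  ultimately show ?thesis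
    using assms b.distr_pair_fst[of \<mu>] by (simp add: couplings_def cong: sets_pair_measure_cong)
qed

text \<open>Under any coupling, g(x) - g(y) vanishes on the diagonal and is at most 2 in absolute
  value off it. The lower bound of the theorem applies this with a cosine as g.\<close>

lemma d_TV_ge:
  fixes \<mu> \<mu>' :: "'a::euclidean_space measure"
  assumes pr: "prob_space \<mu>" "prob_space \<mu>'" "sets \<mu> = sets borel" "sets \<mu>' = sets borel"
    and g: "g \<in> borel_measurable borel" "\<And>x. \<bar>g x\<bar> \<le> 1"
  shows "\<bar>(LINT x|\<mu>. g x) - (LINT x|\<mu>'. g x)\<bar> \<le> 2 * d_TV \<mu> \<mu>'"
proof -
  have "\<bar>(LINT x|\<mu>. g x) - (LINT x|\<mu>'. g x)\<bar> / 2 \<le> d_TV \<mu> \<mu>'"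
    unfolding d_TV_def
  proof (rule cINF_greatest)
    show "couplings \<mu> \<mu>' \<noteq> {}" using product_coupling[OF pr] by auto
    fix \<pi> assume \<pi>: "\<pi> \<in> couplings \<mu> \<mu>'"
    note [measurable] = coupling_measurable[OF \<pi>] g(1)
    \<comment> \<open>The definition of \<open>couplings\<close> does not mention the total mass; it
      is 1 because the first marginal is a probability measure.\<close>
    have "emeasure \<pi> (space \<pi>) = emeasure (distr \<pi> borel fst) (space borel)"
      by (subst emeasure_distr) (auto simp: vimage_def)
    also have "\<dots> = 1" using couplingsD(2)[OF \<pi>] prob_space.emeasure_space_1[OF pr(1)] sets_eq_imp_space_eq[OF pr(3)] by simp
    finally interpret \<pi>: prob_space \<pi> by (rule prob_spaceI)
    have ig: "integrable \<pi> (\<lambda>z. g (fst z))" "integrable \<pi> (\<lambda>z. g (snd z))"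
      using g(2) by (auto intro!: \<pi>.integrable_const_bound[where B=1])
    have N: "{(x, y). x \<noteq> y} \<in> sets \<pi>" using neq_sets by (simp add: couplingsD(1)[OF \<pi>])
    have "(LINT x|\<mu>. g x) = (LINT z|\<pi>. g (fst z))"
      by (subst couplingsD(2)[OF \<pi>, symmetric]) (simp add: integral_distr)
    moreover have "(LINT x|\<mu>'. g x) = (LINT z|\<pi>. g (snd z))"
      by (subst couplingsD(3)[OF \<pi>, symmetric]) (simp add: integral_distr)
    ultimately have "\<bar>(LINT x|\<mu>. g x) - (LINT x|\<mu>'. g x)\<bar> = \<bar>LINT z|\<pi>. g (fst z) - g (snd z)\<bar>"
      using ig by simp
    also have "\<dots> \<le> (LINT z|\<pi>. \<bar>g (fst z) - g (snd z)\<bar>)" by (rule integral_abs_bound)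
    also have "\<dots> \<le> (LINT z|\<pi>. 2 * indicator {(x, y). x \<noteq> y} z)"
    proof (rule integral_mono)
      show "integrable \<pi> (\<lambda>z. 2 * indicat_real {(x, y). x \<noteq> y} z)"
        using N by (auto intro!: integrable_mult_right \<pi>.integrable_const_bound[where B=1])
      fix z
      show "\<bar>g (fst z) - g (snd z)\<bar> \<le> 2 * indicator {(x, y). x \<noteq> y} z"
        using g(2)[of "fst z"] g(2)[of "snd z"] by (auto simp: indicator_def split_beta)
    qed (use ig in auto)
    also have "\<dots> = 2 * measure \<pi> {(x, y). x \<noteq> y}" using N by simp
    finally show "\<bar>(LINT x|\<mu>. g x) - (LINT x|\<mu>'. g x)\<bar> / 2 \<le> measure \<pi> {(x, y). x \<noteq> y}" by simp
  qed
  then show ?thesis by simp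
qed

lemma d_TV_le_coupling:
  assumes "\<pi> \<in> couplings \<mu> \<mu>'" shows "d_TV \<mu> \<mu>' \<le> measure \<pi> {(x, y). x \<noteq> y}"
  unfolding d_TV_def by (rule cINF_lower[OF _ assms]) (auto intro: bdd_belowI2[where m=0])

section \<open>Densities: maximal coupling, duality and limits in mean\<close>

definition prob_density :: "('a::euclidean_space \<Rightarrow> real) \<Rightarrow> bool" where
  "prob_density f \<longleftrightarrow> f \<in> borel_measurable borel \<and> (\<forall>x. 0 \<le> f x) \<and> integrable lborel f \<and> (LINT x|lborel. f x) = 1"

lemma nn_integral_prob_density: "prob_density f \<Longrightarrow> (\<integral>\<^sup>+x. ennreal (f x) \<partial>lborel) = 1"
  by (subst nn_integral_eq_integral) (auto simp: prob_density_def)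

lemma prob_space_density: "prob_density f \<Longrightarrow> prob_space (density lborel f)"
  by (rule prob_spaceI) (simp add: emeasure_density nn_integral_prob_density, simp add: prob_density_def emeasure_density nn_integral_prob_density)

text \<open>Maximal coupling: the common part min(f, g) sits on the diagonal, and the two excess
  parts, of equal mass e, are coupled as a product divided by e. The off-diagonal mass is at most e,
  which is half the L1 distance.\<close>

lemma d_TV_density_le:
  fixes f g :: "'a::euclidean_space \<Rightarrow> real"
  assumes f: "prob_density f" and g: "prob_density g"
  shows "d_TV (density lborel f) (density lborel g) \<le> (LINT x|lborel. \<bar>f x - g x\<bar>)"
proof -
  have [measurable]: "f \<in> borel_measurable borel" "g \<in> borel_measurable borel" using f g by (auto simp: prob_density_def)
  define e where "e = (LINT x|lborel. max 0 (f x - g x))"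
  have int: "integrable lborel f" "integrable lborel g" using f g by (auto simp: prob_density_def)
  have imin: "integrable lborel (\<lambda>x. min (f x) (g x))"
    by (rule Bochner_Integration.integrable_bound[OF int(1)]) (use f g in \<open>auto simp: prob_density_def min_def\<close>)
  have ipos: "integrable lborel (\<lambda>x. max 0 (f x - g x))" "integrable lborel (\<lambda>x. max 0 (g x - f x))"
    using int by (auto intro: integrable_max)
  have e': "e = (LINT x|lborel. max 0 (g x - f x))"
  proof -
    have "e - (LINT x|lborel. max 0 (g x - f x)) = (LINT x|lborel. max 0 (f x - g x) - max 0 (g x - f x))"
      unfolding e_def using ipos by simp
    also have "\<dots> = (LINT x|lborel. f x - g x)" by (intro Bochner_Integration.integral_cong) auto
    also have "\<dots> = 0" using f g by (simp add: prob_density_def)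
    finally show ?thesis by simp
  qed
  have ele: "e \<le> (LINT x|lborel. \<bar>f x - g x\<bar>)"
    unfolding e_def using ipos int by (intro integral_mono) auto
  have e0: "0 \<le> e" unfolding e_def by (intro integral_nonneg_AE) auto
  define fp gp where "fp = density lborel (\<lambda>x. ennreal (max 0 (f x - g x)))" and "gp = density lborel (\<lambda>x. ennreal (max 0 (g x - f x)))"
  define mm where "mm = density lborel (\<lambda>x. ennreal (min (f x) (g x)))"
  have sb: "sets fp = sets borel" "sets gp = sets borel" "sets mm = sets borel" "space fp = UNIV" "space gp = UNIV" "space mm = UNIV"
    by (auto simp: fp_def gp_def mm_def)
  have tot: "emeasure fp UNIV = ennreal e" "emeasure gp UNIV = ennreal e"
  proof -
    have "emeasure fp UNIV = (\<integral>\<^sup>+x. ennreal (max 0 (f x - g x)) \<partial>lborel)"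
      "emeasure gp UNIV = (\<integral>\<^sup>+x. ennreal (max 0 (g x - f x)) \<partial>lborel)"
      unfolding fp_def gp_def by (subst emeasure_density; simp)+
    then show "emeasure fp UNIV = ennreal e" "emeasure gp UNIV = ennreal e"
      using nn_integral_eq_integral[OF ipos(1)] nn_integral_eq_integral[OF ipos(2)] by (simp_all add: e_def e'[unfolded e_def])
  qed
  show ?thesis
  \<comment> \<open>For e = 0 the product part cannot be normalised; then f = g almost everywhere,
    and the diagonal coupling does.\<close>
  proof (cases "e = 0")
    case True
    have z: "AE x in lborel. max 0 (f x - g x) = 0" "AE x in lborel. max 0 (g x - f x) = 0"
      using integral_nonneg_eq_0_iff_AE[OF ipos(1)] integral_nonneg_eq_0_iff_AE[OF ipos(2)] True e' e_def by auto
    have "AE x in lborel. f x = g x" using z by eventually_elim (auto simp: max_def split: if_splits)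
    then have eq: "density lborel (\<lambda>x. ennreal (f x)) = density lborel (\<lambda>x. ennreal (g x))"
      by (intro density_cong) auto
    have "distr (density lborel f) (borel \<Otimes>\<^sub>M borel) (\<lambda>x. (x, x)) \<in> couplings (density lborel f) (density lborel g)"
      unfolding eq[symmetric] couplings_def by (auto simp: distr_distr comp_def distr_id2)
    from d_TV_le_coupling[OF this] have "d_TV (density lborel f) (density lborel g) \<le>
       measure (distr (density lborel f) (borel \<Otimes>\<^sub>M borel) (\<lambda>x. (x, x))) {(x, y). x \<noteq> y}" .
    also have "\<dots> = 0" using neq_sets by (subst measure_distr) auto
    finally show ?thesis using ele e0 by linarith
  next
    case False
    then have ep: "0 < e" using e0 by simp
    interpret fp: finite_measure fp by standard (simp add: sb tot)
    interpret gp: finite_measure gp by standard (simp add: sb tot)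
    interpret pr: pair_sigma_finite fp gp ..
    define D where "D = distr mm (borel \<Otimes>\<^sub>M borel) (\<lambda>x. (x, x))"
    define P where "P = fp \<Otimes>\<^sub>M gp"
    have sP: "sets P = sets (borel \<Otimes>\<^sub>M borel)" unfolding P_def by (intro sets_pair_measure_cong sb)
    define \<mu> where "\<mu> A = emeasure D A + ennreal (1 / e) * emeasure P A" for A
    define \<pi> where "\<pi> = measure_of UNIV (sets (borel \<Otimes>\<^sub>M (borel :: 'a measure))) \<mu>"
    have s\<pi>: "sets \<pi> = sets (borel \<Otimes>\<^sub>M borel)"
      unfolding \<pi>_def by (subst sets_measure_of) (auto simp: sets.sigma_sets_eq[of "borel \<Otimes>\<^sub>M borel", unfolded space_pair_measure, simplified])
    have em: "emeasure \<pi> A = emeasure D A + ennreal (1 / e) * emeasure P A" if A: "A \<in> sets (borel \<Otimes>\<^sub>M borel)" for A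
    proof -
      have "emeasure \<pi> A = \<mu> A"
      proof (rule emeasure_measure_of[OF \<pi>_def])
        show "A \<in> sets \<pi>" using A s\<pi> by simp
        show "positive (sets \<pi>) \<mu>" by (simp add: positive_def \<mu>_def)
        show "countably_additive (sets \<pi>) \<mu>"
        proof (rule countably_additiveI)
          fix F :: "nat \<Rightarrow> ('a \<times> 'a) set" assume F: "range F \<subseteq> sets \<pi>" "disjoint_family F" "\<Union> (range F) \<in> sets \<pi>"
          have "(\<Sum>i. emeasure D (F i) + ennreal (1 / e) * emeasure P (F i)) = (\<Sum>i. emeasure D (F i)) + ennreal (1 / e) * (\<Sum>i. emeasure P (F i))"
            by (subst suminf_add[symmetric]) (auto simp: ennreal_suminf_cmult)
          also have "(\<Sum>i. emeasure D (F i)) = emeasure D (\<Union> (range F))"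
            using F s\<pi> by (intro suminf_emeasure) (auto simp: D_def)
          also have "(\<Sum>i. emeasure P (F i)) = emeasure P (\<Union> (range F))"
            using F s\<pi> sP by (intro suminf_emeasure) auto
          finally show "(\<Sum>i. \<mu> (F i)) = \<mu> (\<Union> (range F))" by (simp add: \<mu>_def)
        qed
      qed auto
      then show ?thesis by (simp add: \<mu>_def)
    qed
    have dd: "emeasure (density lborel (\<lambda>x. ennreal (a x))) A + emeasure (density lborel (\<lambda>x. ennreal (b x))) A = emeasure (density lborel (\<lambda>x. ennreal (c x))) A"
      if [measurable]: "A \<in> sets borel" "a \<in> borel_measurable borel" "b \<in> borel_measurable borel" "c \<in> borel_measurable borel"
        and "\<And>x. 0 \<le> a x" "\<And>x. 0 \<le> b x" "\<And>x. c x = a x + b x" for a b c :: "'a \<Rightarrow> real" and A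
    proof -
      have "emeasure (density lborel (\<lambda>x. ennreal (c x))) A = (\<integral>\<^sup>+x. ennreal (a x) * indicator A x + ennreal (b x) * indicator A x \<partial>lborel)"
        using that(5,6) by (subst emeasure_density) (auto simp: that(7) ennreal_plus distrib_right intro!: nn_integral_cong)
      also have "\<dots> = (\<integral>\<^sup>+x. ennreal (a x) * indicator A x \<partial>lborel) + (\<integral>\<^sup>+x. ennreal (b x) * indicator A x \<partial>lborel)"
        by (rule nn_integral_add) auto
      finally show ?thesis by (simp add: emeasure_density)
    qed
    have m\<pi>: "fst \<in> measurable \<pi> borel" "snd \<in> measurable \<pi> borel"
      by (simp_all add: measurable_cong_sets[OF s\<pi> refl])
    have sp\<pi>: "space \<pi> = UNIV" using sets_eq_imp_space_eq[OF s\<pi>] by (simp add: space_pair_measure)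
    have emD: "emeasure D B = emeasure mm {x. (x, x) \<in> B}" if [measurable]: "B \<in> sets (borel \<Otimes>\<^sub>M borel)" for B
    proof -
      have "(\<lambda>x. (x, x)) \<in> measurable mm (borel \<Otimes>\<^sub>M borel)" unfolding measurable_cong_sets[OF sb(3) refl] by measurable
      then show ?thesis unfolding D_def using that by (subst emeasure_distr) (auto simp: sb vimage_def)
    qed
    have nn: "0 \<le> f x" "0 \<le> g x" for x using f g by (auto simp: prob_density_def)
    have rect: "emeasure \<pi> (A \<times> B) = emeasure mm (A \<inter> B) + ennreal (1 / e) * (emeasure fp A * emeasure gp B)"
      if [measurable]: "A \<in> sets borel" "B \<in> sets borel" for A B
    proof -
      have "emeasure D (A \<times> B) = emeasure mm (A \<inter> B)" by (subst emD) (auto simp: Int_def)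
      moreover have "emeasure P (A \<times> B) = emeasure fp A * emeasure gp B"
        unfolding P_def by (rule gp.emeasure_pair_measure_Times) (auto simp: sb)
      ultimately show ?thesis by (subst em) auto
    qed
    have "\<pi> \<in> couplings (density lborel f) (density lborel g)"
      unfolding couplings_def
    proof (intro CollectI conjI s\<pi> measure_eqI)
      fix A assume "A \<in> sets (distr \<pi> borel fst)"
      then have A[measurable]: "A \<in> sets borel" by simp
      have "emeasure (distr \<pi> borel fst) A = emeasure \<pi> (A \<times> UNIV)"
        using m\<pi> by (subst emeasure_distr) (auto simp: sp\<pi> intro!: arg_cong[where f="emeasure \<pi>"])
      also have "\<dots> = emeasure mm A + ennreal (1 / e) * (emeasure fp A * emeasure gp UNIV)"
        by (subst rect) auto
      \<comment> \<open>The mass e of the other excess part cancels 1/e, which leaves min(f, g) +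
        max(0, f - g) = f as density of the first marginal.\<close>
      also have "ennreal (1 / e) * (emeasure fp A * emeasure gp UNIV) = ennreal (1 / e) * ennreal e * emeasure fp A"
        by (simp add: tot ac_simps)
      also have "ennreal (1 / e) * ennreal e = 1" using ep by (simp flip: ennreal_mult)
      also have "emeasure mm A + 1 * emeasure fp A = emeasure (density lborel f) A"
        unfolding mm_def fp_def mult_1 using nn by (intro dd) (auto simp: min_def max_def)
      finally show "emeasure (distr \<pi> borel fst) A = emeasure (density lborel f) A" .
    next
      fix A assume "A \<in> sets (distr \<pi> borel snd)"
      then have A[measurable]: "A \<in> sets borel" by simp
      have "emeasure (distr \<pi> borel snd) A = emeasure \<pi> (UNIV \<times> A)"
        using m\<pi> by (subst emeasure_distr) (auto simp: sp\<pi> intro!: arg_cong[where f="emeasure \<pi>"])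
      also have "\<dots> = emeasure mm A + ennreal (1 / e) * (emeasure fp UNIV * emeasure gp A)"
        by (subst rect) auto
      also have "ennreal (1 / e) * (emeasure fp UNIV * emeasure gp A) = ennreal (1 / e) * ennreal e * emeasure gp A"
        by (simp add: tot ac_simps)
      also have "ennreal (1 / e) * ennreal e = 1" using ep by (simp flip: ennreal_mult)
      also have "emeasure mm A + 1 * emeasure gp A = emeasure (density lborel g) A"
        unfolding mm_def gp_def mult_1 using nn by (intro dd) (auto simp: min_def max_def)
      finally show "emeasure (distr \<pi> borel snd) A = emeasure (density lborel g) A" .
    qed (auto simp: s\<pi>)
    from d_TV_le_coupling[OF this] have "d_TV (density lborel f) (density lborel g) \<le> measure \<pi> {(x, y). x \<noteq> y}" .
    also have "\<dots> \<le> e"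
    proof -
      have "emeasure D {(x, y). x \<noteq> y} = 0"
        using neq_sets by (subst emD) auto
      moreover have "emeasure P {(x, y). x \<noteq> y} \<le> emeasure P (UNIV \<times> UNIV)"
      proof (rule emeasure_mono)
        show "UNIV \<times> UNIV \<in> sets P" unfolding sP by (intro pair_measureI) simp_all
      qed blast
      moreover have "emeasure P (UNIV \<times> UNIV) = ennreal e * ennreal e"
        unfolding P_def by (subst gp.emeasure_pair_measure_Times) (auto simp: sb tot)
      ultimately have "emeasure \<pi> {(x, y). x \<noteq> y} \<le> ennreal (1 / e) * (ennreal e * ennreal e)"
        unfolding em[OF neq_sets] by (simp only: add_0_left) (metis mult_left_mono zero_le)
      also have "\<dots> = ennreal e" using ep by (simp flip: ennreal_mult)
      finally show ?thesis unfolding measure_def using e0 by (intro enn2real_leI)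
    qed
    finally show ?thesis using ele by linarith
  qed
qed

text \<open>The sign of f - g is an admissible test function and attains the L1 norm; bounds on
  expectations thereby become bounds on densities.\<close>

lemma L1_dist_le_dual:
  fixes f g :: "'a::euclidean_space \<Rightarrow> real"
  assumes f: "prob_density f" and g: "prob_density g"
    and dual: "\<And>h. h \<in> borel_measurable borel \<Longrightarrow> (\<And>x. \<bar>h x\<bar> \<le> 1) \<Longrightarrow>
       \<bar>(LINT x|density lborel f. h x) - (LINT x|density lborel g. h x)\<bar> \<le> c"
  shows "(LINT x|lborel. \<bar>f x - g x\<bar>) \<le> c"
proof -
  have [measurable]: "f \<in> borel_measurable borel" "g \<in> borel_measurable borel" using f g by (auto simp: prob_density_def)
  have int: "integrable lborel f" "integrable lborel g" and nn: "\<And>x. 0 \<le> f x" "\<And>x. 0 \<le> g x"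
    using f g by (auto simp: prob_density_def)
  define h where "h x = (if g x \<le> f x then 1 else -1 :: real)" for x
  have [measurable]: "h \<in> borel_measurable borel" unfolding h_def by measurable
  have i: "integrable lborel (\<lambda>x. f x * h x)" "integrable lborel (\<lambda>x. g x * h x)"
    by (rule Bochner_Integration.integrable_bound[OF int(1)], auto simp: h_def)
       (rule Bochner_Integration.integrable_bound[OF int(2)], auto simp: h_def)
  have "(LINT x|lborel. \<bar>f x - g x\<bar>) = (LINT x|lborel. f x * h x - g x * h x)"
    by (intro Bochner_Integration.integral_cong) (auto simp: h_def)
  also have "\<dots> = (LINT x|density lborel f. h x) - (LINT x|density lborel g. h x)"
    using i nn by (simp add: integral_density)
  also have "\<dots> \<le> c" using dual[of h] by (force simp: h_def)
  finally show ?thesis .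
qed

text \<open>Completeness of L1 with an explicit remainder: the increments form an absolutely
  convergent series for almost every x, and the tail of the series bounds the distance to the
  limit.\<close>

lemma prob_density_L1_limit:
  fixes f :: "nat \<Rightarrow> 'a::euclidean_space \<Rightarrow> real"
  assumes f: "\<And>j. prob_density (f j)" and c: "\<And>j. (LINT x|lborel. \<bar>f (Suc j) x - f j x\<bar>) \<le> c j" "summable c"
  shows "\<exists>h. prob_density h \<and> (\<forall>j. (LINT x|lborel. \<bar>h x - f j x\<bar>) \<le> (\<Sum>i. c (i + j)))"
proof -
  have [measurable]: "f j \<in> borel_measurable borel" for j using f by (auto simp: prob_density_def)
  have int: "integrable lborel (f j)" for j using f by (auto simp: prob_density_def)
  define d where "d j x = f (Suc j) x - f j x" for j x
  have di: "integrable lborel (d j)" for j using int unfolding d_def by auto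
  have c0: "0 \<le> c j" for j using order_trans[OF _ c(1), of 0 j] by (auto intro: integral_nonneg_AE)
  have sN: "summable (\<lambda>j. LINT x|lborel. norm (d j x))"
    by (rule summable_comparison_test'[OF c(2), of 0]) (use c(1) in \<open>simp add: d_def\<close>)
  have AEs: "AE x in lborel. summable (\<lambda>j. norm (d j x))"
  proof -
    have "(\<integral>\<^sup>+x. (\<Sum>j. ennreal (norm (d j x))) \<partial>lborel) = (\<Sum>j. \<integral>\<^sup>+x. ennreal (norm (d j x)) \<partial>lborel)"
      by (rule nn_integral_suminf) (simp add: d_def)
    also have "\<dots> = (\<Sum>j. ennreal (LINT x|lborel. norm (d j x)))"
      by (intro suminf_cong nn_integral_eq_integral integrable_norm di) auto
    also have "\<dots> \<noteq> \<infinity>" unfolding infinity_ennreal_def by (rule ennreal_suminf_neq_top[OF sN]) auto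
    finally have "AE x in lborel. (\<Sum>j. ennreal (norm (d j x))) \<noteq> \<infinity>"
      by (rule nn_integral_PInf_AE[rotated]) (simp add: d_def)
    then show ?thesis by eventually_elim (auto intro!: summable_suminf_not_top)
  qed
  have tel: "(\<Sum>j<n. d j x) = f n x - f 0 x" for n x
    unfolding d_def using sum_lessThan_telescope[of "\<lambda>j. f j x" n] by simp
  define h0 where "h0 x = f 0 x + (\<Sum>j. d j x)" for x
  have ih0: "integrable lborel h0"
    unfolding h0_def[abs_def] by (rule Bochner_Integration.integrable_add[OF int integrable_suminf[OF di AEs sN]])
  have lim: "AE x in lborel. (\<lambda>n. f n x) \<longlonglongrightarrow> h0 x"
    using AEs
  proof eventually_elim
    fix x assume "summable (\<lambda>j. norm (d j x))"
    then have "(\<lambda>n. \<Sum>j<n. d j x) \<longlonglongrightarrow> (\<Sum>j. d j x)" by (rule summable_LIMSEQ[OF summable_norm_cancel])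
    from tendsto_add[OF tendsto_const[of "f 0 x"] this] show "(\<lambda>n. f n x) \<longlonglongrightarrow> h0 x" by (simp add: tel h0_def)
  qed
  \<comment> \<open>The limit is nonnegative only almost everywhere, while
    \<open>prob_density\<close> asks for it at every point.\<close>
  define h where "h x = max 0 (h0 x)" for x
  have hh: "AE x in lborel. h x = h0 x"
    using lim
  proof eventually_elim
    fix x assume "(\<lambda>n. f n x) \<longlonglongrightarrow> h0 x"
    then have "0 \<le> h0 x" by (rule LIMSEQ_le_const) (use f in \<open>auto simp: prob_density_def\<close>)
    then show "h x = h0 x" by (simp add: h_def)
  qed
  have [measurable]: "h0 \<in> borel_measurable borel" using ih0 by auto
  have hm[measurable]: "h \<in> borel_measurable borel" unfolding h_def by measurable
  have ih: "integrable lborel h" unfolding h_def using ih0 by auto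
  have dist: "(LINT x|lborel. \<bar>h x - f j x\<bar>) \<le> (\<Sum>i. c (i + j))" for j
  proof -
    have sNj: "summable (\<lambda>i. LINT x|lborel. norm (d (i + j) x))" using sN summable_ignore_initial_segment by blast
    have AEj: "AE x in lborel. summable (\<lambda>i. norm (d (i + j) x))" using AEs by eventually_elim (rule summable_ignore_initial_segment)
    have "(LINT x|lborel. \<bar>h x - f j x\<bar>) \<le> (LINT x|lborel. (\<Sum>i. norm (d (i + j) x)))"
    proof (rule integral_mono_AE)
      show "integrable lborel (\<lambda>x. \<bar>h x - f j x\<bar>)" using ih int by auto
      show "integrable lborel (\<lambda>x. \<Sum>i. norm (d (i + j) x))"
        using AEj sNj di by (intro integrable_suminf) auto
      show "AE x in lborel. \<bar>h x - f j x\<bar> \<le> (\<Sum>i. norm (d (i + j) x))"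
        using hh AEs AEj
      proof eventually_elim
        case (elim x)
        have "(\<Sum>i. d i x) = (\<Sum>i. d (i + j) x) + (\<Sum>i<j. d i x)"
          by (rule suminf_split_initial_segment) (rule summable_norm_cancel[OF elim(2)])
        then have "h x - f j x = (\<Sum>i. d (i + j) x)" by (simp add: elim(1) h0_def tel)
        then show ?case using summable_norm[OF elim(3)] by simp
      qed
    qed
    also have "\<dots> = (\<Sum>i. LINT x|lborel. norm (d (i + j) x))"
      using AEj sNj di by (intro integral_suminf) auto
    also have "\<dots> \<le> (\<Sum>i. c (i + j))"
      using sNj summable_ignore_initial_segment[OF c(2)] c(1) by (intro suminf_le) (auto simp: d_def)
    finally show ?thesis .
  qed
  have "(LINT x|lborel. h x) = 1"
  proof -
    have "\<bar>(LINT x|lborel. h x) - 1\<bar> \<le> (\<Sum>i. c (i + j))" for j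
    proof -
      have "(LINT x|lborel. h x) - 1 = (LINT x|lborel. h x - f j x)" using ih f by (simp add: prob_density_def)
      also have "\<bar>\<dots>\<bar> \<le> (LINT x|lborel. \<bar>h x - f j x\<bar>)" by (rule integral_abs_bound)
      finally show ?thesis using dist[of j] by linarith
    qed
    moreover have "(\<lambda>j. \<Sum>i. c (i + j)) \<longlonglongrightarrow> 0" by (rule suminf_exist_split2[OF c(2)])
    ultimately have "\<bar>(LINT x|lborel. h x) - 1\<bar> \<le> 0" by (intro LIMSEQ_le_const) blast+
    then show ?thesis by simp
  qed
  then have "prob_density h" using hm ih by (simp add: prob_density_def h_def)
  then show ?thesis using dist by blast
qed

section \<open>Characteristic functions in Euclidean spaces\<close>

lemma (in finite_measure) integrable_bounded:
  fixes f :: "_ \<Rightarrow> real"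
  assumes "f \<in> borel_measurable M" "\<And>x. \<bar>f x\<bar> \<le> B" shows "integrable M f"
  using assms by (intro integrable_const_bound[where B=B]) auto

lemma iexp_integral:
  assumes "finite_measure M" "f \<in> borel_measurable M"
  shows "(CLINT x|M. iexp (f x)) = Complex (LINT x|M. cos (f x)) (LINT x|M. sin (f x))"
proof -
  interpret finite_measure M by fact
  have i: "integrable M (\<lambda>x. iexp (f x))" using assms by (intro integrable_const_bound[where B=1]) auto
  show ?thesis
    using integral_Re[OF i] integral_Im[OF i] by (simp add: complex_eq_iff exp_Euler cos_of_real sin_of_real del: of_real_mult flip: of_real_mult)
qed

text \<open>Division by the total mass, read off from the cosine at t = 0, reduces to Levy's
  uniqueness theorem for probability measures on the line; the null measure is treated
  separately.\<close>

lemma Levy_uniqueness_finite_measure: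
  fixes M1 M2 :: "real measure"
  assumes f: "finite_measure M1" "finite_measure M2" and s: "sets M1 = sets borel" "sets M2 = sets borel"
    and c: "\<And>t. (LINT x|M1. cos (t * x)) = (LINT x|M2. cos (t * x))"
           "\<And>t. (LINT x|M1. sin (t * x)) = (LINT x|M2. sin (t * x))"
  shows "M1 = M2"
proof -
  interpret a: finite_measure M1 by fact
  interpret b: finite_measure M2 by fact
  have sp: "space M1 = UNIV" "space M2 = UNIV" using s[THEN sets_eq_imp_space_eq] by auto
  define m where "m = measure M1 UNIV"
  have m2: "measure M2 UNIV = m" using c(1)[of 0] by (simp add: m_def sp)
  have em: "emeasure M1 UNIV = ennreal m" "emeasure M2 UNIV = ennreal m"
    using m2 by (auto simp: m_def a.emeasure_eq_measure b.emeasure_eq_measure)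
  show ?thesis
  proof (cases "m = 0")
    case True
    show ?thesis
    proof (rule measure_eqI)
      fix A assume "A \<in> sets M1"
      then have "emeasure M1 A \<le> emeasure M1 UNIV" "emeasure M2 A \<le> emeasure M2 UNIV"
        using s sp sets.top[of M1] sets.top[of M2] by (auto intro!: emeasure_mono)
      then show "emeasure M1 A = emeasure M2 A" by (simp add: em True)
    qed (simp add: s)
  next
    case False
    then have m: "0 < m" by (simp add: m_def less_le)
    define N where "N M = density M (\<lambda>_. ennreal (1 / m))" for M :: "real measure"
    have rd: "real_distribution (N M)" if "sets M = sets borel" "space M = UNIV" "emeasure M UNIV = ennreal m" for M
    proof -
      have "emeasure (N M) UNIV = ennreal (1 / m) * ennreal m"
        unfolding N_def using that sets.top[of M] by (subst emeasure_density) (auto simp: nn_integral_cmult_indicator)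
      also have "\<dots> = 1" using m by (simp flip: ennreal_mult)
      finally interpret prob_space "N M" by (intro prob_spaceI) (simp add: N_def that)
      show ?thesis by standard (simp add: N_def that)
    qed
    have ch: "char (N M) t = complex_of_real (1 / m) * Complex (LINT x|M. cos (t * x)) (LINT x|M. sin (t * x))"
      if "finite_measure M" "sets M = sets borel" for M t
    proof -
      have [measurable]: "(\<lambda>x. t * x) \<in> borel_measurable M" "(\<lambda>x. iexp (t * x)) \<in> borel_measurable M"
        unfolding measurable_cong_sets[OF that(2) refl] by measurable
      have "char (N M) t = (CLINT x|M. (1 / m) *\<^sub>R iexp (t * x))"
        unfolding char_def N_def using m by (subst integral_density) (auto simp del: of_real_mult)
      also have "\<dots> = complex_of_real (1 / m) * (CLINT x|M. iexp (t * x))"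
        by (simp add: scaleR_conv_of_real)
      finally show ?thesis using iexp_integral[OF that(1), of "\<lambda>x. t * x"] by simp
    qed
    have "N M1 = N M2"
      by (intro Levy_uniqueness rd em s sp) (auto simp: fun_eq_iff ch f s c)
    show ?thesis
    proof (rule measure_eqI)
      fix A assume A: "A \<in> sets M1"
      have "emeasure (N M1) A = emeasure (N M2) A" using \<open>N M1 = N M2\<close> by simp
      then have "ennreal (1 / m) * emeasure M1 A = ennreal (1 / m) * emeasure M2 A"
        unfolding N_def using A s by (simp add: emeasure_density nn_integral_cmult_indicator)
      then have "ennreal m * ennreal (1 / m) * emeasure M1 A = ennreal m * ennreal (1 / m) * emeasure M2 A"
        by (simp add: mult.assoc)
      moreover have "ennreal m * ennreal (1 / m) = 1" using m by (simp flip: ennreal_mult)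
      ultimately show "emeasure M1 A = emeasure M2 A" by simp
    qed (simp add: s)
  qed
qed

text \<open>The projection to direction b of the measure with density w is a finite measure on the
  line, hence determined by its Fourier transform. The bound 2 anticipates weights of the form
  indicator times 1 + cos.\<close>

lemma weighted_projection_unique:
  fixes P Q :: "'a::euclidean_space measure"
  assumes pr: "prob_space P" "prob_space Q" and s: "sets P = sets borel" "sets Q = sets borel"
    and w: "w \<in> borel_measurable borel" "\<And>y. 0 \<le> w y" "\<And>y. w y \<le> 2"
    and c: "\<And>t. (LINT y|P. w y * cos (t * (y \<bullet> b))) = (LINT y|Q. w y * cos (t * (y \<bullet> b)))"
           "\<And>t. (LINT y|P. w y * sin (t * (y \<bullet> b))) = (LINT y|Q. w y * sin (t * (y \<bullet> b)))"
    and B: "B \<in> sets borel"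
  shows "(LINT y|P. w y * indicator B (y \<bullet> b)) = (LINT y|Q. w y * indicator B (y \<bullet> b))"
proof -
  define N where "N M = distr (density M (\<lambda>y. ennreal (w y))) borel (\<lambda>y. y \<bullet> b)" for M
  have i: "(LINT x|N M. f x) = (LINT y|M. w y * f (y \<bullet> b))"
    if "sets M = sets borel" and [measurable]: "f \<in> borel_measurable borel" for M and f :: "real \<Rightarrow> real"
  proof -
    have [measurable]: "w \<in> borel_measurable M" "(\<lambda>y. y \<bullet> b) \<in> borel_measurable M"
      using w by (simp_all add: measurable_cong_sets[OF that(1) refl])
    show ?thesis unfolding N_def using w by (simp add: integral_distr integral_density)
  qed
  have fin: "finite_measure (N M)" if "sets M = sets borel" "prob_space M" for M
  proof -
    interpret prob_space M by fact
    have [measurable]: "w \<in> borel_measurable M" "(\<lambda>y. y \<bullet> b) \<in> borel_measurable M"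
      using w by (simp_all add: measurable_cong_sets[OF that(1) refl])
    have "emeasure (N M) (space (N M)) = (\<integral>\<^sup>+y. ennreal (w y) \<partial>M)"
      unfolding N_def by (simp add: emeasure_distr emeasure_density cong: nn_integral_cong)
    also have "\<dots> \<le> (\<integral>\<^sup>+y. ennreal 2 \<partial>M)" using w by (intro nn_integral_mono ennreal_leI)
    also have "\<dots> < \<infinity>" by (simp add: emeasure_space_1)
    finally show ?thesis by (intro finite_measureI) auto
  qed
  have "N P = N Q"
    by (rule Levy_uniqueness_finite_measure[OF fin fin])
       (use pr s c in \<open>auto simp: i N_def[THEN arg_cong[where f=sets]]\<close>)
  then have "(LINT x|N P. indicator B x :: real) = (LINT x|N Q. indicator B x)" by simp
  then show ?thesis unfolding i[OF s(1) borel_measurable_indicator[OF B]] i[OF s(2) borel_measurable_indicator[OF B]] .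
qed

text \<open>Coordinate by coordinate, Fourier information in direction b is traded for the indicator
  of y \<bullet> b \<in> B b, while \<open>main\<close> carries arbitrary frequencies l along. With
  all basis directions used and l = 0, boxes remain, and these generate the Borel sets.\<close>

lemma char_unique_euclidean:
  fixes P Q :: "'a::euclidean_space measure"
  assumes pr: "prob_space P" "prob_space Q" and s: "sets P = sets borel" "sets Q = sets borel"
    and c: "\<And>l. (LINT y|P. cos (l \<bullet> y)) = (LINT y|Q. cos (l \<bullet> y))"
           "\<And>l. (LINT y|P. sin (l \<bullet> y)) = (LINT y|Q. sin (l \<bullet> y))"
  shows "P = Q"
proof -
  interpret P: prob_space P by fact
  interpret Q: prob_space Q by fact
  have mP: "f \<in> borel_measurable P" "f \<in> borel_measurable Q" if "f \<in> borel_measurable borel" for f :: "'a \<Rightarrow> real"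
    using that by (simp_all add: measurable_cong_sets[OF s(1) refl] measurable_cong_sets[OF s(2) refl])
  define I where "I S B y = (\<Prod>b\<in>S. indicator (B b) (y \<bullet> b) :: real)" for S :: "'a set" and B :: "'a \<Rightarrow> real set" and y
  have I01: "0 \<le> I S B y \<and> I S B y \<le> 1" for S B y
    unfolding I_def by (auto intro!: prod_nonneg prod_le_1 simp: indicator_def)
  have Im: "I S B \<in> borel_measurable borel" if "\<And>b. B b \<in> sets borel" for S B
    unfolding I_def[abs_def] using that by measurable
  have int: "integrable P f" "integrable Q f" if "f \<in> borel_measurable borel" "\<And>y. \<bar>f y\<bar> \<le> 2" for f :: "'a \<Rightarrow> real"
    using mP[OF that(1)] that(2) P.integrable_bounded Q.integrable_bounded by blast+
  have main: "\<forall>l. (LINT y|P. I S B y * cos (l \<bullet> y)) = (LINT y|Q. I S B y * cos (l \<bullet> y)) \<and>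
                  (LINT y|P. I S B y * sin (l \<bullet> y)) = (LINT y|Q. I S B y * sin (l \<bullet> y))"
    if "finite S" and B: "\<And>b. B b \<in> sets borel" for S B
    using \<open>finite S\<close>
  proof induction
    case empty then show ?case using c by (simp add: I_def)
  next
    case (insert b S)
    note [measurable] = Im[OF B, of S] B[of b]
    have abs1: "\<bar>I S B y * z\<bar> \<le> 1" if "\<bar>z\<bar> \<le> 1" for y z
      using I01[of S B y] that mult_mono[of "I S B y" 1 "\<bar>z\<bar>" 1] by (simp add: abs_mult)
    have ic: "integrable M (\<lambda>y. I S B y * cos (l \<bullet> y))" "integrable M (\<lambda>y. I S B y * sin (l \<bullet> y))" if "M = P \<or> M = Q" for M l
      using that abs1 by (auto intro!: int order_trans[OF abs1])
    \<comment> \<open>Products of trigonometric functions become sums at the frequencies l + t b and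
      l - t b, to which the induction hypothesis applies.\<close>
    have prod: "(LINT y|P. (I S B y * f (l \<bullet> y)) * g (t * (y \<bullet> b))) = (LINT y|Q. (I S B y * f (l \<bullet> y)) * g (t * (y \<bullet> b)))"
      if "f = cos \<or> f = sin" "g = cos \<or> g = sin" for f g :: "real \<Rightarrow> real" and l t
    proof -
      have sh: "l \<bullet> y + t * (y \<bullet> b) = (l + t *\<^sub>R b) \<bullet> y" "l \<bullet> y - t * (y \<bullet> b) = (l - t *\<^sub>R b) \<bullet> y" for y
        by (simp_all add: inner_add_left inner_diff_left inner_commute[of b])
      have IH: "(LINT y|P. I S B y * cos (l \<bullet> y)) = (LINT y|Q. I S B y * cos (l \<bullet> y))"
               "(LINT y|P. I S B y * sin (l \<bullet> y)) = (LINT y|Q. I S B y * sin (l \<bullet> y))" for l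
        using insert.IH by auto
      have id: "I S B y * cos (l \<bullet> y) * cos (t * (y \<bullet> b)) = (I S B y * cos ((l - t *\<^sub>R b) \<bullet> y) + I S B y * cos ((l + t *\<^sub>R b) \<bullet> y)) / 2"
         "I S B y * sin (l \<bullet> y) * sin (t * (y \<bullet> b)) = (I S B y * cos ((l - t *\<^sub>R b) \<bullet> y) - I S B y * cos ((l + t *\<^sub>R b) \<bullet> y)) / 2"
         "I S B y * sin (l \<bullet> y) * cos (t * (y \<bullet> b)) = (I S B y * sin ((l + t *\<^sub>R b) \<bullet> y) + I S B y * sin ((l - t *\<^sub>R b) \<bullet> y)) / 2"
         "I S B y * cos (l \<bullet> y) * sin (t * (y \<bullet> b)) = (I S B y * sin ((l + t *\<^sub>R b) \<bullet> y) - I S B y * sin ((l - t *\<^sub>R b) \<bullet> y)) / 2" for y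
        unfolding sh[symmetric] by (simp_all add: cos_add cos_diff sin_add sin_diff field_simps)
      show ?thesis
        using that by (elim disjE) (simp_all add: id ic IH)
    qed
    \<comment> \<open>A weight of a measure has to be nonnegative, so cos and sin are raised by
      1.\<close>
    have key: "(LINT y|P. I S B y * (1 + f (l \<bullet> y)) * indicator (B b) (y \<bullet> b)) = (LINT y|Q. I S B y * (1 + f (l \<bullet> y)) * indicator (B b) (y \<bullet> b))"
      if f: "f = cos \<or> f = sin" for f :: "real \<Rightarrow> real" and l
    proof (rule weighted_projection_unique[OF pr s])
      have f1: "\<bar>f x\<bar> \<le> 1" for x using f by auto
      have [measurable]: "f \<in> borel_measurable borel" using f by auto
      show "(\<lambda>y. I S B y * (1 + f (l \<bullet> y))) \<in> borel_measurable borel" by measurable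
      fix y
      have "- 1 \<le> f (l \<bullet> y)" "f (l \<bullet> y) \<le> 1" using f1[of "l \<bullet> y"] by auto
      then show "0 \<le> I S B y * (1 + f (l \<bullet> y))" "I S B y * (1 + f (l \<bullet> y)) \<le> 2"
        using I01[of S B y] mult_mono[of "I S B y" 1 "1 + f (l \<bullet> y)" 2] by auto
    next
      fix t
      have bd: "integrable M (\<lambda>y. I S B y * f (l \<bullet> y) * g (t * (y \<bullet> b)))" "integrable M (\<lambda>y. I S B y * cos (0 \<bullet> y) * g (t * (y \<bullet> b)))"
        if "M = P \<or> M = Q" "g = cos \<or> g = sin" for M and g :: "real \<Rightarrow> real"
      proof -
        have [measurable]: "g \<in> borel_measurable borel" "f \<in> borel_measurable borel" using that f by auto
        have g1: "\<bar>g x\<bar> \<le> 1" "\<bar>f x\<bar> \<le> 1" for x using f that by auto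
        have "\<bar>f x * g y\<bar> \<le> 1" "\<bar>g y\<bar> \<le> 1" for x y using mult_mono[OF g1(2)[of x] g1(1)[of y]] g1 by (auto simp: abs_mult)
        then show "integrable M (\<lambda>y. I S B y * f (l \<bullet> y) * g (t * (y \<bullet> b)))" "integrable M (\<lambda>y. I S B y * cos (0 \<bullet> y) * g (t * (y \<bullet> b)))"
          using that(1) by (auto intro!: int order_trans[OF abs1] simp: mult.assoc)
      qed
      have eq: "I S B y * (1 + f (l \<bullet> y)) * g = I S B y * cos (0 \<bullet> y) * g + I S B y * f (l \<bullet> y) * g" for y g
        by (simp add: algebra_simps)
      show "(LINT y|P. I S B y * (1 + f (l \<bullet> y)) * cos (t * (y \<bullet> b))) = (LINT y|Q. I S B y * (1 + f (l \<bullet> y)) * cos (t * (y \<bullet> b)))"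
        unfolding eq using bd[of P cos] bd[of Q cos] prod[of f cos l t] prod[of cos cos 0 t] f by simp
      show "(LINT y|P. I S B y * (1 + f (l \<bullet> y)) * sin (t * (y \<bullet> b))) = (LINT y|Q. I S B y * (1 + f (l \<bullet> y)) * sin (t * (y \<bullet> b)))"
        unfolding eq using bd[of P sin] bd[of Q sin] prod[of f sin l t] prod[of cos sin 0 t] f by simp
    qed (rule B)
    have I_ins: "I (insert b S) B y = I S B y * indicator (B b) (y \<bullet> b)" for y
      using insert.hyps by (simp add: I_def)
    note [measurable] = Im[OF B, of "insert b S"]
    have abs2: "\<bar>I (insert b S) B y * z\<bar> \<le> 1" if "\<bar>z\<bar> \<le> 1" for y z
      using I01[of "insert b S" B y] that mult_mono[of "I (insert b S) B y" 1 "\<bar>z\<bar>" 1] by (simp add: abs_mult)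
    have i1: "integrable M (\<lambda>y. I (insert b S) B y * f (l \<bullet> y))" "integrable M (I (insert b S) B)"
      if "M = P \<or> M = Q" "f = cos \<or> f = sin" for M l and f :: "real \<Rightarrow> real"
    proof -
      have [measurable]: "f \<in> borel_measurable borel" using that by auto
      have "\<bar>f x\<bar> \<le> 1" for x using that by auto
      then show "integrable M (\<lambda>y. I (insert b S) B y * f (l \<bullet> y))" using that by (auto intro!: int order_trans[OF abs2])
      have "\<bar>I (insert b S) B y\<bar> \<le> 2" for y using I01[of "insert b S" B y] by linarith
      then show "integrable M (I (insert b S) B)" using that by (auto intro!: int)
    qed
    \<comment> \<open>Frequency 0 gives weight 2 and thus the indicator alone; subtracting it later
      undoes the shift by 1.\<close>
    have base: "(LINT y|P. I (insert b S) B y) = (LINT y|Q. I (insert b S) B y)"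
      using key[of cos 0] by (simp add: I_ins mult_ac)
    have fin: "(LINT y|P. I (insert b S) B y * f (l \<bullet> y)) = (LINT y|Q. I (insert b S) B y * f (l \<bullet> y))"
      if f: "f = cos \<or> f = sin" for f :: "real \<Rightarrow> real" and l
    proof -
      have eq: "I S B y * (1 + f (l \<bullet> y)) * indicator (B b) (y \<bullet> b) = I (insert b S) B y + I (insert b S) B y * f (l \<bullet> y)" for y
        by (simp add: I_ins algebra_simps)
      have "(LINT y|P. I (insert b S) B y + I (insert b S) B y * f (l \<bullet> y)) = (LINT y|Q. I (insert b S) B y + I (insert b S) B y * f (l \<bullet> y))"
        using key[OF f, of l] by (simp only: eq)
      then show ?thesis using i1(1)[of P f l] i1(1)[of Q f l] i1(2)[of P f] i1(2)[of Q f] f base by simp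
    qed
    then show ?case by blast
  qed
  have box: "emeasure P (box a b) = emeasure Q (box a b)" for a b
  proof -
    have I_box: "I Basis (\<lambda>i. {a \<bullet> i <..< b \<bullet> i}) y = indicator (box a b) y" for y
      by (auto simp: I_def indicator_def mem_box prod_zero_iff intro!: prod.neutral)
    have "(LINT y|P. indicator (box a b) y :: real) = (LINT y|Q. indicator (box a b) y)"
      using main[OF finite_Basis, of "\<lambda>i. {a \<bullet> i <..< b \<bullet> i}", THEN spec, THEN conjunct1, of 0]
      unfolding I_box inner_zero_left cos_zero mult_1_right by simp
    then show ?thesis using s by (simp add: P.emeasure_eq_measure Q.emeasure_eq_measure)
  qed
  let ?E = "range (\<lambda>(a, b). box a b::'a set)"
  show "P = Q"
  proof (rule measure_eqI_generator_eq)
    show "Int_stable ?E" by (auto simp: Int_stable_def box_Int_box)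
    show "?E \<subseteq> Pow UNIV" "sets P = sigma_sets UNIV ?E" "sets Q = sigma_sets UNIV ?E"
      by (simp_all add: borel_eq_box s)
    let ?A = "\<lambda>n::nat. box (- (real n *\<^sub>R One)) (real n *\<^sub>R One) :: 'a set"
    show "range ?A \<subseteq> ?E" "(\<Union>i. ?A i) = UNIV"
      unfolding UN_box_eq_UNIV by auto
    show "emeasure P (?A i) \<noteq> \<infinity>" for i by (simp add: P.emeasure_eq_measure)
    fix X assume "X \<in> ?E" then show "emeasure P X = emeasure Q X" using box by auto
  qed
qed

section \<open>Laws of the normalised sums\<close>

text \<open>The sum is a function of the block of variables indexed by I, and disjoint blocks are
  independent.\<close>

lemma (in prob_space) indep_var_sum_euclidean:
  fixes X :: "'i \<Rightarrow> 'a \<Rightarrow> 'b::euclidean_space"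
  assumes I: "finite I" "i \<notin> I" and indep: "indep_vars (\<lambda>_. borel) X (insert i I)"
  shows "indep_var borel (X i) borel (\<lambda>\<omega>. \<Sum>i\<in>I. X i \<omega>)"
proof -
  have "indep_var
    borel ((\<lambda>f. f i) \<circ> (\<lambda>\<omega>. restrict (\<lambda>i. X i \<omega>) {i}))
    borel ((\<lambda>f. \<Sum>i\<in>I. f i) \<circ> (\<lambda>\<omega>. restrict (\<lambda>i. X i \<omega>) I))"
    using I by (intro indep_var_compose[OF indep_var_restrict[OF indep]]) auto
  also have "((\<lambda>f. f i) \<circ> (\<lambda>\<omega>. restrict (\<lambda>i. X i \<omega>) {i})) = X i" by auto
  also have "((\<lambda>f. \<Sum>i\<in>I. f i) \<circ> (\<lambda>\<omega>. restrict (\<lambda>i. X i \<omega>) I)) = (\<lambda>\<omega>. \<Sum>i\<in>I. X i \<omega>)"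
    by (auto cong: rev_conj_cong)
  finally show ?thesis .
qed

lemma AE_lborel_affine:
  fixes A :: "'a::euclidean_space set"
  assumes A: "A \<in> sets borel" "emeasure lborel A = 0" and c: "c \<noteq> 0"
  shows "AE y in lborel. t + c *\<^sub>R y \<notin> A"
proof -
  have "AE y in (lborel :: 'a measure). y \<notin> A" using A by (intro AE_not_in) (auto simp: null_sets_def)
  then have "AE y in density (distr lborel borel (\<lambda>x. t + c *\<^sub>R x)) (\<lambda>_. ennreal (\<bar>c\<bar> ^ DIM('a))). y \<notin> A"
    by (subst (asm) lborel_affine[OF c, of t])
  then show ?thesis using A c by (simp add: AE_density AE_distr_iff)
qed

context pareto
begin

text \<open>The induction runs over all x and g: integrating out the last summand replaces g by
  \<open>conv_op p g\<close>.\<close>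

lemma iid_sum_expectation:
  fixes X :: "nat \<Rightarrow> 'w \<Rightarrow> 'a"
  assumes M: "prob_space M" and ind: "prob_space.indep_vars M (\<lambda>_. borel) X {1..}"
    and X: "\<And>i. i \<ge> 1 \<Longrightarrow> distributed M lborel (X i) (\<lambda>x. ennreal (p x))"
    and g: "bdd_borel B g"
  shows "(LINT w|M. g (x + (\<Sum>i=1..n. X i w))) = (conv_op p ^^ n) g x"
  using g
proof (induction n arbitrary: x g)
  interpret prob_space M by fact
  case 0 then show ?case by (simp add: prob_space)
next
  interpret prob_space M by fact
  case (Suc n)
  note [measurable] = bdd_borelD(1)[OF Suc.prems]
  have p1: "(LINT y|lborel. \<bar>p y\<bar>) \<le> 1" using integral_p p_nonneg by simp
  define S where "S = (\<lambda>w. \<Sum>i=1..n. X i w)"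
  have iv: "indep_var borel (X (Suc n)) borel S"
    unfolding S_def by (rule indep_var_sum_euclidean[OF _ _ indep_vars_subset[OF ind]]) auto
  note [measurable] = indep_var_rv1[OF iv] indep_var_rv2[OF iv]
  have dX: "distr M borel (X (Suc n)) = density lborel (\<lambda>x. ennreal (p x))"
    using X[of "Suc n"] by (simp add: distributed_def distr_cong[of M M borel lborel])
  have jd: "distr M borel (X (Suc n)) \<Otimes>\<^sub>M distr M borel S = distr M (borel \<Otimes>\<^sub>M borel) (\<lambda>w. (X (Suc n) w, S w))"
    using iv by (simp add: indep_var_distribution_eq)
  interpret a: prob_space "distr M borel (X (Suc n))" by (rule prob_space_distr) simp
  interpret b: prob_space "distr M borel S" by (rule prob_space_distr) simp
  interpret pair_prob_space "distr M borel (X (Suc n))" "distr M borel S" ..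
  have "(LINT w|M. g (x + (\<Sum>i=1..Suc n. X i w))) = (LINT w|M. (\<lambda>(y, s). g (x + s + y)) (X (Suc n) w, S w))"
    by (simp add: S_def add.assoc)
  also have "\<dots> = (LINT z|distr M (borel \<Otimes>\<^sub>M borel) (\<lambda>w. (X (Suc n) w, S w)). (\<lambda>(y, s). g (x + s + y)) z)"
    by (subst integral_distr) auto
  also have "\<dots> = (LINT s|distr M borel S. LINT y|distr M borel (X (Suc n)). g (x + s + y))"
    unfolding jd[symmetric]
  proof (rule integral_snd[symmetric])
    show "integrable (distr M borel (X (Suc n)) \<Otimes>\<^sub>M distr M borel S) (\<lambda>(y, s). g (x + s + y))"
      by (rule P.integrable_const_bound[where B=B]) (use bdd_borelD(2)[OF Suc.prems] in auto)
  qed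
  also have "\<dots> = (LINT s|distr M borel S. conv_op p g (x + s))"
    unfolding dX conv_op_def using p_nonneg by (intro Bochner_Integration.integral_cong[OF refl], subst integral_density) auto
  also have "\<dots> = (LINT w|M. conv_op p g (x + S w))"
    using bdd_borelD(1)[OF bdd_borel_conv_op[OF p_integrable p1 Suc.prems]] by (subst integral_distr) auto
  also have "\<dots> = (conv_op p ^^ n) (conv_op p g) x"
    unfolding S_def using bdd_borel_conv_op[OF p_integrable p1 Suc.prems] by (intro Suc.IH) simp
  finally show ?case by (simp add: funpow_swap1)
qed

text \<open>Reflection of Lebesgue measure gives I = -I. The argument also covers a non-integrable
  F(X), whose Bochner integral is 0 by convention.\<close>

lemma odd_expectation:
  fixes X :: "'w \<Rightarrow> 'a" and F :: "'a \<Rightarrow> 'a"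
  assumes X: "distributed M lborel X (\<lambda>x. ennreal (p x))"
    and F[measurable]: "F \<in> borel_measurable borel" and odd: "\<And>y. F (- y) = - F y"
  shows "(LINT w|M. F (X w)) = 0"
proof -
  have "(LINT w|M. F (X w)) = (LINT y|distr M lborel X. F y)"
    using X by (subst integral_distr) (auto simp: distributed_def)
  also have "\<dots> = (LINT y|lborel. p y *\<^sub>R F y)"
    using X p_nonneg by (simp add: distributed_distr_eq_density integral_density)
  finally have e: "(LINT w|M. F (X w)) = (LINT y|lborel. p y *\<^sub>R F y)" .
  have "(LINT y|lborel. p y *\<^sub>R F y) = (LINT y|distr lborel borel uminus. p y *\<^sub>R F y)"
    by (simp add: lborel_distr_uminus_euclidean)
  also have "\<dots> = (LINT y|lborel. - (p y *\<^sub>R F y))"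
    by (subst integral_distr) (auto simp: p_even odd)
  also have "\<dots> = - (LINT y|lborel. p y *\<^sub>R F y)" by simp
  finally have "(LINT y|lborel. p y *\<^sub>R F y) = 0"
    by (metis add.right_inverse add_cancel_left_right euclidean_eqI real_vector_eq_affinity scaleR_half_double scaleR_zero_right)
  then show ?thesis using e by simp
qed

text \<open>The mean and the truncated mean are expectations of odd functions, so all three cases of
  the centering vanish.\<close>

lemma centering_eq_0:
  fixes X :: "'w \<Rightarrow> 'a"
  assumes "distributed M lborel X (\<lambda>x. ennreal (p x))"
  shows "centering M X \<sigma> \<alpha> n = 0"
  unfolding centering_def using odd_expectation[OF assms, of "\<lambda>y. y"]
    odd_expectation[OF assms, of "\<lambda>y. indicator {0<..\<sigma> * real n} (norm y) *\<^sub>R y"] by auto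

text \<open>Describes the law of the normalised sum through powers of \<open>conv_op p\<close>
  alone, detached from the underlying probability space and its variables.\<close>

definition sum_law :: "real \<Rightarrow> nat \<Rightarrow> 'a measure \<Rightarrow> bool" where
  "sum_law \<sigma> n \<mu> \<longleftrightarrow> prob_space \<mu> \<and> sets \<mu> = sets borel \<and>
    (\<forall>B g. bdd_borel B g \<longrightarrow> (LINT x|\<mu>. g x) = (conv_op p ^^ n) (\<lambda>x. g ((1 / (real n powr (1 / \<alpha>) * \<sigma>)) *\<^sub>R x)) 0)"

lemma sum_law_normalized_sum:
  fixes X :: "nat \<Rightarrow> 'w \<Rightarrow> 'a"
  assumes M: "prob_space M" and ind: "prob_space.indep_vars M (\<lambda>_. borel) X {1..}"
    and X: "\<And>i. i \<ge> 1 \<Longrightarrow> distributed M lborel (X i) (\<lambda>x. ennreal (p x))"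
  shows "sum_law \<sigma> n (distr M borel (normalized_sum M X \<sigma> \<alpha> n))"
proof -
  interpret prob_space M by fact
  have Xm[measurable]: "X i \<in> borel_measurable M" if "i \<in> {1..n}" for i
    using X[of i] that by (auto simp: distributed_def)
  have e: "normalized_sum M X \<sigma> \<alpha> n = (\<lambda>w. (1 / (real n powr (1 / \<alpha>) * \<sigma>)) *\<^sub>R (\<Sum>i=1..n. X i w))"
    unfolding normalized_sum_def[abs_def] using centering_eq_0[OF X[of 1]] by simp
  have m: "normalized_sum M X \<sigma> \<alpha> n \<in> borel_measurable M" unfolding e by measurable
  show ?thesis
    unfolding sum_law_def
  proof (intro conjI allI impI)
    show "prob_space (distr M borel (normalized_sum M X \<sigma> \<alpha> n))" using m by (rule prob_space_distr)
    fix B g assume g: "bdd_borel B (g :: 'a \<Rightarrow> real)"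
    have "(LINT x|distr M borel (normalized_sum M X \<sigma> \<alpha> n). g x) = (LINT w|M. g ((1 / (real n powr (1 / \<alpha>) * \<sigma>)) *\<^sub>R (0 + (\<Sum>i=1..n. X i w))))"
      using m bdd_borelD(1)[OF g] by (subst integral_distr) (auto simp: e)
    also have "\<dots> = (conv_op p ^^ n) (\<lambda>x. g ((1 / (real n powr (1 / \<alpha>) * \<sigma>)) *\<^sub>R x)) 0"
      by (rule iid_sum_expectation[OF M ind X bdd_borel_scale[OF g]])
    finally show "(LINT x|distr M borel (normalized_sum M X \<sigma> \<alpha> n). g x) = \<dots>" .
  qed simp
qed

text \<open>A step with a density sends the indicator of a null set to the zero function, so n \<ge>
  1 steps give absolute continuity, and Radon-Nikodym supplies the density.\<close>

lemma sum_law_density: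
  assumes \<mu>: "sum_law \<sigma> n \<mu>" and n: "n \<ge> 1" and \<sigma>: "0 < \<sigma>"
  shows "\<exists>f. prob_density f \<and> \<mu> = density lborel (\<lambda>x. ennreal (f x))"
proof -
  interpret prob_space \<mu> using \<mu> by (simp add: sum_law_def)
  have s: "sets \<mu> = sets borel" using \<mu> by (simp add: sum_law_def)
  define c where "c = 1 / (real n powr (1 / \<alpha>) * \<sigma>)"
  have c: "c \<noteq> 0" using n \<sigma> by (simp add: c_def)
  have ac: "absolutely_continuous lborel \<mu>"
    unfolding absolutely_continuous_def
  proof
    fix A :: "'a set" assume "A \<in> null_sets lborel"
    then have A: "A \<in> sets borel" "emeasure lborel A = 0" by (auto simp: null_sets_def)
    define g where "g x = indicat_real A (c *\<^sub>R x)" for x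
    have bi: "bdd_borel 1 (indicat_real A)" using A by (auto simp: bdd_borel_def indicator_def)
    have "conv_op p g = (\<lambda>x. 0)"
    proof
      fix x
      have "AE y in lborel. c *\<^sub>R x + c *\<^sub>R y \<notin> A" by (rule AE_lborel_affine[OF A c])
      then have "(LINT y|lborel. p y * g (x + y)) = (LINT y|(lborel :: 'a measure). 0)"
      proof (intro Bochner_Integration.integral_cong_AE)
        show "(\<lambda>y. p y * g (x + y)) \<in> borel_measurable lborel"
          using bdd_borelD(1)[OF bdd_borel_scale[OF bi]] unfolding g_def by measurable
      qed (auto simp: g_def scaleR_add_right elim!: eventually_mono)
      then show "conv_op p g x = 0" by (simp add: conv_op_def)
    qed
    moreover have "(conv_op p ^^ k) (\<lambda>x. 0) = (\<lambda>x. 0)" for k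
      by (induction k) (auto simp: conv_op_def)
    moreover obtain k where "n = Suc k" using n by (cases n) auto
    ultimately have z: "(conv_op p ^^ n) g = (\<lambda>x. 0)" by (simp only: funpow_Suc_right comp_apply)
    have "(LINT x|\<mu>. indicat_real A x) = (conv_op p ^^ n) g 0"
      using \<mu> bi unfolding sum_law_def g_def[abs_def] c_def by blast
    then have "measure \<mu> A = 0" using A s z by simp
    then show "A \<in> null_sets \<mu>" using A s by (simp add: null_sets_def emeasure_eq_measure)
  qed
  obtain D where D: "D \<in> borel_measurable lborel" "AE x in lborel. RN_deriv lborel \<mu> x = ennreal (D x)" "\<And>x. 0 \<le> D x"
    by (rule sigma_finite_measure.real_RN_deriv[OF sigma_finite_lborel finite_measure_axioms ac]) (use s in auto)
  have "\<mu> = density lborel (RN_deriv lborel \<mu>)" using sigma_finite_measure.density_RN_deriv[OF sigma_finite_lborel ac] s by simp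
  also have "\<dots> = density lborel (\<lambda>x. ennreal (D x))" using D by (intro density_cong) auto
  finally have e: "\<mu> = density lborel (\<lambda>x. ennreal (D x))" .
  have "(\<integral>\<^sup>+x. ennreal (D x) \<partial>lborel) = emeasure \<mu> UNIV"
    by (subst e) (use D in \<open>simp add: emeasure_density\<close>)
  also have "\<dots> = ennreal 1" using emeasure_space_1 sets_eq_imp_space_eq[OF s] by simp
  finally have "has_bochner_integral lborel D 1" using D by (intro has_bochner_integral_nn_integral) auto
  then show ?thesis using D e by (auto simp: prob_density_def has_bochner_integral_iff intro!: exI[of _ D])
qed

lemma bdd_borelI: "h \<in> borel_measurable borel \<Longrightarrow> (\<And>x. \<bar>h x\<bar> \<le> 1) \<Longrightarrow> bdd_borel 1 (h :: 'a \<Rightarrow> real)"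
  by (simp add: bdd_borel_def)

text \<open>The scale factor for 2 n times \<open>dil\<close> is that for n. Both expectations are
  therefore values at 0 obtained from one test function \<open>G\<close>, by 2 n steps of
  \<open>p\<close> and by n steps of \<open>p_dil\<close>.\<close>

lemma sum_law_doubling:
  assumes C: "\<forall>n\<ge>1. \<forall>B g x. bdd_borel B g \<longrightarrow>
     \<bar>(conv_op p ^^ (2 * n)) g x - (conv_op p_dil ^^ n) g x\<bar> \<le> C * B * real n powr (- rate)"
    and n: "n \<ge> 1" and \<mu>: "sum_law \<sigma> n \<mu>" and \<mu>': "sum_law \<sigma> (2 * n) \<mu>'" and g: "bdd_borel 1 g"
  shows "\<bar>(LINT x|\<mu>'. g x) - (LINT x|\<mu>. g x)\<bar> \<le> C * real n powr (- rate)"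
proof -
  define c where "c = 1 / (real (2 * n) powr (1 / \<alpha>) * \<sigma>)"
  define G where "G x = g (c *\<^sub>R x)" for x
  have G: "bdd_borel 1 G" unfolding G_def using g by (rule bdd_borel_scale)
  have "c * dil = 1 / (real n powr (1 / \<alpha>) * \<sigma>)"
    unfolding c_def dil_def using n by (simp add: powr_mult)
  then have "(LINT x|\<mu>. g x) = (conv_op p_dil ^^ n) G 0"
    unfolding conv_op_p_dil_pow[OF G] using \<mu> g by (simp add: sum_law_def G_def)
  moreover have "(LINT x|\<mu>'. g x) = (conv_op p ^^ (2 * n)) G 0"
    using \<mu>' g by (simp add: sum_law_def G_def[abs_def] c_def)
  ultimately show ?thesis using C[rule_format, OF n G, of 0] by simp
qed

text \<open>Along n 2^j the rates form a geometric series with ratio 2^(-rate). The limit density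
  may depend on n here; the last conjunct, convergence of expectations, is what later identifies its
  law for all n.\<close>

lemma sum_law_limit:
  assumes \<mu>: "\<And>n. n \<ge> 1 \<Longrightarrow> sum_law \<sigma> n (\<mu> n)" and \<sigma>: "0 < \<sigma>"
  shows "\<exists>C\<ge>0. \<forall>n\<ge>1. \<exists>h. prob_density h \<and> d_TV (\<mu> n) (density lborel h) \<le> C * real n powr (- rate) \<and>
     (\<forall>g. bdd_borel 1 g \<longrightarrow> (\<lambda>j. LINT x|\<mu> (n * 2 ^ j). g x) \<longlonglongrightarrow> (LINT x|density lborel h. g x))"
proof -
  obtain C where C: "0 \<le> C" "\<forall>n\<ge>1. \<forall>B g x. bdd_borel B g \<longrightarrow>
     \<bar>(conv_op p ^^ (2 * n)) g x - (conv_op p_dil ^^ n) g x\<bar> \<le> C * B * real n powr (- rate)"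
    using doubling_estimate by blast
  define r where "r = 2 powr (- rate)"
  have r: "0 < r" "r < 1" using rate(1) powr_less_mono[of "- rate" 0 2] by (auto simp: r_def)
  define K where "K = C / (1 - r)"
  have K: "0 \<le> K" using C r by (simp add: K_def)
  have "\<exists>h. prob_density h \<and> d_TV (\<mu> n) (density lborel h) \<le> K * real n powr (- rate) \<and>
     (\<forall>g. bdd_borel 1 g \<longrightarrow> (\<lambda>j. LINT x|\<mu> (n * 2 ^ j). g x) \<longlonglongrightarrow> (LINT x|density lborel h. g x))" if n: "n \<ge> 1" for n
  proof -
    have "\<exists>f. prob_density f \<and> \<mu> (n * 2 ^ j) = density lborel (\<lambda>x. ennreal (f x))" for j
      using n by (intro sum_law_density[OF \<mu> _ \<sigma>]) auto
    then obtain f where f: "\<And>j. prob_density (f j)" "\<And>j. \<mu> (n * 2 ^ j) = density lborel (\<lambda>x. ennreal (f j x))" by metis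
    define c where "c j = C * real n powr (- rate) * r ^ j" for j
    have cj: "C * real (n * 2 ^ j) powr (- rate) = c j" for j
      using n by (simp add: c_def r_def powr_mult powr_powr flip: powr_realpow) (simp add: powr_powr mult.commute)
    have "(LINT x|lborel. \<bar>f (Suc j) x - f j x\<bar>) \<le> c j" for j
    proof (rule L1_dist_le_dual[OF f(1) f(1)])
      fix h :: "'a \<Rightarrow> real" assume h: "h \<in> borel_measurable borel" "\<And>x. \<bar>h x\<bar> \<le> 1"
      have "sum_law \<sigma> (n * 2 ^ j) (\<mu> (n * 2 ^ j))" "sum_law \<sigma> (2 * (n * 2 ^ j)) (\<mu> (2 * (n * 2 ^ j)))"
        using n by (auto intro!: \<mu>)
      from sum_law_doubling[OF C(2) _ this bdd_borelI[OF h]] n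
      have "\<bar>(LINT x|\<mu> (n * 2 ^ Suc j). h x) - (LINT x|\<mu> (n * 2 ^ j). h x)\<bar> \<le> C * real (n * 2 ^ j) powr (- rate)"
        by (simp add: mult_ac)
      then show "\<bar>(LINT x|density lborel (f (Suc j)). h x) - (LINT x|density lborel (f j). h x)\<bar> \<le> c j"
        by (simp only: f(2) cj)
    qed
    moreover have sc: "summable c" unfolding c_def using r by (intro summable_mult summable_geometric) auto
    ultimately obtain h where h: "prob_density h" "\<And>j. (LINT x|lborel. \<bar>h x - f j x\<bar>) \<le> (\<Sum>i. c (i + j))"
      using prob_density_L1_limit[of f c, OF f(1)] by blast
    have tail: "(\<Sum>i. c (i + j)) = K * real n powr (- rate) * r ^ j" for j
      using r suminf_mult[of "\<lambda>i. r ^ i" "C * real n powr (- rate) * r ^ j"]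
      by (simp add: c_def power_add suminf_geometric K_def mult_ac)
    have "d_TV (\<mu> n) (density lborel h) \<le> (LINT x|lborel. \<bar>f 0 x - h x\<bar>)"
      using d_TV_density_le[OF f(1)[of 0] h(1)] f(2)[of 0] by simp
    also have "\<dots> \<le> K * real n powr (- rate)" using h(2)[of 0] tail[of 0] by (simp add: abs_minus_commute)
    finally have 1: "d_TV (\<mu> n) (density lborel h) \<le> K * real n powr (- rate)" .
    have 2: "(\<lambda>j. LINT x|\<mu> (n * 2 ^ j). g x) \<longlonglongrightarrow> (LINT x|density lborel h. g x)" if g: "bdd_borel 1 g" for g
    proof -
      have b: "norm ((LINT x|\<mu> (n * 2 ^ j). g x) - (LINT x|density lborel h. g x)) \<le> (\<Sum>i. c (i + j))" for j
      proof -
        have int: "integrable lborel (\<lambda>x. f j x * g x)" "integrable lborel (\<lambda>x. h x * g x)"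
          using h(1) f(1)[of j] bdd_borelD[OF g] by (auto simp: prob_density_def intro!: integrable_mult_bdd[where B=1])
        have i2: "integrable lborel (\<lambda>x. \<bar>h x - f j x\<bar>)" using h(1) f(1)[of j] by (auto simp: prob_density_def)
        have "(LINT x|\<mu> (n * 2 ^ j). g x) - (LINT x|density lborel h. g x) = (LINT x|lborel. f j x * g x - h x * g x)"
          using int h(1) f(1)[of j] bdd_borelD(1)[OF g] by (simp add: f(2) prob_density_def integral_density)
        also have "norm \<dots> \<le> (LINT x|lborel. \<bar>f j x * g x - h x * g x\<bar>)" using integral_abs_bound by simp
        also have "\<dots> \<le> (LINT x|lborel. \<bar>h x - f j x\<bar>)"
        proof (intro integral_mono i2 integrable_abs Bochner_Integration.integrable_diff int)
          fix x
          have "\<bar>f j x * g x - h x * g x\<bar> = \<bar>h x - f j x\<bar> * \<bar>g x\<bar>" by (simp add: abs_mult abs_minus_commute flip: left_diff_distrib)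
          also have "\<dots> \<le> \<bar>h x - f j x\<bar> * 1" using bdd_borelD(2)[OF g] by (intro mult_left_mono) auto
          finally show "\<bar>f j x * g x - h x * g x\<bar> \<le> \<bar>h x - f j x\<bar>" by simp
        qed
        finally show ?thesis using h(2)[of j] by linarith
      qed
      have "(\<lambda>j. (LINT x|\<mu> (n * 2 ^ j). g x) - (LINT x|density lborel h. g x)) \<longlonglongrightarrow> 0"
        by (rule Lim_null_comparison[OF always_eventually[OF allI[OF b]] suminf_exist_split2[OF sc]])
      then show ?thesis by (rule LIM_zero_cancel)
    qed
    show ?thesis using h(1) 1 2 by blast
  qed
  then show ?thesis using K by blast
qed

section \<open>Characteristic functions of the normalised sums\<close>

definition \<phi> :: "'a \<Rightarrow> real" where "\<phi> l = (LINT y|lborel. p y * cos (l \<bullet> y))"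

text \<open>Evenness of p makes its characteristic function real, and cosines and sines are
  eigenfunctions of the convolution with eigenvalue \<open>\<phi> l\<close>. Powers of the operator
  then give the characteristic functions of the sums.\<close>

lemma conv_op_cos: "conv_op p (\<lambda>x. cos (l \<bullet> x)) x = \<phi> l * cos (l \<bullet> x)"
  and conv_op_sin: "conv_op p (\<lambda>x. sin (l \<bullet> x)) x = \<phi> l * sin (l \<bullet> x)"
proof -
  have i: "integrable lborel (\<lambda>y. p y * cos (l \<bullet> y))" "integrable lborel (\<lambda>y. p y * sin (l \<bullet> y))"
    by (auto intro!: integrable_mult_bdd[OF p_integrable, where B=1])
  have s0: "(LINT y|lborel. p y * sin (l \<bullet> y)) = 0"
    using integral_lborel_uminus[of "\<lambda>y. p y * sin (l \<bullet> y)"] by (simp add: p_even)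
  have "conv_op p (\<lambda>x. cos (l \<bullet> x)) x = (LINT y|lborel. cos (l \<bullet> x) * (p y * cos (l \<bullet> y)) - sin (l \<bullet> x) * (p y * sin (l \<bullet> y)))"
    unfolding conv_op_def by (intro Bochner_Integration.integral_cong) (auto simp: inner_add_right cos_add algebra_simps)
  then show "conv_op p (\<lambda>x. cos (l \<bullet> x)) x = \<phi> l * cos (l \<bullet> x)" using i s0 by (simp add: \<phi>_def)
  have "conv_op p (\<lambda>x. sin (l \<bullet> x)) x = (LINT y|lborel. sin (l \<bullet> x) * (p y * cos (l \<bullet> y)) + cos (l \<bullet> x) * (p y * sin (l \<bullet> y)))"
    unfolding conv_op_def by (intro Bochner_Integration.integral_cong) (auto simp: inner_add_right sin_add algebra_simps)
  then show "conv_op p (\<lambda>x. sin (l \<bullet> x)) x = \<phi> l * sin (l \<bullet> x)" using i s0 by (simp add: \<phi>_def)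
qed

lemma conv_op_pow_cos: "(conv_op p ^^ k) (\<lambda>x. cos (l \<bullet> x)) = (\<lambda>x. \<phi> l ^ k * cos (l \<bullet> x))"
  and conv_op_pow_sin: "(conv_op p ^^ k) (\<lambda>x. sin (l \<bullet> x)) = (\<lambda>x. \<phi> l ^ k * sin (l \<bullet> x))"
proof -
  have cm: "conv_op p (\<lambda>x. a * g x) = (\<lambda>x. a * conv_op p g x)" for a and g :: "'a \<Rightarrow> real"
    unfolding conv_op_def by (auto simp: mult.left_commute[of _ a])
  show "(conv_op p ^^ k) (\<lambda>x. cos (l \<bullet> x)) = (\<lambda>x. \<phi> l ^ k * cos (l \<bullet> x))"
    by (induction k) (auto simp: cm conv_op_cos)
  show "(conv_op p ^^ k) (\<lambda>x. sin (l \<bullet> x)) = (\<lambda>x. \<phi> l ^ k * sin (l \<bullet> x))"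
    by (induction k) (auto simp: cm conv_op_sin)
qed

lemma bdd_cos_sin: "bdd_borel 1 (\<lambda>x::'a. cos (l \<bullet> x))" "bdd_borel 1 (\<lambda>x::'a. sin (l \<bullet> x))"
  by (auto simp: bdd_borel_def)

lemma sum_law_char:
  assumes "sum_law \<sigma> n \<mu>"
  shows "(LINT x|\<mu>. cos (l \<bullet> x)) = \<phi> ((1 / (real n powr (1 / \<alpha>) * \<sigma>)) *\<^sub>R l) ^ n" "(LINT x|\<mu>. sin (l \<bullet> x)) = 0"
proof -
  have "(LINT x|\<mu>. cos (l \<bullet> x)) = (conv_op p ^^ n) (\<lambda>x. cos (((1 / (real n powr (1 / \<alpha>) * \<sigma>)) *\<^sub>R l) \<bullet> x)) 0"
    using assms bdd_cos_sin(1)[of l] by (simp add: sum_law_def)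
  then show "(LINT x|\<mu>. cos (l \<bullet> x)) = \<phi> ((1 / (real n powr (1 / \<alpha>) * \<sigma>)) *\<^sub>R l) ^ n"
    by (simp only: conv_op_pow_cos inner_zero_right cos_zero mult_1_right)
  have "(LINT x|\<mu>. sin (l \<bullet> x)) = (conv_op p ^^ n) (\<lambda>x. sin (((1 / (real n powr (1 / \<alpha>) * \<sigma>)) *\<^sub>R l) \<bullet> x)) 0"
    using assms bdd_cos_sin(2)[of l] by (simp add: sum_law_def)
  then show "(LINT x|\<mu>. sin (l \<bullet> x)) = 0"
    by (simp only: conv_op_pow_sin inner_zero_right sin_zero mult_zero_right)
qed

end

section \<open>Expansion of the characteristic function\<close>

lemma one_minus_cos_le: "1 - cos x \<le> x\<^sup>2 / 2" for x :: real
proof -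
  obtain t where t: "cos x = (\<Sum>m<2. cos_coeff m * x ^ m) + (cos (t + 1/2 * real 2 * pi) / fact 2) * x ^ 2"
    using Maclaurin_cos_expansion[of x 2] by blast
  have "cos (t + 1/2 * real 2 * pi) * x\<^sup>2 \<ge> (- 1) * x\<^sup>2" by (intro mult_right_mono) auto
  then show ?thesis using t by (simp add: cos_coeff_def numeral_2_eq_2)
qed

lemma one_minus_cos_ge: "x\<^sup>2 / 2 - x ^ 4 / 24 \<le> 1 - cos x" for x :: real
proof -
  obtain t where t: "cos x = (\<Sum>m<4. cos_coeff m * x ^ m) + (cos (t + 1/2 * real 4 * pi) / fact 4) * x ^ 4"
    using Maclaurin_cos_expansion[of x 4] by blast
  have "cos (t + 1/2 * real 4 * pi) * x ^ 4 \<le> 1 * x ^ 4" by (intro mult_right_mono) auto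
  moreover have "{..<4} = {0, 1, 2, 3 :: nat}" by auto
  ultimately show ?thesis using t by (simp add: cos_coeff_def fact_numeral)
qed

lemma nn_integral_powr_0_1:
  assumes "- 1 < a" shows "(\<integral>\<^sup>+r. ennreal (r powr a) * indicator {0..1} r \<partial>lborel) = ennreal (1 / (a + 1))"
  using nn_integral_has_integral_lebesgue'[OF _ has_integral_powr_from_0[OF assms, of 1]] by simp

text \<open>Integrand of the one-dimensional stable exponent: 1 - cos against the measure \<alpha>
  r^(-1-\<alpha>) dr, which on r \<ge> 1 is the law of |X|.\<close>

definition levy_integrand :: "real \<Rightarrow> real \<Rightarrow> real \<Rightarrow> real" where
  "levy_integrand \<alpha> t r = \<alpha> * (1 - cos (r * t)) * r powr (- 1 - \<alpha>)"

lemma levy_integrand_nonneg: "0 < \<alpha> \<Longrightarrow> 0 \<le> levy_integrand \<alpha> t r"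
  by (simp add: levy_integrand_def)

lemma levy_integrand_measurable [measurable]: "(\<lambda>(t, r). levy_integrand \<alpha> t r) \<in> borel_measurable (borel \<Otimes>\<^sub>M borel)"
  unfolding levy_integrand_def by measurable

text \<open>Contribution of the jumps below 1, which the Pareto law lacks. Averaged over directions
  it is exactly the difference between the stable exponent and 1 - \<phi>.\<close>

definition levy_small :: "real \<Rightarrow> real \<Rightarrow> ennreal" where
  "levy_small \<alpha> t = (\<integral>\<^sup>+r. ennreal (levy_integrand \<alpha> t r) * indicator {0<..<1} r \<partial>lborel)"

context
  fixes \<alpha> :: real assumes \<alpha>: "0 < \<alpha>" "\<alpha> < 2"
begin

lemma levy_small_le: "levy_small \<alpha> t \<le> ennreal (\<alpha> / (2 * (2 - \<alpha>)) * t\<^sup>2)"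
proof -
  have "levy_small \<alpha> t \<le> (\<integral>\<^sup>+r. ennreal (\<alpha> * t\<^sup>2 / 2) * (ennreal (r powr (1 - \<alpha>)) * indicator {0..1} r) \<partial>lborel)"
    unfolding levy_small_def
  proof (intro nn_integral_mono)
    fix r :: real
    have "levy_integrand \<alpha> t r \<le> \<alpha> * t\<^sup>2 / 2 * r powr (1 - \<alpha>)" if "0 < r"
    proof -
      have "levy_integrand \<alpha> t r \<le> \<alpha> * ((r * t)\<^sup>2 / 2) * r powr (- 1 - \<alpha>)"
        unfolding levy_integrand_def using \<alpha> one_minus_cos_le by (intro mult_right_mono mult_left_mono) auto
      also have "\<dots> = \<alpha> * t\<^sup>2 / 2 * (r powr 2 * r powr (- 1 - \<alpha>))" using that by (simp add: power_mult_distrib powr_numeral)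
      also have "r powr 2 * r powr (- 1 - \<alpha>) = r powr (1 - \<alpha>)" by (simp flip: powr_add)
      finally show ?thesis .
    qed
    then show "ennreal (levy_integrand \<alpha> t r) * indicator {0<..<1} r \<le> ennreal (\<alpha> * t\<^sup>2 / 2) * (ennreal (r powr (1 - \<alpha>)) * indicator {0..1} r)"
      using \<alpha> by (auto simp: indicator_def ennreal_mult[symmetric] intro!: ennreal_leI)
  qed
  also have "\<dots> = ennreal (\<alpha> * t\<^sup>2 / 2) * ennreal (1 / (2 - \<alpha>))"
    using \<alpha> nn_integral_powr_0_1[of "1 - \<alpha>"] by (simp add: nn_integral_cmult)
  also have "\<dots> = ennreal (\<alpha> / (2 * (2 - \<alpha>)) * t\<^sup>2)"
    using \<alpha> by (simp flip: ennreal_mult)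
  finally show ?thesis .
qed

text \<open>Fourth-order Taylor bound of the cosine, integrated over (0, 1). The quartic term stands
  on the right to avoid a subtraction of extended reals.\<close>

lemma levy_small_ge: "ennreal (\<alpha> / (2 * (2 - \<alpha>)) * t\<^sup>2) \<le> levy_small \<alpha> t + ennreal (\<alpha> / (24 * (4 - \<alpha>)) * t ^ 4)"
proof -
  have "ennreal (\<alpha> / (2 * (2 - \<alpha>)) * t\<^sup>2) = ennreal (\<alpha> * t\<^sup>2 / 2) * ennreal (1 / (2 - \<alpha>))"
    using \<alpha> by (simp flip: ennreal_mult)
  also have "\<dots> = (\<integral>\<^sup>+r. ennreal (\<alpha> * t\<^sup>2 / 2) * (ennreal (r powr (1 - \<alpha>)) * indicator {0..1} r) \<partial>lborel)"
    using \<alpha> nn_integral_powr_0_1[of "1 - \<alpha>"] by (simp add: nn_integral_cmult)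
  also have "\<dots> \<le> (\<integral>\<^sup>+r. ennreal (levy_integrand \<alpha> t r) * indicator {0<..<1} r +
       ennreal (\<alpha> * t ^ 4 / 24) * (ennreal (r powr (3 - \<alpha>)) * indicator {0..1} r) \<partial>lborel)"
  proof (rule nn_integral_mono_AE)
    have *: "\<alpha> * t\<^sup>2 / 2 * r powr (1 - \<alpha>) \<le> levy_integrand \<alpha> t r + \<alpha> * t ^ 4 / 24 * r powr (3 - \<alpha>)" if "0 < r" for r
    proof -
      have e1: "\<alpha> * ((r * t)\<^sup>2 / 2 - (r * t) ^ 4 / 24) * r powr (- 1 - \<alpha>) \<le> levy_integrand \<alpha> t r"
        unfolding levy_integrand_def using \<alpha> one_minus_cos_ge by (intro mult_right_mono mult_left_mono) auto
      have e2: "r\<^sup>2 * r powr (- 1 - \<alpha>) = r powr (1 - \<alpha>)" "r ^ 4 * r powr (- 1 - \<alpha>) = r powr (3 - \<alpha>)"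
        using that by (simp_all flip: powr_numeral powr_add)
      have e3: "\<alpha> * ((r * t)\<^sup>2 / 2 - (r * t) ^ 4 / 24) * r powr (- 1 - \<alpha>) =
          \<alpha> * t\<^sup>2 / 2 * (r\<^sup>2 * r powr (- 1 - \<alpha>)) - \<alpha> * t ^ 4 / 24 * (r ^ 4 * r powr (- 1 - \<alpha>))"
        by (simp add: power_mult_distrib algebra_simps)
      show ?thesis using e1[unfolded e3 e2] by linarith
    qed
    have "AE r in lborel. r \<noteq> 0 \<and> r \<noteq> (1::real)" using AE_lborel_singleton[of 0] AE_lborel_singleton[of 1] by auto
    then show "AE r in lborel. ennreal (\<alpha> * t\<^sup>2 / 2) * (ennreal (r powr (1 - \<alpha>)) * indicator {0..1} r) \<le>
       ennreal (levy_integrand \<alpha> t r) * indicator {0<..<1} r + ennreal (\<alpha> * t ^ 4 / 24) * (ennreal (r powr (3 - \<alpha>)) * indicator {0..1} r)"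
    proof eventually_elim
      fix r :: real assume r: "r \<noteq> 0 \<and> r \<noteq> 1"
      show "ennreal (\<alpha> * t\<^sup>2 / 2) * (ennreal (r powr (1 - \<alpha>)) * indicator {0..1} r) \<le>
       ennreal (levy_integrand \<alpha> t r) * indicator {0<..<1} r + ennreal (\<alpha> * t ^ 4 / 24) * (ennreal (r powr (3 - \<alpha>)) * indicator {0..1} r)"
      proof (cases "0 < r \<and> r < 1")
        case True
        then show ?thesis using *[of r] \<alpha> levy_integrand_nonneg[of \<alpha> t r]
          by (simp add: indicator_def ennreal_mult[symmetric] ennreal_plus[symmetric] ennreal_leI del: ennreal_plus)
      qed (use r in \<open>auto simp: indicator_def\<close>)
    qed
  qed
  also have "\<dots> = levy_small \<alpha> t + ennreal (\<alpha> * t ^ 4 / 24) * ennreal (1 / (4 - \<alpha>))"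
    unfolding levy_small_def using \<alpha> nn_integral_powr_0_1[of "3 - \<alpha>"]
    by (subst nn_integral_add) (auto simp: nn_integral_cmult)
  also have "ennreal (\<alpha> * t ^ 4 / 24) * ennreal (1 / (4 - \<alpha>)) = ennreal (\<alpha> / (24 * (4 - \<alpha>)) * t ^ 4)"
    using \<alpha> by (simp flip: ennreal_mult)
  finally show ?thesis .
qed

lemma nn_integral_levy_large: "(\<integral>\<^sup>+r. ennreal (levy_integrand \<alpha> t r) * indicator {1..} r \<partial>lborel) < \<infinity>"
proof -
  have "(\<integral>\<^sup>+r. ennreal (levy_integrand \<alpha> t r) * indicator {1..} r \<partial>lborel) \<le>
     (\<integral>\<^sup>+r. ennreal 2 * (ennreal (\<alpha> * r powr (- 1 - \<alpha>)) * indicator {1..} r) \<partial>lborel)"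
  proof (intro nn_integral_mono)
    fix r :: real
    have "levy_integrand \<alpha> t r \<le> \<alpha> * 2 * r powr (- 1 - \<alpha>)"
      unfolding levy_integrand_def using \<alpha> by (intro mult_right_mono mult_left_mono) (auto simp: cos_ge_minus_one[THEN order_trans[rotated]] minus_le_iff)
    then have "ennreal (levy_integrand \<alpha> t r) \<le> ennreal (2 * (\<alpha> * r powr (- 1 - \<alpha>)))"
      by (intro ennreal_leI) simp
    also have "\<dots> = ennreal 2 * ennreal (\<alpha> * r powr (- 1 - \<alpha>))"
      using \<alpha> by (intro ennreal_mult) auto
    finally show "ennreal (levy_integrand \<alpha> t r) * indicator {1..} r \<le> ennreal 2 * (ennreal (\<alpha> * r powr (- 1 - \<alpha>)) * indicator {1..} r)"
      by (simp add: indicator_def)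
  qed
  also have "\<dots> < \<infinity>" using nn_integral_powr_tail[OF \<alpha>(1), of 1] by (simp add: nn_integral_cmult ennreal_mult_less_top)
  finally show ?thesis .
qed

lemma levy_split: "(\<integral>\<^sup>+r. ennreal (levy_integrand \<alpha> t r) * indicator {0<..} r \<partial>lborel) =
    (\<integral>\<^sup>+r. ennreal (levy_integrand \<alpha> t r) * indicator {1..} r \<partial>lborel) + levy_small \<alpha> t"
proof -
  have "(\<integral>\<^sup>+r. ennreal (levy_integrand \<alpha> t r) * indicator {0<..} r \<partial>lborel) =
    (\<integral>\<^sup>+r. ennreal (levy_integrand \<alpha> t r) * indicator {1..} r + ennreal (levy_integrand \<alpha> t r) * indicator {0<..<1} r \<partial>lborel)"
    by (intro nn_integral_cong) (auto simp: indicator_def)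
  also have "\<dots> = (\<integral>\<^sup>+r. ennreal (levy_integrand \<alpha> t r) * indicator {1..} r \<partial>lborel) + levy_small \<alpha> t"
    unfolding levy_small_def by (rule nn_integral_add) auto
  finally show ?thesis .
qed

text \<open>The integrals over (0, 1) and over r \<ge> 1 are finite, so the Bochner integral in
  \<open>stable_scale\<close> agrees with the nonnegative integral used in the estimates.\<close>

lemma stable_scale_powr: "ennreal (stable_scale 1 \<alpha> powr \<alpha>) = (\<integral>\<^sup>+r. ennreal (levy_integrand \<alpha> 1 r) * indicator {0<..} r \<partial>lborel)"
  and stable_scale_pos: "0 < stable_scale 1 \<alpha>"
proof -
  let ?N = "\<integral>\<^sup>+r. ennreal (levy_integrand \<alpha> 1 r) * indicator {0<..} r \<partial>lborel"
  have fin: "?N < \<infinity>"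
    using nn_integral_levy_large[of 1] le_less_trans[OF levy_small_le[of 1] ennreal_less_top] unfolding levy_split[of 1]
    by simp
  have eq: "\<alpha> * (indicator {0<..} y *\<^sub>R ((1 - cos y) / y powr (1 + \<alpha>))) = levy_integrand \<alpha> 1 y * indicator {0<..} y" for y :: real
  proof -
    have "y powr (- 1 - \<alpha>) = inverse (y powr (1 + \<alpha>))" using powr_minus[of y "1 + \<alpha>"] by simp
    then show ?thesis by (simp add: levy_integrand_def divide_inverse)
  qed
  have "?N = (\<integral>\<^sup>+r. ennreal (levy_integrand \<alpha> 1 r * indicator {0<..} r) \<partial>lborel)"
    by (intro nn_integral_cong) (auto simp: indicator_def)
  then have int: "integrable lborel (\<lambda>r. levy_integrand \<alpha> 1 r * indicator {0<..} r)" and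
    N: "?N = ennreal (LINT r|lborel. levy_integrand \<alpha> 1 r * indicator {0<..} r)"
  proof -
    assume e: "?N = (\<integral>\<^sup>+r. ennreal (levy_integrand \<alpha> 1 r * indicator {0<..} r) \<partial>lborel)"
    show i: "integrable lborel (\<lambda>r. levy_integrand \<alpha> 1 r * indicator {0<..} r)"
      using fin e \<alpha> levy_integrand_nonneg by (intro integrableI_nonneg) (auto simp: indicator_def)
    show "?N = ennreal (LINT r|lborel. levy_integrand \<alpha> 1 r * indicator {0<..} r)"
      unfolding e using i \<alpha> levy_integrand_nonneg by (intro nn_integral_eq_integral) (auto simp: indicator_def)
  qed
  define L where "L = (LINT r|lborel. levy_integrand \<alpha> 1 r * indicator {0<..} r)"
  have "1 * \<alpha> * (LBINT y:{0<..}. (1 - cos y) / y powr (1 + \<alpha>)) = L"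
    unfolding set_lebesgue_integral_def L_def eq[symmetric] integral_mult_right_zero by (simp only: mult_1)
  then have sc: "stable_scale 1 \<alpha> = L powr (1 / \<alpha>)" by (simp add: stable_scale_def)
  \<comment> \<open>Positivity comes from the small jumps at t = 1, where the quadratic term
    \<alpha>/(2 (2 - \<alpha>)) exceeds the quartic correction \<alpha>/(24 (4 - \<alpha>)).\<close>
  have L: "0 < L"
  proof -
    have "ennreal (\<alpha> / (2 * (2 - \<alpha>)) * 1\<^sup>2) \<le> levy_small \<alpha> 1 + ennreal (\<alpha> / (24 * (4 - \<alpha>)) * 1 ^ 4)"
      by (rule levy_small_ge)
    also have "levy_small \<alpha> 1 \<le> ?N" unfolding levy_split[of 1] by (rule add_increasing[OF zero_le order_refl])
    also have "?N = ennreal L" using N by (simp add: L_def)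
    finally have "ennreal (\<alpha> / (2 * (2 - \<alpha>))) \<le> ennreal L + ennreal (\<alpha> / (24 * (4 - \<alpha>)))" by simp
    moreover have "\<alpha> / (24 * (4 - \<alpha>)) < \<alpha> / (2 * (2 - \<alpha>))" using \<alpha> by (intro divide_strict_left_mono) auto
    ultimately have "ennreal L \<noteq> 0" using \<alpha> by (auto simp: not_le ennreal_le_iff)
    then show ?thesis by (simp add: ennreal_eq_0_iff)
  qed
  then show "0 < stable_scale 1 \<alpha>" using sc by simp
  have "stable_scale 1 \<alpha> powr \<alpha> = L" using L \<alpha> by (simp add: sc powr_powr)
  then show "ennreal (stable_scale 1 \<alpha> powr \<alpha>) = ?N" using N by (simp add: L_def)
qed

text \<open>Substituting r / |t| for r extracts |t|^\<alpha>.\<close>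

lemma nn_integral_levy: "(\<integral>\<^sup>+r. ennreal (levy_integrand \<alpha> t r) * indicator {0<..} r \<partial>lborel) =
   ennreal (stable_scale 1 \<alpha> powr \<alpha> * \<bar>t\<bar> powr \<alpha>)"
proof (cases "t = 0")
  case True then show ?thesis by (simp add: levy_integrand_def)
next
  case False
  have "(\<integral>\<^sup>+r. ennreal (levy_integrand \<alpha> t r) * indicator {0<..} r \<partial>lborel) =
     ennreal \<bar>1 / \<bar>t\<bar>\<bar> * (\<integral>\<^sup>+r. ennreal (levy_integrand \<alpha> t (0 + 1 / \<bar>t\<bar> * r)) * indicator {0<..} (0 + 1 / \<bar>t\<bar> * r) \<partial>lborel)"
    using False by (intro nn_integral_real_affine) auto
  also have "(\<integral>\<^sup>+r. ennreal (levy_integrand \<alpha> t (0 + 1 / \<bar>t\<bar> * r)) * indicator {0<..} (0 + 1 / \<bar>t\<bar> * r) \<partial>lborel)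
     = (\<integral>\<^sup>+r. ennreal (\<bar>t\<bar> powr (1 + \<alpha>)) * (ennreal (levy_integrand \<alpha> 1 r) * indicator {0<..} r) \<partial>lborel)"
  proof (intro nn_integral_cong)
    fix r :: real
    show "ennreal (levy_integrand \<alpha> t (0 + 1 / \<bar>t\<bar> * r)) * indicator {0<..} (0 + 1 / \<bar>t\<bar> * r)
      = ennreal (\<bar>t\<bar> powr (1 + \<alpha>)) * (ennreal (levy_integrand \<alpha> 1 r) * indicator {0<..} r)"
    proof (cases "0 < r")
      case True
      have c: "cos (r / \<bar>t\<bar> * t) = cos r" using False by (cases "0 < t") auto
      have "(r / \<bar>t\<bar>) powr (- 1 - \<alpha>) = r powr (- 1 - \<alpha>) / \<bar>t\<bar> powr (- 1 - \<alpha>)"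
        using True False by (simp add: powr_divide)
      also have "\<dots> = \<bar>t\<bar> powr (1 + \<alpha>) * r powr (- 1 - \<alpha>)"
        using powr_minus[of "\<bar>t\<bar>" "1 + \<alpha>"] by (simp add: divide_inverse)
      finally have "levy_integrand \<alpha> t (0 + 1 / \<bar>t\<bar> * r) = \<bar>t\<bar> powr (1 + \<alpha>) * levy_integrand \<alpha> 1 r"
        using c by (simp add: levy_integrand_def)
      then show ?thesis using True False \<alpha> by (simp add: indicator_def ennreal_mult levy_integrand_nonneg)
    qed (use False in \<open>auto simp: indicator_def zero_less_divide_iff\<close>)
  qed
  also have "\<dots> = ennreal (\<bar>t\<bar> powr (1 + \<alpha>)) * ennreal (stable_scale 1 \<alpha> powr \<alpha>)"
    by (subst nn_integral_cmult) (auto simp: stable_scale_powr)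
  also have "ennreal \<bar>1 / \<bar>t\<bar>\<bar> * \<dots> = ennreal (1 / \<bar>t\<bar> * (\<bar>t\<bar> powr (1 + \<alpha>) * stable_scale 1 \<alpha> powr \<alpha>))"
    by (simp flip: ennreal_mult)
  also have "1 / \<bar>t\<bar> * (\<bar>t\<bar> powr (1 + \<alpha>) * stable_scale 1 \<alpha> powr \<alpha>) = stable_scale 1 \<alpha> powr \<alpha> * \<bar>t\<bar> powr \<alpha>"
    using False by (simp add: powr_add)
  finally show ?thesis .
qed

end

text \<open>Integration by parts gives the antiderivative Si y - (1 - cos y)/y, and Si tends to
  pi/2. The explicit value decides the borderline case \<alpha> = 1 of the lower bound.\<close>

lemma stable_scale_1: "stable_scale 1 1 = pi / 2"
proof -
  define F where "F y = Si y - (1 - cos y) / y" for y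
  have dF: "(F has_real_derivative (1 - cos x) / x\<^sup>2) (at x)" if "0 < x" for x
  proof -
    have "(F has_real_derivative sinc x - (sin x * x - (1 - cos x)) / x\<^sup>2) (at x)"
      unfolding F_def using that by (auto intro!: derivative_eq_intros DERIV_Si simp: power2_eq_square)
    moreover have "sinc x - (sin x * x - (1 - cos x)) / x\<^sup>2 = (1 - cos x) / x\<^sup>2"
      using that by (simp add: field_simps power2_eq_square)
    ultimately show ?thesis by simp
  qed
  have "((\<lambda>y. (1 - cos y) / y) \<longlongrightarrow> 0) (at_right (0::real))" by real_asymp
  then have F0: "(F \<longlongrightarrow> 0 - 0) (at_right 0)"
  proof -
    have "Si 0 = 0" by (simp add: Si_def zero_ereal_def[symmetric])
    then have "(Si \<longlongrightarrow> 0) (at 0)" using isCont_Si[of 0] by (simp add: isCont_def)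
    then have "(Si \<longlongrightarrow> 0) (at_right 0)" by (rule tendsto_mono[OF at_le[OF subset_UNIV]])
    then show ?thesis unfolding F_def using \<open>((\<lambda>y. (1 - cos y) / y) \<longlongrightarrow> 0) (at_right 0)\<close> by (rule tendsto_diff)
  qed
  have "((\<lambda>y. (1 - cos y) / y) \<longlongrightarrow> 0) (at_top :: real filter)"
  proof (rule Lim_null_comparison)
    show "\<forall>\<^sub>F y in at_top. norm ((1 - cos y) / y) \<le> 2 / (y :: real)"
      using eventually_gt_at_top[of 0]
    proof eventually_elim
      fix y :: real assume "0 < y"
      then show "norm ((1 - cos y) / y) \<le> 2 / y" using cos_ge_minus_one[of y] by (auto intro!: divide_right_mono)
    qed
    show "((\<lambda>y. 2 / y) \<longlongrightarrow> (0::real)) at_top" by real_asymp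
  qed
  then have Finf: "(F \<longlongrightarrow> pi / 2 - 0) at_top" unfolding F_def using Si_at_top by (intro tendsto_diff)
  have "(LBINT x=0..\<infinity>. (1 - cos x) / x\<^sup>2) = (pi / 2 - 0) - (0 - 0)"
    by (rule interval_integral_FTC_nonneg(2)[where F=F])
       (use F0 Finf dF in \<open>auto intro!: DERIV_isCont continuous_intros simp: ereal_tendsto_simps zero_ereal_def\<close>)
  then have "(LBINT y:{0<..}. (1 - cos y) / y\<^sup>2) = pi / 2"
    by (simp add: interval_lebesgue_integral_0_infty)
  moreover have "(LBINT y:{0<..}. (1 - cos y) / y powr (1 + 1)) = (LBINT y:{0<..}. (1 - cos y) / (y :: real)\<^sup>2)"
    by (rule set_lebesgue_integral_cong) (auto simp: powr_numeral)
  ultimately have "(LBINT y:{0<..}. (1 - cos y) / y powr (1 + 1)) = pi / 2" by simp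
  then show ?thesis by (simp only: stable_scale_def) simp
qed

section \<open>Symmetry and moments on the sphere, and the stable exponent\<close>

lemma sets_uniform_sphere [measurable_cong, simp]: "sets (uniform_sphere :: 'a::euclidean_space measure) = sets borel"
  by (simp add: uniform_sphere_def)

lemma uniform_sphere_uminus: "distr uniform_sphere borel uminus = (uniform_sphere :: 'a::euclidean_space measure)"
proof (rule measure_eqI)
  fix A :: "'a set" assume "A \<in> sets (distr uniform_sphere borel uminus)"
  then have A[measurable]: "A \<in> sets borel" by simp
  have mA[measurable]: "uminus -` A \<in> sets borel" using measurable_sets_borel[of uminus borel A] A by simp
  have w: "ennreal (unit_ball_vol (real DIM('a))) \<noteq> 0" "ennreal (unit_ball_vol (real DIM('a))) \<noteq> top"
    using unit_ball_vol_pos[of "real DIM('a)"] by (simp_all add: ennreal_eq_0_iff not_le)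
  have S: "{x::'a. x /\<^sub>R norm x \<in> A} \<inter> ball 0 1 \<in> sets borel"
    using measurable_sets_borel[OF radial_projection_measurable, of A] by (auto simp: vimage_def)
  have "emeasure uniform_sphere (uminus -` A) * ennreal (unit_ball_vol (real DIM('a))) =
     emeasure lborel ({x. x /\<^sub>R norm x \<in> uminus -` A} \<inter> ball 0 1)"
    by (rule emeasure_uniform_sphere) simp
  also have "{x. x /\<^sub>R norm x \<in> uminus -` A} \<inter> ball 0 1 = uminus -` ({x. x /\<^sub>R norm x \<in> A} \<inter> ball 0 1)"
    by auto
  also have "emeasure lborel \<dots> = emeasure (distr lborel borel uminus) ({x. x /\<^sub>R norm x \<in> A} \<inter> ball 0 1)"
    using S by (subst emeasure_distr) auto
  also have "\<dots> = emeasure uniform_sphere A * ennreal (unit_ball_vol (real DIM('a)))"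
    by (simp only: lborel_distr_uminus_euclidean emeasure_uniform_sphere[OF A])
  finally have "emeasure uniform_sphere (uminus -` A) = emeasure uniform_sphere A"
    using w by (metis mult_divide_eq_ennreal)
  then show "emeasure (distr uniform_sphere borel uminus) A = emeasure uniform_sphere A"
    by (subst emeasure_distr) (auto simp: uniform_sphere_def)
qed simp

lemma sphere_integral_odd:
  fixes f :: "'a::euclidean_space \<Rightarrow> real"
  assumes [measurable]: "f \<in> borel_measurable borel" and odd: "\<And>x. f (- x) = - f x"
  shows "(LINT x|uniform_sphere. f x) = 0"
proof -
  have "(LINT x|uniform_sphere. f x) = (LINT x|distr uniform_sphere borel uminus. f x)"
    by (simp add: uniform_sphere_uminus)
  also have "\<dots> = - (LINT x|uniform_sphere. f x)" by (subst integral_distr) (auto simp: odd)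
  finally show ?thesis by simp
qed

text \<open>For a = \<alpha> this is the exponent of the stable law; a = 2 and a = 4 measure the
  error terms of the characteristic function.\<close>

definition sphere_moment :: "real \<Rightarrow> 'a::euclidean_space \<Rightarrow> real" where
  "sphere_moment a l = (LINT \<theta>|uniform_sphere. \<bar>l \<bullet> \<theta>\<bar> powr a)"

lemma inner_sphere_le: "AE \<theta> in uniform_sphere. \<bar>l \<bullet> \<theta>\<bar> \<le> norm (l :: 'a::euclidean_space)"
  using AE_uniform_sphere
proof eventually_elim
  fix \<theta> :: 'a assume "\<theta> \<in> sphere 0 1"
  then show "\<bar>l \<bullet> \<theta>\<bar> \<le> norm l" using Cauchy_Schwarz_ineq2[of l \<theta>] by simp
qed

lemma sphere_moment_integrable:
  assumes "0 \<le> a" shows "integrable uniform_sphere (\<lambda>\<theta>::'a::euclidean_space. \<bar>l \<bullet> \<theta>\<bar> powr a)"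
proof -
  interpret prob_space "uniform_sphere :: 'a measure" by (rule prob_space_uniform_sphere)
  show ?thesis
  proof (rule integrable_const_bound[where B="norm l powr a"])
    show "AE \<theta> in uniform_sphere. norm (\<bar>l \<bullet> \<theta>\<bar> powr a) \<le> norm l powr a"
      using inner_sphere_le[of l] by eventually_elim (use assms in \<open>auto intro: powr_mono2\<close>)
  qed measurable
qed

lemma sphere_moment_nonneg: "0 \<le> sphere_moment a l"
  by (simp add: sphere_moment_def)

lemma sphere_moment_scale: "sphere_moment a (s *\<^sub>R l) = \<bar>s\<bar> powr a * sphere_moment a l"
  by (simp add: sphere_moment_def abs_mult powr_mult)

lemma nn_integral_sphere_moment:
  "0 \<le> a \<Longrightarrow> (\<integral>\<^sup>+\<theta>. ennreal (\<bar>l \<bullet> \<theta>\<bar> powr a) \<partial>uniform_sphere) = ennreal (sphere_moment a l)"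
  unfolding sphere_moment_def by (intro nn_integral_eq_integral sphere_moment_integrable) auto

lemma nn_integral_sphere_moment_cmult:
  assumes "0 \<le> c" "0 \<le> a"
  shows "(\<integral>\<^sup>+\<theta>. ennreal c * ennreal (\<bar>l \<bullet> \<theta>\<bar> powr a) \<partial>uniform_sphere) = ennreal (c * sphere_moment a l)"
  unfolding ennreal_mult'[OF assms(1)] nn_integral_sphere_moment[OF assms(2), symmetric]
  by (rule nn_integral_cmult) measurable

text \<open>By the symmetry of the uniform distribution the skewness terms of the stable exponent
  cancel.\<close>

lemma stable_exponent_uniform:
  fixes l :: "'a::euclidean_space"
  assumes \<alpha>: "0 < \<alpha>"
  shows "(CLINT \<theta>:sphere 0 1|uniform_sphere. stable_exponent \<alpha> (l \<bullet> \<theta>)) = complex_of_real (sphere_moment \<alpha> l)"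
proof -
  \<comment> \<open>Imaginary part of the stable exponent, an odd function of t.\<close>
  define v where "v t = (if \<alpha> = 1 then 2 / pi * (t * ln \<bar>t\<bar>) else - (sgn t * \<bar>t\<bar> powr \<alpha> * tan (pi * \<alpha> / 2)))" for t :: real
  have [measurable]: "v \<in> borel_measurable borel" unfolding v_def[abs_def] sgn_real_def by measurable
  have e: "stable_exponent \<alpha> t = complex_of_real (\<bar>t\<bar> powr \<alpha>) + \<i> * complex_of_real (v t)" for t
  proof (cases "\<alpha> = 1")
    case True
    have "\<bar>t\<bar> * (2 / pi * sgn t * ln \<bar>t\<bar>) = 2 / pi * ((\<bar>t\<bar> * sgn t) * ln \<bar>t\<bar>)" by simp
    also have "\<dots> = v t" using True by (simp only: abs_mult_sgn v_def simp_thms if_True)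
    finally have v: "v t = \<bar>t\<bar> * (2 / pi * sgn t * ln \<bar>t\<bar>)" by simp
    show ?thesis unfolding v of_real_mult using True by (simp add: stable_exponent_def algebra_simps)
  next
    case False then show ?thesis by (simp add: stable_exponent_def v_def algebra_simps)
  qed
  have odd: "(LINT \<theta>|uniform_sphere. v (l \<bullet> \<theta>)) = 0"
    by (rule sphere_integral_odd) (auto simp: v_def sgn_if)
  have iv: "integrable uniform_sphere (\<lambda>\<theta>. v (l \<bullet> \<theta>))"
  proof -
    interpret prob_space "uniform_sphere :: 'a measure" by (rule prob_space_uniform_sphere)
    \<comment> \<open>Boundedness on |t| \<le> |l| gives integrability. For \<alpha> = 1 the product
      u ln u is controlled, near 0 and for large u, by ln x \<le> x - 1 at x = u and x =
      1/u.\<close>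
    have "\<exists>B. \<forall>t. \<bar>t\<bar> \<le> norm l \<longrightarrow> \<bar>v t\<bar> \<le> B"
    proof (cases "\<alpha> = 1")
      case True
      have b: "\<bar>t * ln \<bar>t\<bar>\<bar> \<le> 1 + norm l * norm l" if t: "\<bar>t\<bar> \<le> norm l" for t :: real
      proof (cases "t = 0")
        case False
        define u where "u = \<bar>t\<bar>"
        have u: "0 < u" "u \<le> norm l" using False t by (auto simp: u_def)
        have "ln u \<le> u - 1" "ln (1 / u) \<le> 1 / u - 1" using u by (auto intro: ln_le_minus_one)
        then have "u * ln u \<le> u * (u - 1)" "u * ln (1 / u) \<le> u * (1 / u - 1)" using u by (auto intro: mult_left_mono)
        moreover have "ln (1 / u) = - ln u" "u * (u - 1) = u * u - u" "u * (1 / u - 1) = 1 - u"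
          using u by (simp_all add: ln_div right_diff_distrib)
        ultimately have "\<bar>u * ln u\<bar> \<le> 1 + u * u" 
          using u zero_le_square[of u] mult_minus_right[of u "ln u"] by (simp only: abs_le_iff) linarith
        also have "\<dots> \<le> 1 + norm l * norm l" using u by (intro add_left_mono mult_mono) auto
        finally show ?thesis by (simp add: u_def abs_mult)
      qed simp
      have "\<bar>v t\<bar> \<le> 2 / pi * (1 + norm l * norm l)" if "\<bar>t\<bar> \<le> norm l" for t
      proof -
        have "\<bar>v t\<bar> = 2 / pi * \<bar>t * ln \<bar>t\<bar>\<bar>" using True by (simp add: v_def abs_mult)
        also have "\<dots> \<le> 2 / pi * (1 + norm l * norm l)" using b[OF that] by (intro mult_left_mono) auto
        finally show ?thesis .
      qed
      then show ?thesis by blast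
    next
      case False
      have "\<bar>v t\<bar> \<le> norm l powr \<alpha> * \<bar>tan (pi * \<alpha> / 2)\<bar>" if "\<bar>t\<bar> \<le> norm l" for t
        using that False \<alpha> powr_mono2[of \<alpha> "\<bar>t\<bar>" "norm l"] by (auto simp: v_def abs_mult sgn_if intro!: mult_right_mono)
      then show ?thesis by blast
    qed
    then obtain B where B: "\<And>t. \<bar>t\<bar> \<le> norm l \<Longrightarrow> \<bar>v t\<bar> \<le> B" by blast
    show ?thesis
    proof (rule integrable_const_bound[where B=B])
      show "AE \<theta> in uniform_sphere. norm (v (l \<bullet> \<theta>)) \<le> B"
        using inner_sphere_le[of l] by eventually_elim (use B in auto)
    qed measurable
  qed
  have "(CLINT \<theta>:sphere 0 1|uniform_sphere. stable_exponent \<alpha> (l \<bullet> \<theta>)) = (CLINT \<theta>|uniform_sphere. stable_exponent \<alpha> (l \<bullet> \<theta>))"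
    unfolding set_lebesgue_integral_def
  proof (rule integral_cong_AE)
    show "AE \<theta> in uniform_sphere. indicat_real (sphere 0 1) \<theta> *\<^sub>R stable_exponent \<alpha> (l \<bullet> \<theta>) = stable_exponent \<alpha> (l \<bullet> \<theta>)"
      using AE_uniform_sphere by eventually_elim (simp add: indicator_def)
  next
    have [measurable]: "(\<lambda>\<theta>. stable_exponent \<alpha> (l \<bullet> \<theta>)) \<in> borel_measurable uniform_sphere"
      unfolding e measurable_cong_sets[OF sets_uniform_sphere refl] by measurable
    have [measurable]: "sphere (0 :: 'a) 1 \<in> sets borel" by auto
    show "(\<lambda>\<theta>. indicat_real (sphere 0 1) \<theta> *\<^sub>R stable_exponent \<alpha> (l \<bullet> \<theta>)) \<in> borel_measurable uniform_sphere"
      by measurable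
    show "(\<lambda>\<theta>. stable_exponent \<alpha> (l \<bullet> \<theta>)) \<in> borel_measurable uniform_sphere" by measurable
  qed
  also have "\<dots> = complex_of_real (sphere_moment \<alpha> l)"
    unfolding e using sphere_moment_integrable[of \<alpha> l] \<alpha> odd iv
    by (simp add: sphere_moment_def del: of_real_mult)
  finally show ?thesis .
qed

text \<open>The description in \<open>stable_law\<close> is definite because
  \<open>char_unique_euclidean\<close> gives uniqueness; existence is witnessed by Q, in the
  application the limit of the normalised sums.\<close>

lemma stable_law_eqI:
  fixes Q :: "'a::euclidean_space measure"
  assumes \<alpha>: "0 < \<alpha>" and Q: "prob_space Q" "sets Q = sets borel"
    and c: "\<And>l. (LINT y|Q. cos (l \<bullet> y)) = exp (- sphere_moment \<alpha> l)" "\<And>l. (LINT y|Q. sin (l \<bullet> y)) = 0"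
  shows "stable_law \<alpha> uniform_sphere = Q"
proof -
  have ch: "(CLINT y|R. iexp (l \<bullet> y)) = Complex (LINT y|R. cos (l \<bullet> y)) (LINT y|R. sin (l \<bullet> y))"
    if "prob_space R" "sets R = sets borel" for R :: "'a measure" and l
    using that by (intro iexp_integral) (auto simp: prob_space_def measurable_cong_sets[OF that(2) refl])
  have rhs: "exp (- (CLINT \<theta>:sphere 0 1|uniform_sphere. stable_exponent \<alpha> (l \<bullet> \<theta>))) = Complex (exp (- sphere_moment \<alpha> l)) 0" for l :: 'a
    unfolding stable_exponent_uniform[OF \<alpha>] by (simp add: complex_eq_iff Re_exp Im_exp)
  show ?thesis
    unfolding stable_law_def
  proof (rule the_equality)
    show "prob_space Q \<and> sets Q = sets borel \<and> (\<forall>l. (CLINT y|Q. iexp (l \<bullet> y)) =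
        exp (- (CLINT \<theta>:sphere 0 1|uniform_sphere. stable_exponent \<alpha> (l \<bullet> \<theta>))))"
      using Q c by (simp only: rhs ch[OF Q]) simp
    fix R :: "'a measure"
    assume R: "prob_space R \<and> sets R = sets borel \<and> (\<forall>l. (CLINT y|R. iexp (l \<bullet> y)) =
        exp (- (CLINT \<theta>:sphere 0 1|uniform_sphere. stable_exponent \<alpha> (l \<bullet> \<theta>))))"
    then have R1: "prob_space R" "sets R = sets borel" by auto
    from R have "Complex (LINT y|R. cos (l \<bullet> y)) (LINT y|R. sin (l \<bullet> y)) = Complex (exp (- sphere_moment \<alpha> l)) 0" for l
      by (simp only: rhs ch[OF R1])
    then show "R = Q" using R1 Q c by (intro char_unique_euclidean) auto
  qed
qed

context pareto
begin

text \<open>Exponent before normalisation, the leading term of 1 - \<phi> near 0. Dividing the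
  argument by \<sigma> n^(1/\<alpha>) turns it into \<open>sphere_moment \<alpha> l\<close> /
  n.\<close>

definition stable_psi :: "'a \<Rightarrow> real" where "stable_psi l = stable_scale 1 \<alpha> powr \<alpha> * sphere_moment \<alpha> l"

lemma stable_psi_nonneg: "0 \<le> stable_psi l"
  by (simp add: stable_psi_def sphere_moment_nonneg)

text \<open>In polar coordinates 1 - \<phi> is the integral of the stable exponent restricted to
  radii r \<ge> 1. Adding the radii below 1 completes it to \<open>stable_psi\<close> exactly, so
  the error is the average of \<open>levy_small\<close> and inherits its quadratic and quartic
  bounds.\<close>

lemma phi_expansion:
  fixes l :: 'a
  shows "1 - \<phi> l \<le> stable_psi l" "0 \<le> 1 - \<phi> l"
    "stable_psi l - (1 - \<phi> l) \<le> \<alpha> / (2 * (2 - \<alpha>)) * sphere_moment 2 l"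
    "\<alpha> / (2 * (2 - \<alpha>)) * sphere_moment 2 l - \<alpha> / (24 * (4 - \<alpha>)) * sphere_moment 4 l \<le> stable_psi l - (1 - \<phi> l)"
proof -
  have int: "integrable lborel (\<lambda>y. p y * (1 - cos (l \<bullet> y)))"
    by (rule integrable_mult_bdd[OF p_integrable, where B=2]) (auto simp: abs_le_iff intro: order_trans[OF cos_ge_minus_one[THEN le_imp_neg_le]])
  have "(LINT y|lborel. p y * (1 - cos (l \<bullet> y))) = (LINT y|lborel. p y - p y * cos (l \<bullet> y))"
    by (simp add: right_diff_distrib)
  also have "\<dots> = 1 - \<phi> l"
    unfolding \<phi>_def using p_integrable integral_p
    by (subst Bochner_Integration.integral_diff) (auto intro!: integrable_mult_bdd[OF p_integrable, where B=1])
  finally have ph: "(LINT y|lborel. p y * (1 - cos (l \<bullet> y))) = 1 - \<phi> l" .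
  show nn: "0 \<le> 1 - \<phi> l" unfolding ph[symmetric] using p_nonneg by (intro integral_nonneg_AE) auto
  define b where "b = (\<integral>\<^sup>+\<theta>. levy_small \<alpha> (l \<bullet> \<theta>) \<partial>(uniform_sphere :: 'a measure))"
  have [measurable]: "levy_small \<alpha> \<in> borel_measurable borel"
    unfolding levy_small_def[abs_def] by measurable
  have lm: "(\<lambda>\<theta>. \<integral>\<^sup>+r. ennreal (levy_integrand \<alpha> (l \<bullet> \<theta>) r) * indicator {1..} r \<partial>lborel) \<in> borel_measurable (uniform_sphere :: 'a measure)"
    by measurable
  have "ennreal (1 - \<phi> l) = (\<integral>\<^sup>+y. ennreal (p y * (1 - cos (l \<bullet> y))) \<partial>lborel)"
    unfolding ph[symmetric] using p_nonneg int by (intro nn_integral_eq_integral[symmetric]) auto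
  also have "\<dots> = (\<integral>\<^sup>+y. ennreal (p y) * ennreal (1 - cos (l \<bullet> y)) \<partial>lborel)"
    using p_nonneg by (intro nn_integral_cong) (simp add: ennreal_mult)
  also have "\<dots> = (\<integral>\<^sup>+\<theta>. (\<integral>\<^sup>+r. ennreal (\<alpha> * r powr (- 1 - \<alpha>) * indicator {1..} r) * ennreal (1 - cos (l \<bullet> (r *\<^sub>R \<theta>))) \<partial>lborel) \<partial>uniform_sphere)"
    by (rule nn_integral_pareto) measurable
  also have "\<dots> = (\<integral>\<^sup>+\<theta>. (\<integral>\<^sup>+r. ennreal (levy_integrand \<alpha> (l \<bullet> \<theta>) r) * indicator {1..} r \<partial>lborel) \<partial>uniform_sphere)"
    using \<alpha> by (intro nn_integral_cong) (auto simp: indicator_def levy_integrand_def ennreal_mult[symmetric] mult_ac)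
  finally have a: "ennreal (1 - \<phi> l) = (\<integral>\<^sup>+\<theta>. (\<integral>\<^sup>+r. ennreal (levy_integrand \<alpha> (l \<bullet> \<theta>) r) * indicator {1..} r \<partial>lborel) \<partial>uniform_sphere)" .
  have "ennreal (1 - \<phi> l) + b = (\<integral>\<^sup>+\<theta>. (\<integral>\<^sup>+r. ennreal (levy_integrand \<alpha> (l \<bullet> \<theta>) r) * indicator {1..} r \<partial>lborel) + levy_small \<alpha> (l \<bullet> \<theta>) \<partial>uniform_sphere)"
    unfolding a b_def using lm by (intro nn_integral_add[symmetric]) auto
  also have "\<dots> = (\<integral>\<^sup>+\<theta>. ennreal (stable_scale 1 \<alpha> powr \<alpha>) * ennreal (\<bar>l \<bullet> \<theta>\<bar> powr \<alpha>) \<partial>uniform_sphere)"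
    by (simp only: levy_split[OF \<alpha>, symmetric] nn_integral_levy[OF \<alpha>]) (simp add: ennreal_mult)
  also have "\<dots> = ennreal (stable_psi l)"
    unfolding stable_psi_def using \<alpha> by (intro nn_integral_sphere_moment_cmult) auto
  finally have sum: "ennreal (1 - \<phi> l) + b = ennreal (stable_psi l)" .
  have pw: "x\<^sup>2 = \<bar>x\<bar> powr 2" "x ^ 4 = \<bar>x\<bar> powr 4" for x :: real
    by (simp_all add: powr_numeral)
  have c12: "0 \<le> \<alpha> / (2 * (2 - \<alpha>))" "0 \<le> \<alpha> / (24 * (4 - \<alpha>))" using \<alpha> by auto
  have sle: "levy_small \<alpha> t \<le> ennreal (\<alpha> / (2 * (2 - \<alpha>))) * ennreal (\<bar>t\<bar> powr 2)" for t
    using levy_small_le[OF \<alpha>, of t] unfolding pw ennreal_mult'[OF c12(1)] .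
  have sge: "ennreal (\<alpha> / (2 * (2 - \<alpha>))) * ennreal (\<bar>t\<bar> powr 2) \<le>
      levy_small \<alpha> t + ennreal (\<alpha> / (24 * (4 - \<alpha>))) * ennreal (\<bar>t\<bar> powr 4)" for t
    using levy_small_ge[OF \<alpha>, of t] unfolding pw ennreal_mult'[OF c12(1)] ennreal_mult'[OF c12(2)] .
  have "b \<le> (\<integral>\<^sup>+\<theta>. ennreal (\<alpha> / (2 * (2 - \<alpha>))) * ennreal (\<bar>l \<bullet> \<theta>\<bar> powr 2) \<partial>uniform_sphere)"
    unfolding b_def by (intro nn_integral_mono sle)
  also have "\<dots> = ennreal (\<alpha> / (2 * (2 - \<alpha>)) * sphere_moment 2 l)"
    using c12 by (intro nn_integral_sphere_moment_cmult) auto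
  finally have bl: "b \<le> ennreal (\<alpha> / (2 * (2 - \<alpha>)) * sphere_moment 2 l)" .
  have "ennreal (\<alpha> / (2 * (2 - \<alpha>)) * sphere_moment 2 l) = (\<integral>\<^sup>+\<theta>. ennreal (\<alpha> / (2 * (2 - \<alpha>))) * ennreal (\<bar>l \<bullet> \<theta>\<bar> powr 2) \<partial>uniform_sphere)"
    using c12 by (intro nn_integral_sphere_moment_cmult[symmetric]) auto
  also have "\<dots> \<le> (\<integral>\<^sup>+\<theta>. levy_small \<alpha> (l \<bullet> \<theta>) + ennreal (\<alpha> / (24 * (4 - \<alpha>))) * ennreal (\<bar>l \<bullet> \<theta>\<bar> powr 4) \<partial>uniform_sphere)"
    by (intro nn_integral_mono sge)
  also have "\<dots> = b + (\<integral>\<^sup>+\<theta>. ennreal (\<alpha> / (24 * (4 - \<alpha>))) * ennreal (\<bar>l \<bullet> \<theta>\<bar> powr 4) \<partial>uniform_sphere)"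
    unfolding b_def by (rule nn_integral_add) auto
  also have "(\<integral>\<^sup>+\<theta>. ennreal (\<alpha> / (24 * (4 - \<alpha>))) * ennreal (\<bar>l \<bullet> \<theta>\<bar> powr 4) \<partial>uniform_sphere) = ennreal (\<alpha> / (24 * (4 - \<alpha>)) * sphere_moment 4 l)"
    using c12 by (intro nn_integral_sphere_moment_cmult) auto
  finally have bu: "ennreal (\<alpha> / (2 * (2 - \<alpha>)) * sphere_moment 2 l) \<le> b + ennreal (\<alpha> / (24 * (4 - \<alpha>)) * sphere_moment 4 l)" .
  have "b < top" using bl le_less_trans[OF _ ennreal_less_top] by blast
  then obtain b' where b': "b = ennreal b'" "0 \<le> b'" by (cases b) auto
  have n: "0 \<le> \<alpha> / (2 * (2 - \<alpha>)) * sphere_moment 2 l" "0 \<le> \<alpha> / (24 * (4 - \<alpha>)) * sphere_moment 4 l"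
    using \<alpha> sphere_moment_nonneg[of 2 l] sphere_moment_nonneg[of 4 l] by auto
  have s': "1 - \<phi> l + b' = stable_psi l"
    using sum nn b' stable_psi_nonneg[of l] by (simp add: ennreal_plus[symmetric] del: ennreal_plus)
  show "1 - \<phi> l \<le> stable_psi l" using s' b' by simp
  show "stable_psi l - (1 - \<phi> l) \<le> \<alpha> / (2 * (2 - \<alpha>)) * sphere_moment 2 l"
    using bl n s' b' by (simp add: ennreal_le_iff)
  show "\<alpha> / (2 * (2 - \<alpha>)) * sphere_moment 2 l - \<alpha> / (24 * (4 - \<alpha>)) * sphere_moment 4 l \<le> stable_psi l - (1 - \<phi> l)"
    using bu n s' b' by (simp add: ennreal_plus[symmetric] ennreal_le_iff del: ennreal_plus)
qed

end

lemma exp_minus_bounds: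
  fixes z :: real assumes "0 \<le> z"
  shows "exp (- z) \<le> 1 - z + z\<^sup>2 / 2" "1 - z + z\<^sup>2 / 2 - z ^ 3 / 6 \<le> exp (- z)"
proof -
  have u: "exp (- z) \<le> 1 - z + z\<^sup>2 / 2" if "0 \<le> z" for z :: real
  proof -
    have "(\<lambda>z. 1 - z + z\<^sup>2 / 2 - exp (- z)) 0 \<le> (\<lambda>z. 1 - z + z\<^sup>2 / 2 - exp (- z)) z"
    proof (rule DERIV_nonneg_imp_nondecreasing[OF that])
      fix x :: real
      show "\<exists>y. ((\<lambda>z. 1 - z + z\<^sup>2 / 2 - exp (- z)) has_real_derivative y) (at x) \<and> 0 \<le> y"
        by (rule exI[of _ "- 1 + x + exp (- x)"], safe, (auto intro!: derivative_eq_intros)[1]) (use exp_ge_add_one_self[of "- x"] in simp)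
    qed
    then show ?thesis by simp
  qed
  show "exp (- z) \<le> 1 - z + z\<^sup>2 / 2" by (rule u[OF assms])
  have "(\<lambda>z. exp (- z) - (1 - z + z\<^sup>2 / 2 - z ^ 3 / 6)) 0 \<le> (\<lambda>z. exp (- z) - (1 - z + z\<^sup>2 / 2 - z ^ 3 / 6)) z"
  proof (rule DERIV_nonneg_imp_nondecreasing[OF assms])
    fix x :: real assume "0 \<le> x"
    show "\<exists>y. ((\<lambda>z. exp (- z) - (1 - z + z\<^sup>2 / 2 - z ^ 3 / 6)) has_real_derivative y) (at x) \<and> 0 \<le> y"
      by (rule exI[of _ "- exp (- x) + 1 - x + x\<^sup>2 / 2"], safe, (auto intro!: derivative_eq_intros)[1]) (use u[OF \<open>0 \<le> x\<close>] in simp)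
  qed
  then show "1 - z + z\<^sup>2 / 2 - z ^ 3 / 6 \<le> exp (- z)" by simp
qed

section \<open>Lower bound\<close>

text \<open>Coordinates of a standard Gaussian vector, which serves to average over directions with
  computable moments.\<close>

definition gauss_coords :: "('a::euclidean_space \<Rightarrow> real) measure" where
  "gauss_coords = PiM Basis (\<lambda>_. density lborel std_normal_density)"

text \<open>Rotation invariance of the Gaussian: independent normals with coefficients of square sum
  1 add up to a standard normal.\<close>

lemma gauss_linear_form:
  fixes \<theta> :: "'a::euclidean_space"
  assumes \<theta>: "norm \<theta> = 1"
  shows "distributed gauss_coords lborel (\<lambda>\<omega>. (\<Sum>b\<in>Basis. \<omega> b *\<^sub>R b) \<bullet> \<theta>) std_normal_density"
proof -
  interpret S: prob_space "density lborel std_normal_density" by (rule prob_space_normal_density) simp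
  interpret product_prob_space "\<lambda>_::'a. density lborel std_normal_density" Basis ..
  interpret G: prob_space "gauss_coords :: ('a \<Rightarrow> real) measure" unfolding gauss_coords_def by (rule prob_space_PiM) (rule S.prob_space_axioms)
  have comp: "distr gauss_coords borel (\<lambda>\<omega>. \<omega> b) = density lborel std_normal_density" if "b \<in> Basis" for b :: 'a
    using PiM_component[OF that] by (simp add: gauss_coords_def cong: distr_cong)
  have rv: "G.random_variable borel (\<lambda>\<omega>. \<omega> b)" if "b \<in> Basis" for b :: 'a
    using that unfolding gauss_coords_def by (auto cong: measurable_cong_sets)
  have "G.indep_vars (\<lambda>_. borel) (\<lambda>b \<omega>. \<omega> b) (Basis :: 'a set)"
  proof (subst G.indep_vars_iff_distr_eq_PiM')
    have "distr gauss_coords (PiM Basis (\<lambda>_::'a. borel)) (\<lambda>x. \<lambda>i\<in>Basis. x i) = distr gauss_coords gauss_coords (\<lambda>x. x)"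
      by (intro distr_cong) (auto simp: gauss_coords_def space_PiM intro!: sets_PiM_cong)
    also have "\<dots> = PiM Basis (\<lambda>i. distr gauss_coords borel (\<lambda>\<omega>. \<omega> i))"
      by (simp add: distr_id2 gauss_coords_def[symmetric] comp cong: PiM_cong)
    finally show "distr gauss_coords (PiM Basis (\<lambda>_::'a. borel)) (\<lambda>x. \<lambda>i\<in>Basis. x i) = PiM Basis (\<lambda>i. distr gauss_coords borel (\<lambda>\<omega>. \<omega> i))" .
  qed (use rv in auto)
  then have ind: "G.indep_vars (\<lambda>_. borel) (\<lambda>b \<omega>. (\<theta> \<bullet> b) * \<omega> b) (Basis :: 'a set)"
    by (rule G.indep_vars_compose2) auto
  \<comment> \<open>Coordinates with coefficient 0 are omitted, since a degenerate normal variable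
    has no density.\<close>
  define I where "I = {b \<in> Basis. \<theta> \<bullet> b \<noteq> 0}"
  have I: "finite I" "I \<noteq> {}"
  proof -
    have "\<theta> \<noteq> 0" using \<theta> by auto
    then show "finite I" "I \<noteq> {}" using euclidean_all_zero_iff[of \<theta>] by (auto simp: I_def)
  qed
  have "distributed gauss_coords lborel (\<lambda>\<omega>. \<Sum>b\<in>I. (\<theta> \<bullet> b) * \<omega> b) (normal_density (\<Sum>b\<in>I. 0) (sqrt (\<Sum>b\<in>I. \<bar>\<theta> \<bullet> b\<bar>\<^sup>2)))"
  proof (rule G.sum_indep_normal[OF I])
    show "G.indep_vars (\<lambda>_. borel) (\<lambda>b \<omega>. (\<theta> \<bullet> b) * \<omega> b) I"
      by (rule G.indep_vars_subset[OF ind]) (auto simp: I_def)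
    fix b assume b: "b \<in> I"
    then show "0 < \<bar>\<theta> \<bullet> b\<bar>" by (simp add: I_def)
    have "distributed gauss_coords lborel (\<lambda>\<omega>. \<omega> b) (normal_density 0 1)"
      using comp[of b] rv[of b] b by (simp add: distributed_def I_def cong: distr_cong)
    from G.normal_density_affine[OF this, of "\<theta> \<bullet> b" 0] b
    show "distributed gauss_coords lborel (\<lambda>\<omega>. (\<theta> \<bullet> b) * \<omega> b) (normal_density 0 \<bar>\<theta> \<bullet> b\<bar>)"
      by (simp add: I_def)
  qed
  moreover have "(\<Sum>b\<in>I. \<bar>\<theta> \<bullet> b\<bar>\<^sup>2) = 1"
  proof -
    have "(\<Sum>b\<in>I. \<bar>\<theta> \<bullet> b\<bar>\<^sup>2) = (\<Sum>b\<in>Basis. (\<theta> \<bullet> b)\<^sup>2)"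
      by (intro sum.mono_neutral_cong_left) (auto simp: I_def)
    also have "\<dots> = (norm \<theta>)\<^sup>2" by (simp add: norm_eq_sqrt_inner power2_eq_square euclidean_inner[of \<theta> \<theta>] sum_nonneg)
    finally show ?thesis using \<theta> by simp
  qed
  moreover have "(\<lambda>\<omega>. \<Sum>b\<in>I. (\<theta> \<bullet> b) * \<omega> b) = (\<lambda>\<omega>. (\<Sum>b\<in>Basis. \<omega> b *\<^sub>R b) \<bullet> \<theta>)"
  proof
    fix \<omega> :: "'a \<Rightarrow> real"
    have "(\<Sum>b\<in>I. (\<theta> \<bullet> b) * \<omega> b) = (\<Sum>b\<in>Basis. (\<theta> \<bullet> b) * \<omega> b)"
      by (intro sum.mono_neutral_left) (auto simp: I_def)
    then show "(\<Sum>b\<in>I. (\<theta> \<bullet> b) * \<omega> b) = (\<Sum>b\<in>Basis. \<omega> b *\<^sub>R b) \<bullet> \<theta>"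
      by (simp add: inner_sum_left inner_commute[of \<theta>] mult.commute)
  qed
  ultimately show ?thesis by simp
qed

text \<open>For \<open>\<alpha> = 1\<close> both error terms of the characteristic function are quadratic. They do not cancel
  in every direction, as one sees by averaging over a Gaussian direction.\<close>

lemma exists_noncancelling_direction:
  "\<exists>e :: 'a::euclidean_space. sphere_moment 2 e < (pi / 2 * sphere_moment 1 e)\<^sup>2"
proof (rule ccontr)
  assume "\<nexists>e :: 'a. sphere_moment 2 e < (pi / 2 * sphere_moment 1 e)\<^sup>2"
  then have le: "(pi / 2 * sphere_moment 1 e)\<^sup>2 \<le> sphere_moment 2 e" for e :: 'a by (simp add: not_less)
  \<comment> \<open>Linearised by 2 x \<le> 1 + x^2, so that averaging over e involves only the
    moments themselves.\<close>
  have le': "ennreal (pi / 2) * ennreal (sphere_moment 1 e) \<le> ennreal (1 / 2) + ennreal (1 / 2) * ennreal (sphere_moment 2 e)" for e :: 'a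
  proof -
    have "0 \<le> (pi / 2 * sphere_moment 1 e - 1)\<^sup>2" by simp
    then have "pi / 2 * sphere_moment 1 e \<le> 1 / 2 + 1 / 2 * sphere_moment 2 e"
      using le[of e] by (simp add: power2_diff)
    then have "ennreal (pi / 2 * sphere_moment 1 e) \<le> ennreal (1 / 2 + 1 / 2 * sphere_moment 2 e)" by (rule ennreal_leI)
    also have "\<dots> = ennreal (1 / 2) + ennreal (1 / 2 * sphere_moment 2 e)"
      by (intro ennreal_plus) (auto simp: sphere_moment_nonneg)
    finally show ?thesis by (simp only: ennreal_mult'[of "pi / 2"] ennreal_mult'[of "1 / 2"] pi_half_ge_zero)
  qed
  interpret S: prob_space "density lborel std_normal_density" by (rule prob_space_normal_density) simp
  interpret G: prob_space "gauss_coords :: ('a \<Rightarrow> real) measure" unfolding gauss_coords_def by (rule prob_space_PiM) (rule S.prob_space_axioms)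
  interpret U: prob_space "uniform_sphere :: 'a measure" by (rule prob_space_uniform_sphere)
  interpret P: pair_prob_space "gauss_coords :: ('a \<Rightarrow> real) measure" "uniform_sphere :: 'a measure" ..
  define e where "e \<omega> = (\<Sum>b\<in>Basis. \<omega> b *\<^sub>R b)" for \<omega> :: "'a \<Rightarrow> real"
  have [measurable]: "(\<lambda>\<omega>. \<omega> b) \<in> borel_measurable gauss_coords" if "b \<in> Basis" for b :: 'a
    using that unfolding gauss_coords_def by (auto cong: measurable_cong_sets)
  have em[measurable]: "e \<in> measurable gauss_coords borel" unfolding e_def[abs_def] by measurable
  have avg: "(\<integral>\<^sup>+\<omega>. ennreal (sphere_moment a (e \<omega>)) \<partial>gauss_coords) = ennreal m"
    if a: "0 \<le> a" and m: "has_bochner_integral lborel (\<lambda>x. std_normal_density x * \<bar>x\<bar> powr a) m" for a m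
  proof -
    have "(\<integral>\<^sup>+\<omega>. ennreal (sphere_moment a (e \<omega>)) \<partial>gauss_coords) = (\<integral>\<^sup>+\<omega>. (\<integral>\<^sup>+\<theta>. ennreal (\<bar>e \<omega> \<bullet> \<theta>\<bar> powr a) \<partial>uniform_sphere) \<partial>gauss_coords)"
      by (simp add: nn_integral_sphere_moment[OF a])
    also have "\<dots> = (\<integral>\<^sup>+\<theta>. (\<integral>\<^sup>+\<omega>. ennreal (\<bar>e \<omega> \<bullet> \<theta>\<bar> powr a) \<partial>gauss_coords) \<partial>uniform_sphere)"
      by (rule P.Fubini'[symmetric]) measurable
    also have "\<dots> = (\<integral>\<^sup>+\<theta>. ennreal m \<partial>(uniform_sphere :: 'a measure))"
    proof (rule nn_integral_cong_AE)
      show "AE \<theta> in uniform_sphere. (\<integral>\<^sup>+\<omega>. ennreal (\<bar>e \<omega> \<bullet> \<theta>\<bar> powr a) \<partial>gauss_coords) = ennreal m"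
        using AE_uniform_sphere
      proof eventually_elim
        fix \<theta> :: 'a assume "\<theta> \<in> sphere 0 1"
        then have \<theta>: "norm \<theta> = 1" by simp
        have "(\<integral>\<^sup>+\<omega>. ennreal (\<bar>e \<omega> \<bullet> \<theta>\<bar> powr a) \<partial>gauss_coords) = (\<integral>\<^sup>+x. ennreal (std_normal_density x) * ennreal (\<bar>x\<bar> powr a) \<partial>lborel)"
          unfolding e_def by (rule distributed_nn_integral[OF gauss_linear_form[OF \<theta>], of "\<lambda>x. ennreal (\<bar>x\<bar> powr a)", symmetric]) simp
        also have "\<dots> = (\<integral>\<^sup>+x. ennreal (std_normal_density x * \<bar>x\<bar> powr a) \<partial>lborel)"
          by (intro nn_integral_cong) (simp add: ennreal_mult)
        also have "\<dots> = ennreal m"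
          using m by (subst nn_integral_eq_integral) (auto simp: has_bochner_integral_iff)
        finally show "(\<integral>\<^sup>+\<omega>. ennreal (\<bar>e \<omega> \<bullet> \<theta>\<bar> powr a) \<partial>gauss_coords) = ennreal m" .
      qed
    qed
    finally show ?thesis by (simp add: U.emeasure_space_1)
  qed
  have a1: "(\<integral>\<^sup>+\<omega>. ennreal (sphere_moment 1 (e \<omega>)) \<partial>gauss_coords) = ennreal (sqrt (2 / pi))"
    by (rule avg) (use std_normal_moment_abs_odd[of 0] in simp_all)
  have a2: "(\<integral>\<^sup>+\<omega>. ennreal (sphere_moment 2 (e \<omega>)) \<partial>gauss_coords) = ennreal 1"
    by (rule avg) (use std_normal_moment_even[of 1] in \<open>simp_all add: powr_numeral\<close>)
  have [measurable]: "(\<lambda>\<omega>. sphere_moment a (e \<omega>)) \<in> borel_measurable gauss_coords" for a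
    unfolding sphere_moment_def by measurable
  \<comment> \<open>A standard normal N has E|N| = sqrt(2/pi) and E N^2 = 1, so averaging gives
    sqrt(pi/2) \<le> 1, which is false.\<close>
  have "ennreal (pi / 2) * ennreal (sqrt (2 / pi)) = (\<integral>\<^sup>+\<omega>. ennreal (pi / 2) * ennreal (sphere_moment 1 (e \<omega>)) \<partial>gauss_coords)"
    by (subst nn_integral_cmult) (auto simp: a1)
  also have "\<dots> \<le> (\<integral>\<^sup>+\<omega>. ennreal (1 / 2) + ennreal (1 / 2) * ennreal (sphere_moment 2 (e \<omega>)) \<partial>gauss_coords)"
    by (intro nn_integral_mono le')
  also have "\<dots> = ennreal (1 / 2) + ennreal (1 / 2) * ennreal 1"
    by (subst nn_integral_add, simp, simp, subst nn_integral_cmult) (auto simp: a2 G.emeasure_space_1)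
  also have "\<dots> = ennreal 1" unfolding ennreal_1 mult_1_right by (subst ennreal_plus[symmetric]) auto
  finally have "ennreal (pi / 2 * sqrt (2 / pi)) \<le> ennreal 1"
    by (simp only: ennreal_mult'[of "pi / 2"] pi_half_ge_zero)
  then have "pi / 2 * sqrt (2 / pi) \<le> 1" by (subst (asm) ennreal_le_iff) simp
  then have "(pi / 2 * sqrt (2 / pi))\<^sup>2 \<le> 1\<^sup>2" by (intro power_mono) auto
  moreover have "(pi / 2 * sqrt (2 / pi))\<^sup>2 = pi / 2"
  proof -
    have "(sqrt (2 / pi))\<^sup>2 = 2 / pi" by simp
    then show ?thesis by (simp only: power_mult_distrib) (simp add: power2_eq_square)
  qed
  ultimately have "pi / 2 \<le> 1" by simp
  then show False using pi_gt3 by simp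
qed

text \<open>Factoring a - b out of a^n - b^n leaves n terms a^i b^(n-1-i), each at least m^(n-1)
  \<ge> m^n for m \<le> 1.\<close>

lemma power_diff_ge:
  fixes a b m :: real
  assumes m: "0 \<le> m" "m \<le> 1" "m \<le> a" "m \<le> b"
  shows "real n * m ^ n * \<bar>a - b\<bar> \<le> \<bar>a ^ n - b ^ n\<bar>"
proof -
  have *: "real n * m ^ n * (a - b) \<le> a ^ n - b ^ n" if "b \<le> a" "m \<le> b" for a b
  proof (induction n)
    case (Suc n)
    have a: "m \<le> a" using that by simp
    have "real (Suc n) * m ^ Suc n * (a - b) = m * (real n * m ^ n * (a - b)) + m * m ^ n * (a - b)"
      by (simp add: algebra_simps)
    also have "\<dots> \<le> a * (a ^ n - b ^ n) + 1 * b ^ n * (a - b)"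
    proof (intro add_mono mult_right_mono mult_mono)
      show "real n * m ^ n * (a - b) \<le> a ^ n - b ^ n" by (rule Suc)
      show "m ^ n \<le> b ^ n" using that m by (intro power_mono) auto
    qed (use a m that in \<open>auto intro!: mult_nonneg_nonneg\<close>)
    also have "\<dots> = a ^ Suc n - b ^ Suc n" by (simp add: algebra_simps)
    finally show ?case .
  qed simp
  show ?thesis
  proof (cases "b \<le> a")
    case True
    then have "b ^ n \<le> a ^ n" using m by (intro power_mono) auto
    then show ?thesis using *[of b a] True m by simp
  next
    case False
    then have "a ^ n \<le> b ^ n" using m by (intro power_mono) auto
    then show ?thesis using *[of a b] False m by simp
  qed
qed

section \<open>Limit of the characteristic functions and the gap at finite n\<close>

lemma at_right_0_lower:
  fixes f :: "real \<Rightarrow> real"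
  assumes "(f \<longlongrightarrow> b) (at_right 0)" "0 < b"
  shows "\<exists>s0>0. \<forall>s. 0 < s \<and> s \<le> s0 \<longrightarrow> b / 2 \<le> f s"
proof -
  have "eventually (\<lambda>s. b / 2 < f s) (at_right 0)" using assms by (intro order_tendstoD) auto
  then obtain c where "c > 0" "\<And>s. 0 < s \<Longrightarrow> s < c \<Longrightarrow> b / 2 < f s" by (auto simp: eventually_at_right_field)
  then show ?thesis by (intro exI[of _ "c / 2"]) (auto intro!: less_imp_le)
qed

lemma powr_at_right_0: "0 < a \<Longrightarrow> ((\<lambda>s. s powr a) \<longlongrightarrow> 0) (at_right (0::real))"
  by (rule tendsto_zero_powrI[OF _ tendsto_const]) (auto simp: eventually_at_right_field intro!: exI[of _ 1] tendsto_ident_at)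

context pareto
begin

lemma stable_psi_scale: "0 \<le> s \<Longrightarrow> stable_psi (s *\<^sub>R l) = s powr \<alpha> * stable_psi l"
  by (simp add: stable_psi_def sphere_moment_scale)

text \<open>Passes from a positive second moment to a positive moment of order \<alpha>, that is, to
  a direction in which the stable exponent does not vanish.\<close>

lemma sphere_moment_2_le: "sphere_moment 2 e \<le> norm e powr (2 - \<alpha>) * sphere_moment \<alpha> (e :: 'a)"
proof -
  have "sphere_moment 2 e \<le> (LINT \<theta>|uniform_sphere. norm e powr (2 - \<alpha>) * \<bar>e \<bullet> \<theta>\<bar> powr \<alpha>)"
    unfolding sphere_moment_def
  proof (rule integral_mono_AE)
    show "AE \<theta> in uniform_sphere. \<bar>e \<bullet> \<theta>\<bar> powr 2 \<le> norm e powr (2 - \<alpha>) * \<bar>e \<bullet> \<theta>\<bar> powr \<alpha>"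
      using inner_sphere_le[of e]
    proof eventually_elim
      fix \<theta> assume "\<bar>e \<bullet> \<theta>\<bar> \<le> norm e"
      then have "\<bar>e \<bullet> \<theta>\<bar> powr (2 - \<alpha>) * \<bar>e \<bullet> \<theta>\<bar> powr \<alpha> \<le> norm e powr (2 - \<alpha>) * \<bar>e \<bullet> \<theta>\<bar> powr \<alpha>"
        using \<alpha> by (intro mult_right_mono powr_mono2) auto
      then show "\<bar>e \<bullet> \<theta>\<bar> powr 2 \<le> norm e powr (2 - \<alpha>) * \<bar>e \<bullet> \<theta>\<bar> powr \<alpha>"
        by (simp flip: powr_add)
    qed
    show "integrable uniform_sphere (\<lambda>\<theta>. \<bar>e \<bullet> \<theta>\<bar> powr 2)" by (rule sphere_moment_integrable) simp
    show "integrable uniform_sphere (\<lambda>\<theta>. norm e powr (2 - \<alpha>) * \<bar>e \<bullet> \<theta>\<bar> powr \<alpha>)"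
      using \<alpha> by (intro integrable_mult_right sphere_moment_integrable) simp
  qed
  then show ?thesis by (simp add: sphere_moment_def)
qed

lemma phi_le_1: "\<bar>\<phi> l\<bar> \<le> 1"
proof -
  have i: "integrable lborel (\<lambda>y. p y * cos (l \<bullet> y))" by (auto intro!: integrable_mult_bdd[OF p_integrable, where B=1])
  have "\<bar>\<phi> l\<bar> \<le> (LINT y|lborel. \<bar>p y * cos (l \<bullet> y)\<bar>)" unfolding \<phi>_def by (rule integral_abs_bound)
  also have "\<dots> \<le> (LINT y|lborel. p y)"
    using p_nonneg by (intro integral_mono integrable_abs i p_integrable) (auto simp: abs_mult intro!: mult_left_le)
  finally show ?thesis by (simp add: integral_p)
qed

text \<open>For factors of absolute value at most 1, n-th powers differ by at most n times the
  difference of the factors, here \<phi> and the exponential of minus \<open>stable_psi\<close>.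
  Times n, the quadratic error of \<phi> is of order n^(1 - 2/\<alpha>) and the square of the
  exponent of order 1/n; both tend to 0.\<close>

lemma phi_pow_limit:
  assumes \<sigma>: "\<sigma> = stable_scale 1 \<alpha>"
  shows "(\<lambda>n. \<phi> ((1 / (real n powr (1 / \<alpha>) * \<sigma>)) *\<^sub>R l) ^ n) \<longlonglongrightarrow> exp (- sphere_moment \<alpha> l)"
proof -
  have \<sigma>0: "0 < \<sigma>" using stable_scale_pos[OF \<alpha>] \<sigma> by simp
  define c where "c n = 1 / (real n powr (1 / \<alpha>) * \<sigma>)" for n
  define K where "K = \<alpha> / (2 * (2 - \<alpha>)) * sphere_moment 2 l / \<sigma>\<^sup>2"
  have z: "stable_psi (c n *\<^sub>R l) = sphere_moment \<alpha> l / real n" if "n \<ge> 1" for n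
  proof -
    have "c n powr \<alpha> = 1 / (real n * \<sigma> powr \<alpha>)"
      using that \<sigma>0 \<alpha> by (simp add: c_def powr_divide powr_mult powr_powr)
    then show ?thesis using \<sigma>0 by (simp add: stable_psi_scale c_def) (simp add: stable_psi_def \<sigma>[symmetric])
  qed
  have V: "real n * (\<alpha> / (2 * (2 - \<alpha>)) * sphere_moment 2 (c n *\<^sub>R l)) = K * real n powr (1 - 2 / \<alpha>)" if "n \<ge> 1" for n
  proof -
    have "(c n)\<^sup>2 = real n powr (- (2 / \<alpha>)) / \<sigma>\<^sup>2"
      using that by (simp add: c_def power_divide power_mult_distrib powr_power powr_minus_divide)
    moreover have "real n * real n powr (- (2 / \<alpha>)) = real n powr (1 - 2 / \<alpha>)"
      using that powr_add[of "real n" 1 "- (2 / \<alpha>)"] by simp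
    moreover have "sphere_moment 2 (c n *\<^sub>R l) = (c n)\<^sup>2 * sphere_moment 2 l"
      by (simp add: sphere_moment_scale powr_numeral)
    moreover have "real n * (A * (r / \<sigma>\<^sup>2 * S)) = A * S / \<sigma>\<^sup>2 * (real n * r)" for A r S :: real by simp
    ultimately show ?thesis unfolding K_def by simp
  qed
  have bound: "norm (\<phi> (c n *\<^sub>R l) ^ n - exp (- sphere_moment \<alpha> l)) \<le> K * real n powr (1 - 2 / \<alpha>) + (sphere_moment \<alpha> l)\<^sup>2 / 2 / real n"
    if n: "n \<ge> 1" for n
  proof -
    define x where "x = stable_psi (c n *\<^sub>R l)"
    have x0: "0 \<le> x" by (simp add: x_def stable_psi_nonneg)
    have "exp (- sphere_moment \<alpha> l) = exp (- x) ^ n"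
      using n z[OF n] by (simp add: x_def flip: exp_of_nat_mult)
    then have "norm (\<phi> (c n *\<^sub>R l) ^ n - exp (- sphere_moment \<alpha> l)) \<le> real n * norm (\<phi> (c n *\<^sub>R l) - exp (- x))"
      using norm_power_diff[of "\<phi> (c n *\<^sub>R l)" "exp (- x)" n] phi_le_1 x0 by simp
    also have "norm (\<phi> (c n *\<^sub>R l) - exp (- x)) \<le> \<alpha> / (2 * (2 - \<alpha>)) * sphere_moment 2 (c n *\<^sub>R l) + x\<^sup>2 / 2"
      using phi_expansion(1,3)[of "c n *\<^sub>R l"] exp_minus_bounds(1)[OF x0] exp_ge_add_one_self[of "- x"]
      unfolding x_def[symmetric] by simp
    also have "real n * (\<alpha> / (2 * (2 - \<alpha>)) * sphere_moment 2 (c n *\<^sub>R l) + x\<^sup>2 / 2) = K * real n powr (1 - 2 / \<alpha>) + real n * (x\<^sup>2 / 2)"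
      using V[OF n] by (simp only: distrib_left)
    also have "real n * (x\<^sup>2 / 2) = (sphere_moment \<alpha> l)\<^sup>2 / 2 / real n"
      using n z[OF n] by (simp add: x_def power2_eq_square)
    finally show ?thesis by (simp add: mult_left_mono)
  qed
  have "(\<lambda>n. K * real n powr (1 - 2 / \<alpha>) + (sphere_moment \<alpha> l)\<^sup>2 / 2 / real n) \<longlonglongrightarrow> K * 0 + 0"
  proof (rule tendsto_add[OF tendsto_mult_left])
    show "(\<lambda>n. real n powr (1 - 2 / \<alpha>)) \<longlonglongrightarrow> 0"
      by (rule tendsto_neg_powr[OF _ filterlim_real_sequentially]) (use \<alpha> in \<open>simp add: field_simps\<close>)
    show "(\<lambda>n. (sphere_moment \<alpha> l)\<^sup>2 / 2 / real n) \<longlonglongrightarrow> 0" by (rule lim_const_over_n)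
  qed
  then have "(\<lambda>n. K * real n powr (1 - 2 / \<alpha>) + (sphere_moment \<alpha> l)\<^sup>2 / 2 / real n) \<longlonglongrightarrow> 0" by simp
  then have "(\<lambda>n. \<phi> (c n *\<^sub>R l) ^ n - exp (- sphere_moment \<alpha> l)) \<longlonglongrightarrow> 0"
    by (rule Lim_null_comparison[rotated]) (use bound in \<open>auto simp: eventually_at_top_linorder intro!: exI[of _ 1]\<close>)
  then show ?thesis unfolding c_def by (rule LIM_zero_cancel)
qed

text \<open>To the difference of \<phi> and the exponential, the missing small jumps contribute
  about c1 V s^2 and the second-order term of the exponential about -Z^2 s^(2 \<alpha>) / 2. The
  latter dominates for \<alpha> < 1, the former for \<alpha> > 1; for \<alpha> = 1 the orders
  agree.\<close>

lemma phi_exp_gap: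
  "\<exists>(e::'a) c s0. 0 < stable_psi e \<and> 0 < c \<and> 0 < s0 \<and>
     (\<forall>s. 0 < s \<and> s \<le> s0 \<longrightarrow> c * s powr min 2 (2 * \<alpha>) \<le> \<bar>\<phi> (s *\<^sub>R e) - exp (- stable_psi (s *\<^sub>R e))\<bar>)"
proof -
  define c1 c2 where "c1 = \<alpha> / (2 * (2 - \<alpha>))" and "c2 = \<alpha> / (24 * (4 - \<alpha>))"
  have c12: "0 < c1" "0 < c2" using \<alpha> by (auto simp: c1_def c2_def)
  have \<sigma>0: "0 < stable_scale 1 \<alpha>" using stable_scale_pos[OF \<alpha>] .
  \<comment> \<open>Chosen for the sake of \<alpha> = 1; for other \<alpha> the same direction
    serves through its positive moments.\<close>
  obtain d :: 'a where d: "sphere_moment 2 d < (pi / 2 * sphere_moment 1 d)\<^sup>2"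
    using exists_noncancelling_direction by blast
  have V0: "0 < sphere_moment 2 d"
  proof -
    have "sphere_moment 2 d \<noteq> 0"
    proof
      assume 0: "sphere_moment 2 d = 0"
      have "AE \<theta> in uniform_sphere. \<bar>d \<bullet> \<theta>\<bar> powr 2 = 0"
        using integral_nonneg_eq_0_iff_AE[OF sphere_moment_integrable[of 2 d]] 0 by (simp add: sphere_moment_def)
      then have "sphere_moment 1 d = (LINT \<theta>|(uniform_sphere :: 'a measure). 0)"
        unfolding sphere_moment_def by (intro integral_cong_AE) (auto elim!: eventually_mono)
      then show False using d 0 by simp
    qed
    then show ?thesis using sphere_moment_nonneg[of 2 d] by simp
  qed
  have Z0: "0 < stable_psi d"
  proof -
    have "0 < norm d powr (2 - \<alpha>) * sphere_moment \<alpha> d" using V0 sphere_moment_2_le[of d] by linarith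
    then have "0 < sphere_moment \<alpha> d" using sphere_moment_nonneg[of \<alpha> d] by (simp add: zero_less_mult_iff)
    then show ?thesis using \<sigma>0 by (simp add: stable_psi_def)
  qed
  define Z V W where "Z = stable_psi d" and "V = sphere_moment 2 d" and "W = sphere_moment 4 d"
  have VW: "0 < V" "0 \<le> W" "0 < Z" using V0 Z0 sphere_moment_nonneg[of 4 d] by (auto simp: V_def W_def Z_def)
  have sc: "stable_psi (s *\<^sub>R d) = s powr \<alpha> * Z" "sphere_moment 2 (s *\<^sub>R d) = s\<^sup>2 * V" "sphere_moment 4 (s *\<^sub>R d) = s ^ 4 * W" if "0 < s" for s
    using that by (auto simp: stable_psi_scale sphere_moment_scale Z_def V_def W_def powr_numeral)
  have lo: "(s powr \<alpha> * Z)\<^sup>2 / 2 - (s powr \<alpha> * Z) ^ 3 / 6 - c1 * (s\<^sup>2 * V) \<le> exp (- stable_psi (s *\<^sub>R d)) - \<phi> (s *\<^sub>R d)" if "0 < s" for s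
    using exp_minus_bounds(2)[OF stable_psi_nonneg[of "s *\<^sub>R d"]] phi_expansion(3)[of "s *\<^sub>R d"]
    unfolding sc[OF that] c1_def[symmetric] by simp
  have hi: "c1 * (s\<^sup>2 * V) - c2 * (s ^ 4 * W) - (s powr \<alpha> * Z)\<^sup>2 / 2 \<le> \<phi> (s *\<^sub>R d) - exp (- stable_psi (s *\<^sub>R d))" if "0 < s" for s
    using exp_minus_bounds(1)[OF stable_psi_nonneg[of "s *\<^sub>R d"]] phi_expansion(4)[of "s *\<^sub>R d"]
    unfolding sc[OF that] c1_def[symmetric] c2_def[symmetric] by simp
  \<comment> \<open>f is a lower bound of the gap divided by the dominant power of s; its positive
    limit b at 0 keeps it above b/2 on an interval.\<close>
  have "\<exists>f b. 0 < b \<and> (f \<longlongrightarrow> b) (at_right 0) \<and> (\<forall>s>0. f s * s powr min 2 (2 * \<alpha>) \<le> \<bar>\<phi> (s *\<^sub>R d) - exp (- stable_psi (s *\<^sub>R d))\<bar>)"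
  proof -
    consider "\<alpha> < 1" | "\<alpha> = 1" | "1 < \<alpha>" by linarith
    then show ?thesis
    proof cases
      case 1
      define f where "f s = Z\<^sup>2 / 2 - s powr \<alpha> * (Z ^ 3 / 6) - c1 * V * s powr (2 - 2 * \<alpha>)" for s
      have "(f \<longlongrightarrow> Z\<^sup>2 / 2 - 0 * (Z ^ 3 / 6) - c1 * V * 0) (at_right 0)"
        unfolding f_def using 1 \<alpha> by (intro tendsto_intros powr_at_right_0) auto
      moreover have "f s * s powr min 2 (2 * \<alpha>) \<le> \<bar>\<phi> (s *\<^sub>R d) - exp (- stable_psi (s *\<^sub>R d))\<bar>" if s: "0 < s" for s
      proof -
        have e2: "(s powr \<alpha>)\<^sup>2 = s powr (2 * \<alpha>)" by (simp add: power2_eq_square flip: powr_add)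
        have e3: "(s powr \<alpha>) ^ 3 = s powr \<alpha> * s powr (2 * \<alpha>)" by (simp add: power3_eq_cube flip: powr_add)
        have "s powr (2 - 2 * \<alpha>) * s powr (2 * \<alpha>) = s powr 2" by (simp flip: powr_add)
        then have "s\<^sup>2 = s powr (2 - 2 * \<alpha>) * s powr (2 * \<alpha>)" using s by (simp add: powr_numeral)
        with e2 e3 have "f s * s powr min 2 (2 * \<alpha>) = (s powr \<alpha> * Z)\<^sup>2 / 2 - (s powr \<alpha> * Z) ^ 3 / 6 - c1 * (s\<^sup>2 * V)"
          using 1 by (simp add: f_def power_mult_distrib) (simp add: algebra_simps)
        then show ?thesis using lo[OF s] by linarith
      qed
      ultimately show ?thesis using VW by (intro exI[of _ f] exI[of _ "Z\<^sup>2 / 2"]) auto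
    next
      case 2
      define f where "f s = Z\<^sup>2 / 2 - s powr 1 * (Z ^ 3 / 6) - c1 * V" for s
      have "(f \<longlongrightarrow> Z\<^sup>2 / 2 - 0 * (Z ^ 3 / 6) - c1 * V) (at_right 0)"
        unfolding f_def by (intro tendsto_intros powr_at_right_0) auto
      moreover have "f s * s powr min 2 (2 * \<alpha>) \<le> \<bar>\<phi> (s *\<^sub>R d) - exp (- stable_psi (s *\<^sub>R d))\<bar>" if s: "0 < s" for s
      proof -
        have "f s * s powr min 2 (2 * \<alpha>) = (s powr \<alpha> * Z)\<^sup>2 / 2 - (s powr \<alpha> * Z) ^ 3 / 6 - c1 * (s\<^sup>2 * V)"
          using 2 s by (simp add: f_def powr_numeral) (simp add: algebra_simps power2_eq_square power3_eq_cube)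
        then show ?thesis using lo[OF s] by linarith
      qed
      moreover have "0 < Z\<^sup>2 / 2 - c1 * V"
      proof -
        have "Z = pi / 2 * sphere_moment 1 d" unfolding Z_def stable_psi_def using 2 by (simp add: stable_scale_1)
        then have "V < Z\<^sup>2" using d by (simp only: V_def)
        then show ?thesis using 2 by (simp add: c1_def)
      qed
      ultimately show ?thesis by (intro exI[of _ f] exI[of _ "Z\<^sup>2 / 2 - c1 * V"]) auto
    next
      case 3
      define f where "f s = c1 * V - s powr 2 * (c2 * W) - s powr (2 * \<alpha> - 2) * (Z\<^sup>2 / 2)" for s
      have "(f \<longlongrightarrow> c1 * V - 0 * (c2 * W) - 0 * (Z\<^sup>2 / 2)) (at_right 0)"
        unfolding f_def using 3 by (intro tendsto_intros powr_at_right_0) auto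
      moreover have "f s * s powr min 2 (2 * \<alpha>) \<le> \<bar>\<phi> (s *\<^sub>R d) - exp (- stable_psi (s *\<^sub>R d))\<bar>" if s: "0 < s" for s
      proof -
        have "(s powr \<alpha>)\<^sup>2 = s powr (2 * \<alpha> - 2) * s powr 2" by (simp add: power2_eq_square flip: powr_add)
        then have "(s powr \<alpha>)\<^sup>2 = s powr (2 * \<alpha> - 2) * s\<^sup>2" "s powr 2 = s\<^sup>2" "s ^ 4 = s\<^sup>2 * s\<^sup>2"
          using s by (simp_all add: powr_numeral)
        then have "f s * s powr min 2 (2 * \<alpha>) = c1 * (s\<^sup>2 * V) - c2 * (s ^ 4 * W) - (s powr \<alpha> * Z)\<^sup>2 / 2"
          using 3 by (simp add: f_def power_mult_distrib) (simp add: algebra_simps)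
        then show ?thesis using hi[OF s] by linarith
      qed
      ultimately show ?thesis using VW c12 by (intro exI[of _ f] exI[of _ "c1 * V"]) auto
    qed
  qed
  then obtain f b where f: "0 < b" "(f \<longlongrightarrow> b) (at_right 0)"
     "\<And>s. 0 < s \<Longrightarrow> f s * s powr min 2 (2 * \<alpha>) \<le> \<bar>\<phi> (s *\<^sub>R d) - exp (- stable_psi (s *\<^sub>R d))\<bar>" by blast
  obtain s0 where s0: "0 < s0" "\<And>s. 0 < s \<Longrightarrow> s \<le> s0 \<Longrightarrow> b / 2 \<le> f s" using at_right_0_lower[OF f(2,1)] by blast
  have "b / 2 * s powr min 2 (2 * \<alpha>) \<le> \<bar>\<phi> (s *\<^sub>R d) - exp (- stable_psi (s *\<^sub>R d))\<bar>" if "0 < s" "s \<le> s0" for s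
  proof -
    have "b / 2 * s powr min 2 (2 * \<alpha>) \<le> f s * s powr min 2 (2 * \<alpha>)" using s0(2)[OF that] by (intro mult_right_mono) auto
    then show ?thesis using f(3)[OF that(1)] by linarith
  qed
  then show ?thesis using Z0 f(1) s0(1) by (intro exI[of _ d] exI[of _ "b / 2"] exI[of _ s0]) auto
qed

text \<open>One frequency serves every n: \<open>l\<close> is scaled so that the rescaled argument
  s1 n^(-1/\<alpha>) e lies in the range of \<open>phi_exp_gap\<close> already for n = 1. The gap
  s^q of one factor, multiplied by n through the powers, is of order n^(1 - q/\<alpha>) =
  n^(-rate).\<close>

lemma char_gap:
  "\<exists>c>0. \<exists>l::'a. \<forall>n\<ge>1. c * real n powr (- rate) \<le>
    \<bar>\<phi> ((1 / (real n powr (1 / \<alpha>) * stable_scale 1 \<alpha>)) *\<^sub>R l) ^ n - exp (- sphere_moment \<alpha> l)\<bar>"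
proof -
  obtain e :: 'a and c s0 where e: "0 < stable_psi e" "0 < c" "0 < s0"
     "\<And>s. 0 < s \<Longrightarrow> s \<le> s0 \<Longrightarrow> c * s powr min 2 (2 * \<alpha>) \<le> \<bar>\<phi> (s *\<^sub>R e) - exp (- stable_psi (s *\<^sub>R e))\<bar>"
    using phi_exp_gap by blast
  define q where "q = min 2 (2 * \<alpha>)"
  define \<sigma> where "\<sigma> = stable_scale 1 \<alpha>"
  have \<sigma>0: "0 < \<sigma>" using stable_scale_pos[OF \<alpha>] by (simp add: \<sigma>_def)
  \<comment> \<open>The second term of the minimum bounds n times the exponent of one factor by 1/2,
    which keeps the n-th power of the lower bound exp(-2 x) above exp(-1).\<close>
  define s1 where "s1 = min s0 ((1 / (2 * stable_psi e)) powr (1 / \<alpha>))"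
  have s1: "0 < s1" "s1 \<le> s0" using e by (auto simp: s1_def)
  have s1z: "s1 powr \<alpha> * stable_psi e \<le> 1 / 2"
  proof -
    have "s1 powr \<alpha> \<le> ((1 / (2 * stable_psi e)) powr (1 / \<alpha>)) powr \<alpha>"
      using \<alpha> s1 by (intro powr_mono2) (auto simp: s1_def)
    also have "\<dots> = 1 / (2 * stable_psi e)" using \<alpha> e by (simp add: powr_powr)
    finally have "s1 powr \<alpha> * stable_psi e \<le> 1 / (2 * stable_psi e) * stable_psi e" using e by (intro mult_right_mono) auto
    then show ?thesis using e by simp
  qed
  define l where "l = (s1 * \<sigma>) *\<^sub>R e"
  define c' where "c' = exp (- 1) * c * s1 powr q"
  have "c' * real n powr (- rate) \<le> \<bar>\<phi> ((1 / (real n powr (1 / \<alpha>) * \<sigma>)) *\<^sub>R l) ^ n - exp (- sphere_moment \<alpha> l)\<bar>" if n: "n \<ge> 1" for n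
  proof -
    define s where "s = s1 * real n powr (- (1 / \<alpha>))"
    have s: "0 < s" "s \<le> s0"
    proof -
      show "0 < s" using s1 n by (simp add: s_def)
      have "real n powr (- (1 / \<alpha>)) \<le> real n powr 0" using n \<alpha> by (intro powr_mono) auto
      then have "s \<le> s1 * 1" unfolding s_def using s1 n by (intro mult_left_mono) auto
      then show "s \<le> s0" using s1 by simp
    qed
    have arg: "(1 / (real n powr (1 / \<alpha>) * \<sigma>)) *\<^sub>R l = s *\<^sub>R e"
      using \<sigma>0 n by (simp add: l_def s_def powr_minus_divide)
    define x where "x = stable_psi (s *\<^sub>R e)"
    have sa: "s powr \<alpha> = s1 powr \<alpha> / real n"
    proof -
      have "s powr \<alpha> = s1 powr \<alpha> * (real n powr (- (1 / \<alpha>))) powr \<alpha>"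
        unfolding s_def by (rule powr_mult)
      moreover have "(real n powr (- (1 / \<alpha>))) powr \<alpha> = 1 / real n"
        unfolding powr_powr using n \<alpha> by (simp add: powr_minus_divide)
      ultimately show ?thesis by simp
    qed
    have nx: "real n * x = s1 powr \<alpha> * stable_psi e" using s n by (simp add: x_def stable_psi_scale sa)
    have x0: "0 \<le> x" by (simp add: x_def stable_psi_nonneg)
    have "1 * x \<le> real n * x" using n x0 by (intro mult_right_mono) auto
    then have x2: "x \<le> 1 / 2" using nx s1z by simp
    have ex: "exp (- sphere_moment \<alpha> l) = exp (- x) ^ n"
    proof -
      have "sphere_moment \<alpha> l = real n * x"
        using s1 \<sigma>0 unfolding nx l_def sphere_moment_scale by (simp add: powr_mult stable_psi_def \<sigma>_def abs_mult)
      then show ?thesis by (simp flip: exp_of_nat_mult)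
    qed
    \<comment> \<open>For 0 \<le> x \<le> 1/2 one has exp(-2 x) \<le> 1 - x, which makes exp(-2 x) a
      common lower bound of \<phi> and exp(-x).\<close>
    have mphi: "exp (- (2 * x)) \<le> \<phi> (s *\<^sub>R e)"
    proof -
      have "1 + 2 * x \<le> exp (2 * x)" by (rule exp_ge_add_one_self)
      then have "(1 - x) * exp (2 * x) \<ge> (1 - x) * (1 + 2 * x)" using x2 by (intro mult_left_mono) auto
      moreover have "(1 - x) * (1 + 2 * x) \<ge> 1" using x0 x2 mult_left_mono[of x "1/2" x] by (simp add: algebra_simps)
      ultimately have "1 \<le> (1 - x) * exp (2 * x)" by linarith
      then have "exp (- (2 * x)) \<le> 1 - x" by (simp add: exp_minus field_simps)
      also have "1 - x \<le> \<phi> (s *\<^sub>R e)" using phi_expansion(1)[of "s *\<^sub>R e"] by (simp add: x_def)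
      finally show ?thesis .
    qed
    have "real n * exp (- (2 * x)) ^ n * \<bar>\<phi> (s *\<^sub>R e) - exp (- x)\<bar> \<le> \<bar>\<phi> (s *\<^sub>R e) ^ n - exp (- x) ^ n\<bar>"
      using x0 mphi by (intro power_diff_ge) auto
    moreover have "exp (- 1) \<le> exp (- (2 * x)) ^ n"
      using nx s1z by (simp flip: exp_of_nat_mult)
    moreover have "c * s powr q \<le> \<bar>\<phi> (s *\<^sub>R e) - exp (- x)\<bar>"
      using e(4)[OF s] by (simp add: q_def x_def)
    ultimately have "real n * exp (- 1) * (c * s powr q) \<le> \<bar>\<phi> (s *\<^sub>R e) ^ n - exp (- x) ^ n\<bar>"
      by (elim order_trans[rotated] , intro mult_mono) (use e in auto)
    moreover have "real n * exp (- 1) * (c * s powr q) = c' * real n powr (- rate)"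
    proof -
      have "- rate = 1 + - (q / \<alpha>)" using \<alpha> by (auto simp: rate_def q_def min_def field_simps)
      then have "real n powr (- rate) = real n * real n powr (- (q / \<alpha>))"
        using n by (simp only: powr_add powr_one)
      moreover have "s powr q = s1 powr q * real n powr (- (q / \<alpha>))"
        using s1 n by (simp add: s_def powr_mult powr_powr)
      ultimately show ?thesis by (simp add: c'_def)
    qed
    ultimately show ?thesis unfolding arg ex by simp
  qed
  moreover have "0 < c'" using e s1 by (simp add: c'_def)
  ultimately show ?thesis unfolding \<sigma>_def by blast
qed

lemma rate_bounds:
  assumes \<mu>: "\<And>n. n \<ge> 1 \<Longrightarrow> sum_law (stable_scale 1 \<alpha>) n (\<mu> n)"
  shows "\<exists>C c. C > 0 \<and> c > 0 \<and> (\<forall>n::nat. n \<ge> 1 \<longrightarrow>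
    c * real n powr (- rate) \<le> d_TV (\<mu> n) (stable_law \<alpha> uniform_sphere) \<and>
    d_TV (\<mu> n) (stable_law \<alpha> uniform_sphere) \<le> C * real n powr (- rate))"
proof -
  obtain C where C: "0 \<le> C" "\<And>n. n \<ge> 1 \<Longrightarrow> \<exists>h. prob_density h \<and> d_TV (\<mu> n) (density lborel h) \<le> C * real n powr (- rate) \<and>
     (\<forall>g. bdd_borel 1 g \<longrightarrow> (\<lambda>j. LINT x|\<mu> (n * 2 ^ j). g x) \<longlonglongrightarrow> (LINT x|density lborel h. g x))"
    using sum_law_limit[OF \<mu> stable_scale_pos[OF \<alpha>]] by blast
  have lim: "(\<lambda>j. LINT x|\<mu> (n * 2 ^ j). cos (l \<bullet> x)) \<longlonglongrightarrow> exp (- sphere_moment \<alpha> l)" if n: "n \<ge> 1" for n l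
  proof -
    have sub: "filterlim (\<lambda>j. n * 2 ^ j) sequentially sequentially"
      using n by (intro filterlim_subseq) (auto simp: strict_mono_def)
    have pos: "n * 2 ^ j \<ge> 1" for j using n by simp
    show ?thesis using filterlim_compose[OF phi_pow_limit[OF refl, of l] sub] by (simp only: sum_law_char(1)[OF \<mu>[OF pos]])
  qed
  \<comment> \<open>From whichever n the doubling starts, the limit has the characteristic function
    of the stable law, so all densities h give the same measure.\<close>
  have st: "stable_law \<alpha> uniform_sphere = density lborel (\<lambda>x. ennreal (h x))"
    if n: "n \<ge> 1" and h: "prob_density h" "\<And>g. bdd_borel 1 g \<Longrightarrow> (\<lambda>j. LINT x|\<mu> (n * 2 ^ j). g x) \<longlonglongrightarrow> (LINT x|density lborel h. g x)" for n h
  proof (rule stable_law_eqI)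
    fix l :: 'a
    have pos: "n * 2 ^ j \<ge> 1" for j using n by simp
    show "(LINT x|density lborel h. cos (l \<bullet> x)) = exp (- sphere_moment \<alpha> l)"
      using LIMSEQ_unique[OF h(2)[OF bdd_cos_sin(1)] lim[OF n]] .
    have "(\<lambda>j. LINT x|\<mu> (n * 2 ^ j). sin (l \<bullet> x)) \<longlonglongrightarrow> 0"
      by (simp only: sum_law_char(2)[OF \<mu>[OF pos]] tendsto_const)
    with h(2)[OF bdd_cos_sin(2)[of l]] show "(LINT x|density lborel h. sin (l \<bullet> x)) = 0"
      using LIMSEQ_unique by blast
  qed (use \<alpha> prob_space_density[OF h(1)] in auto)
  obtain c and l :: 'a where c: "0 < c" "\<And>n. n \<ge> 1 \<Longrightarrow> c * real n powr (- rate) \<le>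
    \<bar>\<phi> ((1 / (real n powr (1 / \<alpha>) * stable_scale 1 \<alpha>)) *\<^sub>R l) ^ n - exp (- sphere_moment \<alpha> l)\<bar>"
    using char_gap by blast
  \<comment> \<open>The factor 1/2 comes from \<open>d_TV_ge\<close>; since \<open>C\<close> may be
    0, the upper constant is raised to C + 1.\<close>
  have "c / 2 * real n powr (- rate) \<le> d_TV (\<mu> n) (stable_law \<alpha> uniform_sphere) \<and>
    d_TV (\<mu> n) (stable_law \<alpha> uniform_sphere) \<le> (C + 1) * real n powr (- rate)" if n: "n \<ge> 1" for n
  proof
    obtain h where h: "prob_density h" "d_TV (\<mu> n) (density lborel h) \<le> C * real n powr (- rate)"
     "\<And>g. bdd_borel 1 g \<Longrightarrow> (\<lambda>j. LINT x|\<mu> (n * 2 ^ j). g x) \<longlonglongrightarrow> (LINT x|density lborel h. g x)"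
      using C(2)[OF n] by blast
    note st' = st[OF n h(1,3)]
    have "C * real n powr (- rate) \<le> (C + 1) * real n powr (- rate)" by (intro mult_right_mono) auto
    then show "d_TV (\<mu> n) (stable_law \<alpha> uniform_sphere) \<le> (C + 1) * real n powr (- rate)"
      using h(2) st' by simp
    have "(LINT x|density lborel h. cos (l \<bullet> x)) = exp (- sphere_moment \<alpha> l)"
      using LIMSEQ_unique[OF h(3)[OF bdd_cos_sin(1)] lim[OF n]] .
    moreover have "\<bar>(LINT x|\<mu> n. cos (l \<bullet> x)) - (LINT x|density lborel h. cos (l \<bullet> x))\<bar> \<le> 2 * d_TV (\<mu> n) (density lborel h)"
      using \<mu>[OF n] prob_space_density[OF h(1)] bdd_cos_sin(1)[of l]
      by (intro d_TV_ge) (auto simp: sum_law_def bdd_borel_def)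
    ultimately have "c / 2 * real n powr (- rate) \<le> d_TV (\<mu> n) (density lborel h)"
      using c(2)[OF n] unfolding sum_law_char(1)[OF \<mu>[OF n]] by linarith
    then show "c / 2 * real n powr (- rate) \<le> d_TV (\<mu> n) (stable_law \<alpha> uniform_sphere)"
      using st' by simp
  qed
  then show ?thesis using C(1) c(1) by (intro exI[of _ "C + 1"] exI[of _ "c / 2"]) auto
qed

end

theorem theorem1p2:
  fixes M :: "'w measure"
    and X :: "nat \<Rightarrow> 'w \<Rightarrow> real ^ 'd"
    and \<alpha> :: real
  assumes "0 < \<alpha>" "\<alpha> < 2"
    and "prob_space M"
    and "prob_space.indep_vars M (\<lambda>_. borel) X {1..}"
    and "\<And>i. i \<ge> 1 \<Longrightarrow> distributed M lborel (X i) (\<lambda>x. ennreal (pareto_density \<alpha> x))"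
  shows "\<exists>C c. C > 0 \<and> c > 0 \<and>
    (\<forall>n::nat. n \<ge> 1 \<longrightarrow>
      c * real n powr (- (min (2 - \<alpha>) \<alpha> / \<alpha>)) \<le>
        d_TV (distr M borel (normalized_sum M X (stable_scale 1 \<alpha>) \<alpha> n))
             (stable_law \<alpha> uniform_sphere) \<and>
      d_TV (distr M borel (normalized_sum M X (stable_scale 1 \<alpha>) \<alpha> n))
           (stable_law \<alpha> uniform_sphere)
        \<le> C * real n powr (- (min (2 - \<alpha>) \<alpha> / \<alpha>)))"
proof -
  interpret pareto \<alpha> "pareto_density \<alpha> :: real ^ 'd \<Rightarrow> real"
    by standard (use assms in auto)
  show ?thesis
    using rate_bounds[OF sum_law_normalized_sum[OF assms(3-5)]] unfolding rate_def .
qed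

end
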